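(* ($\mathsf{WKL_0}$) For every rationally presented function $f:[0,1]_{\mathbb{Q}}\to\mathbb{R}$ of bounded variation, there is a rationally presented non-decreasing function $g:[0,1]_{\mathbb{Q}}\to\mathbb{R}$ such that $f\le^*_{\mathsf{slope}} g$.
   Context: $[0,1]_{\mathbb{Q}}=[0,1]\cap\mathbb{Q}$. A set $Z\subseteq[0,1]_{\mathbb{Q}}\times\mathbb{Q}$ is a rational presentation if (i) for every $p\in[0,1]_{\mathbb{Q}}$ there are $q,q'$ with $(p,q)\in Z$, $(p,q')\notin Z$, and (ii) for all $p$ and $q<q'$, $(p,q)\in Z$ implies $(p,q')\in Z$. It determines $g_Z(p)=\inf\{q:(p,q)\in Z\}$; a rationally presented function is one of the form $g_Z$ (given by $Z$). For a partition $\Pi=\{t_0<\dots<t_n\}$ of $[0,1]$ with rational points, $V(f,\Pi)=\sum_{i<n}|f(t_{i+1})-f(t_i)|$; $f$ is of bounded variation if there is $k\in\mathbb{N}$ with $V(f,\Pi)\le k$ for all such partitions. For $f,g$ defined on $[0,1]_{\mathbb{Q}}$, $f\le^*_{\mathsf{slope}}g$ means: for all $x<y$ in $[0,1]_{\mathbb{Q}}$, $f(y)-f(x)\le g(y)-g(x)$. *)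

theory Defs
  imports Main
begin

text \<open>
  A theorem of the form ``(\<open>WKL\<^sub>0\<close>) \<open>\<phi>\<close>'' says that \<open>\<phi>\<close> is provable in the subsystem \<open>WKL\<^sub>0\<close> of
  second-order arithmetic, i.e. (completeness for the two-sorted language) that \<open>\<phi>\<close> holds in all,
  possibly nonstandard, models of \<open>WKL\<^sub>0\<close>.  Below, a structure for the language of second-order
  arithmetic has the whole type \<open>'a\<close> as its first-order part and a family of subsets of \<open>'a\<close> as its
  second-order part; \<open>WKL\<^sub>0\<close> and all analytic notions are interpreted inside such a structure.
  Axioms and codings follow Simpson, Subsystems of Second Order Arithmetic.
\<close>

record 'a l2_structure =
  zer :: 'a ("\<zero>\<index>")
  one :: 'a ("\<one>\<index>")
  plus :: "'a \<Rightarrow> 'a \<Rightarrow> 'a" (infixl "\<oplus>\<index>" 65)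
  times :: "'a \<Rightarrow> 'a \<Rightarrow> 'a" (infixl "\<otimes>\<index>" 70)
  less :: "'a \<Rightarrow> 'a \<Rightarrow> bool" (infix "\<prec>\<index>" 50)
  Sets :: "'a set set"

text \<open>Terms and \<open>\<Sigma>\<^sup>0\<^sub>0\<close> formulas (bounded number quantifiers, free set variables allowed).\<close>

datatype trm = Var nat | Zero | One | Add trm trm | Mul trm trm

datatype fm0 =
    Eq trm trm
  | Less trm trm
  | Mem trm nat
  | Neg fm0
  | Conj fm0 fm0
  | BAll nat trm fm0

locale l2 =
  fixes M :: "'a l2_structure" (structure)
begin

primrec eval :: "(nat \<Rightarrow> 'a) \<Rightarrow> trm \<Rightarrow> 'a" where
  "eval e (Var x) = e x"
| "eval e Zero = \<zero>"
| "eval e One = \<one>"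
| "eval e (Add t u) = eval e t \<oplus> eval e u"
| "eval e (Mul t u) = eval e t \<otimes> eval e u"

text \<open>\<open>BAll x t \<phi>\<close> is \<open>\<forall>x < t. \<phi>\<close>; the bound \<open>t\<close> is evaluated outside the scope of \<open>x\<close>.\<close>

primrec sat :: "(nat \<Rightarrow> 'a) \<Rightarrow> (nat \<Rightarrow> 'a set) \<Rightarrow> fm0 \<Rightarrow> bool" where
  "sat e s (Eq t u) \<longleftrightarrow> eval e t = eval e u"
| "sat e s (Less t u) \<longleftrightarrow> eval e t \<prec> eval e u"
| "sat e s (Mem t X) \<longleftrightarrow> eval e t \<in> s X"
| "sat e s (Neg \<phi>) \<longleftrightarrow> \<not> sat e s \<phi>"
| "sat e s (Conj \<phi> \<psi>) \<longleftrightarrow> sat e s \<phi> \<and> sat e s \<psi>"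
| "sat e s (BAll x t \<phi>) \<longleftrightarrow> (\<forall>a. a \<prec> eval e t \<longrightarrow> sat (e(x := a)) s \<phi>)"

text \<open>
  \<open>P n\<close> is given by a \<open>\<Sigma>\<^sup>0\<^sub>1\<close> formula \<open>\<exists>m. \<theta>(n, m)\<close> with number parameters and with set parameters
  from the second-order part.  Up to renaming, \<open>n\<close> and \<open>m\<close> are variables 0 and 1.
\<close>

definition Sigma1 :: "('a \<Rightarrow> bool) \<Rightarrow> bool" where
  "Sigma1 P \<longleftrightarrow> (\<exists>\<theta> e s. range s \<subseteq> Sets M \<and> (\<forall>n. P n \<longleftrightarrow> (\<exists>m. sat (e(0 := n, 1 := m)) s \<theta>)))"

definition Pi1 :: "('a \<Rightarrow> bool) \<Rightarrow> bool" where
  "Pi1 P \<longleftrightarrow> Sigma1 (\<lambda>n. \<not> P n)"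

definition basic_axioms :: bool where
  "basic_axioms \<longleftrightarrow>
     (\<forall>n. n \<oplus> \<one> \<noteq> \<zero>) \<and>
     (\<forall>m n. m \<oplus> \<one> = n \<oplus> \<one> \<longrightarrow> m = n) \<and>
     (\<forall>m. m \<oplus> \<zero> = m) \<and>
     (\<forall>m n. m \<oplus> (n \<oplus> \<one>) = (m \<oplus> n) \<oplus> \<one>) \<and>
     (\<forall>m. m \<otimes> \<zero> = \<zero>) \<and>
     (\<forall>m n. m \<otimes> (n \<oplus> \<one>) = (m \<otimes> n) \<oplus> m) \<and>
     (\<forall>m. \<not> m \<prec> \<zero>) \<and>
     (\<forall>m n. m \<prec> n \<oplus> \<one> \<longleftrightarrow> m \<prec> n \<or> m = n)"

definition Sigma1_induction :: bool where
  "Sigma1_induction \<longleftrightarrow>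
     (\<forall>P. Sigma1 P \<longrightarrow> P \<zero> \<longrightarrow> (\<forall>n. P n \<longrightarrow> P (n \<oplus> \<one>)) \<longrightarrow> (\<forall>n. P n))"

definition Delta1_comprehension :: bool where
  "Delta1_comprehension \<longleftrightarrow> (\<forall>P. Sigma1 P \<longrightarrow> Pi1 P \<longrightarrow> {n. P n} \<in> Sets M)"

text \<open>
  The second-order part has to be required nonempty, because \<^const>\<open>Sigma1\<close> interprets all set
  variables, including those that do not occur in the formula.
\<close>

definition RCA0 :: bool where
  "RCA0 \<longleftrightarrow> Sets M \<noteq> {} \<and> basic_axioms \<and> Sigma1_induction \<and> Delta1_comprehension"

definition leq :: "'a \<Rightarrow> 'a \<Rightarrow> bool" (infix "\<preceq>" 50) where
  "m \<preceq> n \<longleftrightarrow> m \<prec> n \<or> m = n"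

definition divides :: "'a \<Rightarrow> 'a \<Rightarrow> bool" where
  "divides d n \<longleftrightarrow> (\<exists>q. n = d \<otimes> q)"

definition pair :: "'a \<Rightarrow> 'a \<Rightarrow> 'a" where
  "pair i j = (i \<oplus> j) \<otimes> (i \<oplus> j) \<oplus> i"

text \<open>
  Finite sets are coded by triples \<open>(k, m, n)\<close>, standing for
  \<open>{i. i < k \<and> m (i + 1) + 1 divides n}\<close>; the code of a finite set is the least such triple.
\<close>

definition is_triple :: "'a \<Rightarrow> bool" where
  "is_triple c \<longleftrightarrow> (\<exists>k m n. c = pair (pair k m) n)"

definition decode :: "'a \<Rightarrow> 'a set" where
  "decode c = {i. \<exists>k m n. c = pair (pair k m) n \<and> i \<prec> k \<and> divides (m \<otimes> (i \<oplus> \<one>) \<oplus> \<one>) n}"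

definition is_finset_code :: "'a \<Rightarrow> bool" where
  "is_finset_code c \<longleftrightarrow>
     is_triple c \<and> (\<forall>c'. c' \<prec> c \<longrightarrow> is_triple c' \<longrightarrow> decode c' \<noteq> decode c)"

text \<open>\<open>is_seq c l\<close>: \<open>c\<close> is the code of a finite sequence of length \<open>l\<close>.\<close>

definition is_seq :: "'a \<Rightarrow> 'a \<Rightarrow> bool" where
  "is_seq c l \<longleftrightarrow>
     is_finset_code c \<and>
     (\<forall>z \<in> decode c. \<exists>i j. i \<prec> l \<and> z = pair i j) \<and>
     (\<forall>i. i \<prec> l \<longrightarrow> (\<exists>!j. pair i j \<in> decode c))"

definition entry :: "'a \<Rightarrow> 'a \<Rightarrow> 'a" where
  "entry c i = (THE j. pair i j \<in> decode c)"

definition is_binseq :: "'a \<Rightarrow> 'a \<Rightarrow> bool" where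
  "is_binseq c l \<longleftrightarrow> is_seq c l \<and> (\<forall>i. i \<prec> l \<longrightarrow> entry c i = \<zero> \<or> entry c i = \<one>)"

definition is_bintree :: "'a set \<Rightarrow> bool" where
  "is_bintree T \<longleftrightarrow>
     T \<in> Sets M \<and>
     (\<forall>\<sigma> \<in> T. \<exists>l. is_binseq \<sigma> l) \<and>
     (\<forall>\<sigma> \<in> T. \<forall>l \<tau> k. is_binseq \<sigma> l \<longrightarrow> k \<preceq> l \<longrightarrow> is_binseq \<tau> k \<longrightarrow>
        (\<forall>i. i \<prec> k \<longrightarrow> entry \<tau> i = entry \<sigma> i) \<longrightarrow> \<tau> \<in> T)"

definition infinite_set :: "'a set \<Rightarrow> bool" where
  "infinite_set X \<longleftrightarrow> (\<forall>k. \<exists>n \<in> X. k \<preceq> n)"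

text \<open>A function is a set of pairs; all initial segments of a path lie on the tree.\<close>

definition is_fun :: "'a set \<Rightarrow> bool" where
  "is_fun F \<longleftrightarrow> F \<in> Sets M \<and> (\<forall>z \<in> F. \<exists>i j. z = pair i j) \<and> (\<forall>i. \<exists>!j. pair i j \<in> F)"

definition is_path :: "'a set \<Rightarrow> 'a set \<Rightarrow> bool" where
  "is_path F T \<longleftrightarrow>
     is_fun F \<and> (\<forall>n. \<exists>\<sigma> \<in> T. is_seq \<sigma> n \<and> (\<forall>i. i \<prec> n \<longrightarrow> pair i (entry \<sigma> i) \<in> F))"

definition weak_koenig :: bool where
  "weak_koenig \<longleftrightarrow> (\<forall>T. is_bintree T \<longrightarrow> infinite_set T \<longrightarrow> (\<exists>F. is_path F T))"

definition WKL0 :: bool where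
  "WKL0 \<longleftrightarrow> RCA0 \<and> weak_koenig"

text \<open>
  Rationals of the model.  The fraction \<open>(a, b, d)\<close> with \<open>d \<noteq> 0\<close> denotes \<open>(a - b) / d\<close>, and a
  rational number is the least code of a fraction in its equivalence class, so that equality of
  rationals is equality of elements.
\<close>

type_synonym 'b frac = "'b \<times> 'b \<times> 'b"

fun is_frac :: "'a frac \<Rightarrow> bool" where
  "is_frac (a, b, d) \<longleftrightarrow> d \<noteq> \<zero>"

fun frac_code :: "'a frac \<Rightarrow> 'a" where
  "frac_code (a, b, d) = pair (pair a b) d"

fun frac_eq :: "'a frac \<Rightarrow> 'a frac \<Rightarrow> bool" where
  "frac_eq (a, b, d) (a', b', d') \<longleftrightarrow> a \<otimes> d' \<oplus> b' \<otimes> d = a' \<otimes> d \<oplus> b \<otimes> d'"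

fun frac_less :: "'a frac \<Rightarrow> 'a frac \<Rightarrow> bool" where
  "frac_less (a, b, d) (a', b', d') \<longleftrightarrow> a \<otimes> d' \<oplus> b' \<otimes> d \<prec> a' \<otimes> d \<oplus> b \<otimes> d'"

fun frac_add :: "'a frac \<Rightarrow> 'a frac \<Rightarrow> 'a frac" where
  "frac_add (a, b, d) (a', b', d') = (a \<otimes> d' \<oplus> a' \<otimes> d, b \<otimes> d' \<oplus> b' \<otimes> d, d \<otimes> d')"

fun frac_minus :: "'a frac \<Rightarrow> 'a frac" where
  "frac_minus (a, b, d) = (b, a, d)"

definition is_rat :: "'a \<Rightarrow> bool" where
  "is_rat c \<longleftrightarrow>
     (\<exists>t. is_frac t \<and> c = frac_code t \<and>
        (\<forall>t'. is_frac t' \<longrightarrow> frac_eq t' t \<longrightarrow> \<not> frac_code t' \<prec> c))"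

definition Rats :: "'a set" where
  "Rats = {c. is_rat c}"

definition frac_of :: "'a \<Rightarrow> 'a frac" where
  "frac_of c = (THE t. is_frac t \<and> c = frac_code t)"

definition rat_of :: "'a frac \<Rightarrow> 'a" where
  "rat_of t = (THE c. is_rat c \<and> frac_eq (frac_of c) t)"

definition rat_nat :: "'a \<Rightarrow> 'a" where
  "rat_nat k = rat_of (k, \<zero>, \<one>)"

definition rat_add :: "'a \<Rightarrow> 'a \<Rightarrow> 'a" where
  "rat_add p q = rat_of (frac_add (frac_of p) (frac_of q))"

definition rat_minus :: "'a \<Rightarrow> 'a" where
  "rat_minus p = rat_of (frac_minus (frac_of p))"

definition rat_less :: "'a \<Rightarrow> 'a \<Rightarrow> bool" (infix "<\<^sub>q" 50) where
  "p <\<^sub>q q \<longleftrightarrow> frac_less (frac_of p) (frac_of q)"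

definition rat_le :: "'a \<Rightarrow> 'a \<Rightarrow> bool" (infix "\<le>\<^sub>q" 50) where
  "p \<le>\<^sub>q q \<longleftrightarrow> p <\<^sub>q q \<or> p = q"

text \<open>The interval \<open>[0,1]\<^sub>\<rat>\<close>.\<close>

definition unit_rats :: "'a set" where
  "unit_rats = {p \<in> Rats. rat_nat \<zero> \<le>\<^sub>q p \<and> p \<le>\<^sub>q rat_nat \<one>}"

text \<open>
  Reals of the model are Dedekind cuts in its rationals: \<open>x\<close> is represented by
  \<open>{r. r rational, x < r}\<close>.  The operations below are the usual ones on such cuts.  In particular
  \<open>- x < r\<close> iff \<open>- s < r\<close> for some rational \<open>s \<le> x\<close>, i.e. some \<open>s\<close> outside the cut of \<open>x\<close>.
\<close>

definition real_nat :: "'a \<Rightarrow> 'a set" where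
  "real_nat k = {r \<in> Rats. rat_nat k <\<^sub>q r}"

definition real_le :: "'a set \<Rightarrow> 'a set \<Rightarrow> bool" (infix "\<le>\<^sub>r" 50) where
  "x \<le>\<^sub>r y \<longleftrightarrow> y \<subseteq> x"

definition real_add :: "'a set \<Rightarrow> 'a set \<Rightarrow> 'a set" where
  "real_add x y = {rat_add r s | r s. r \<in> x \<and> s \<in> y}"

definition real_minus :: "'a set \<Rightarrow> 'a set" where
  "real_minus x = {r \<in> Rats. \<exists>s \<in> Rats. s \<notin> x \<and> rat_minus s <\<^sub>q r}"

definition real_diff :: "'a set \<Rightarrow> 'a set \<Rightarrow> 'a set" where
  "real_diff x y = real_add x (real_minus y)"

definition real_abs :: "'a set \<Rightarrow> 'a set" where
  "real_abs x = x \<inter> real_minus x"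

text \<open>
  Sums of a length \<open>n\<close> that may be a nonstandard element of the model have to be formed inside the
  model.  \<open>rat_sum c n s\<close>: the rational \<open>s\<close> is the sum of the coded sequence \<open>c\<close> of \<open>n\<close> rationals,
  as witnessed by the coded sequence \<open>w\<close> of its partial sums.  A sum of \<open>n\<close> reals \<open>x i\<close> is less
  than \<open>r\<close> iff some coded sequence of rationals \<open>c i > x i\<close> has a sum less than \<open>r\<close>.
\<close>

definition rat_sum :: "'a \<Rightarrow> 'a \<Rightarrow> 'a \<Rightarrow> bool" where
  "rat_sum c n s \<longleftrightarrow>
     (\<exists>w. is_seq w (n \<oplus> \<one>) \<and> entry w \<zero> = rat_nat \<zero> \<and>
        (\<forall>i. i \<prec> n \<longrightarrow> entry w (i \<oplus> \<one>) = rat_add (entry w i) (entry c i)) \<and>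
        entry w n = s)"

definition real_sum :: "('a \<Rightarrow> 'a set) \<Rightarrow> 'a \<Rightarrow> 'a set" where
  "real_sum x n =
     {r \<in> Rats. \<exists>c s. is_seq c n \<and> (\<forall>i. i \<prec> n \<longrightarrow> entry c i \<in> x i) \<and> rat_sum c n s \<and> s <\<^sub>q r}"

definition rational_presentation :: "'a set \<Rightarrow> bool" where
  "rational_presentation Z \<longleftrightarrow>
     Z \<in> Sets M \<and>
     (\<forall>z \<in> Z. \<exists>p \<in> unit_rats. \<exists>q \<in> Rats. z = pair p q) \<and>
     (\<forall>p \<in> unit_rats. \<exists>q \<in> Rats. \<exists>q' \<in> Rats. pair p q \<in> Z \<and> pair p q' \<notin> Z) \<and>
     (\<forall>p \<in> unit_rats. \<forall>q \<in> Rats. \<forall>q' \<in> Rats. q <\<^sub>q q' \<longrightarrow> pair p q \<in> Z \<longrightarrow> pair p q' \<in> Z)"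

text \<open>
  \<open>g\<^sub>Z(p) = inf {q. (p, q) \<in> Z}\<close> as a cut: \<open>inf A < r\<close> iff some element of \<open>A\<close> is below \<open>r\<close>.
\<close>

definition presented_fun :: "'a set \<Rightarrow> 'a \<Rightarrow> 'a set" where
  "presented_fun Z p = {r \<in> Rats. \<exists>q \<in> Rats. pair p q \<in> Z \<and> q <\<^sub>q r}"

definition rationally_presented :: "('a \<Rightarrow> 'a set) \<Rightarrow> bool" where
  "rationally_presented f \<longleftrightarrow> (\<exists>Z. rational_presentation Z \<and> f = presented_fun Z)"

text \<open>\<open>is_partition t n\<close>: \<open>t\<close> codes a partition \<open>0 = t 0 < ... < t n = 1\<close> with rational points.\<close>

definition is_partition :: "'a \<Rightarrow> 'a \<Rightarrow> bool" where
  "is_partition t n \<longleftrightarrow>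
     is_seq t (n \<oplus> \<one>) \<and>
     (\<forall>i. i \<preceq> n \<longrightarrow> entry t i \<in> unit_rats) \<and>
     entry t \<zero> = rat_nat \<zero> \<and> entry t n = rat_nat \<one> \<and>
     (\<forall>i. i \<prec> n \<longrightarrow> entry t i <\<^sub>q entry t (i \<oplus> \<one>))"

definition variation :: "('a \<Rightarrow> 'a set) \<Rightarrow> 'a \<Rightarrow> 'a \<Rightarrow> 'a set" where
  "variation f t n =
     real_sum (\<lambda>i. real_abs (real_diff (f (entry t (i \<oplus> \<one>))) (f (entry t i)))) n"

definition bounded_variation :: "('a \<Rightarrow> 'a set) \<Rightarrow> bool" where
  "bounded_variation f \<longleftrightarrow>
     (\<exists>k. \<forall>t n. is_partition t n \<longrightarrow> variation f t n \<le>\<^sub>r real_nat k)"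

definition nondecreasing :: "('a \<Rightarrow> 'a set) \<Rightarrow> bool" where
  "nondecreasing f \<longleftrightarrow>
     (\<forall>x \<in> unit_rats. \<forall>y \<in> unit_rats. x <\<^sub>q y \<longrightarrow> f x \<le>\<^sub>r f y)"

definition slope_le :: "('a \<Rightarrow> 'a set) \<Rightarrow> ('a \<Rightarrow> 'a set) \<Rightarrow> bool" where
  "slope_le f g \<longleftrightarrow>
     (\<forall>x \<in> unit_rats. \<forall>y \<in> unit_rats. x <\<^sub>q y \<longrightarrow>
        real_diff (f y) (f x) \<le>\<^sub>r real_diff (g y) (g x))"

end

end

theory Submission
  imports Defs
begin

text \<open>
  The variation of \<open>f\<close> on \<open>[0, x]\<close> would be a majorant, but it need not exist in a model of \<open>WKL\<^sub>0\<close>.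
  However, that \<open>g\<close> is non-decreasing, bounded by \<open>0\<close> and \<open>k + 1\<close>, and satisfies \<open>f \<le> g\<close> in slope is a
  \<open>\<Pi>\<^sup>0\<^sub>1\<close> condition on a presentation of \<open>g\<close>, where \<open>k\<close> bounds the variation of \<open>f\<close>.  By weak
  Koenig's lemma it suffices to satisfy the part of it that concerns codes below \<open>n\<close>.  Take \<open>N\<close>
  divisible by all positive numbers below \<open>n\<close>, so that all points concerned lie on the grid \<open>i / N\<close>.
  Bounded variation for this partition yields a coded sequence of rationals \<open>c i\<close>, each larger than
  \<open>\<bar>f ((i + 1) / N) - f (i / N)\<bar>\<close>, of sum below \<open>k + 1\<close>; its partial sums serve as the values of \<open>g\<close> on
  the grid.  Neither the values of \<open>f\<close> nor its variation have to be computed.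
\<close>

section \<open>Bounded formulas with parameters\<close>

text \<open>The type \<open>'a\<close> may be nonstandard, so HOL induction over numbers is not at
  hand: every induction, least element or set inside the model has to come from a formula of low
  complexity. Definability is therefore tracked semantically by \<open>is_term\<close> and
  \<open>Delta0\<close>, whose closure rules follow the shape of a HOL statement. A second obstacle
  is that f p is not given as a rational: only rationals a outside Z (so a \<le> f p) and d inside Z
  (so f p \<le> d) are visible. The slope inequality for the partial sums thus quantifies over all
  such a and d, and it is proved by \<open>\<Pi>\<^sup>0\<^sub>1\<close> induction along the grid.
  The same pairs (a, d) turn the slope condition on g into clauses about two membership bits of a
  presentation of g, each clause witnessed by a number; this is what a node of a tree can
  test.\<close>

primrec rename_trm :: "(nat \<Rightarrow> nat) \<Rightarrow> trm \<Rightarrow> trm" where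
  "rename_trm \<pi> (Var x) = Var (\<pi> x)"
| "rename_trm \<pi> Zero = Zero"
| "rename_trm \<pi> One = One"
| "rename_trm \<pi> (Add t u) = Add (rename_trm \<pi> t) (rename_trm \<pi> u)"
| "rename_trm \<pi> (Mul t u) = Mul (rename_trm \<pi> t) (rename_trm \<pi> u)"

primrec rename_fm0 :: "(nat \<Rightarrow> nat) \<Rightarrow> (nat \<Rightarrow> nat) \<Rightarrow> fm0 \<Rightarrow> fm0" where
  "rename_fm0 \<pi> \<rho> (Eq t u) = Eq (rename_trm \<pi> t) (rename_trm \<pi> u)"
| "rename_fm0 \<pi> \<rho> (Less t u) = Less (rename_trm \<pi> t) (rename_trm \<pi> u)"
| "rename_fm0 \<pi> \<rho> (Mem t X) = Mem (rename_trm \<pi> t) (\<rho> X)"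
| "rename_fm0 \<pi> \<rho> (Neg \<phi>) = Neg (rename_fm0 \<pi> \<rho> \<phi>)"
| "rename_fm0 \<pi> \<rho> (Conj \<phi> \<psi>) = Conj (rename_fm0 \<pi> \<rho> \<phi>) (rename_fm0 \<pi> \<rho> \<psi>)"
| "rename_fm0 \<pi> \<rho> (BAll x t \<phi>) = BAll (\<pi> x) (rename_trm \<pi> t) (rename_fm0 \<pi> \<rho> \<phi>)"

text \<open>Even variables hold the environment, odd variables hold parameters.\<close>

definition mix :: "(nat \<Rightarrow> 'b) \<Rightarrow> (nat \<Rightarrow> 'b) \<Rightarrow> nat \<Rightarrow> 'b" where
  "mix e p n = (if even n then e (n div 2) else p (n div 2))"

text \<open>Together with \<open>right_param\<close>: parameter k moves to place 2k or 2k + 1 of a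
  merged parameter list, so that two formulas with parameters of their own can be read in one
  environment.\<close>

definition left_param :: "nat \<Rightarrow> nat" where
  "left_param n = (if even n then n else 2 * n - 1)"

definition right_param :: "nat \<Rightarrow> nat" where
  "right_param n = (if even n then n else 2 * n + 1)"

lemma inj_left_param: "inj left_param"
proof (rule inj_on_inverseI)
  fix n :: nat
  show "(if even (left_param n) then left_param n else (left_param n + 1) div 2) = n"
  proof (cases "even n")
    case False
    then obtain k where "n = 2 * k + 1" by (rule oddE)
    then show ?thesis by (simp add: left_param_def)
  qed (simp add: left_param_def)
qed

lemma inj_right_param: "inj right_param"
  by (rule inj_on_inverseI[of _ "\<lambda>n. if even n then n else (n - 1) div 2"])
    (simp add: right_param_def)

lemma mix_left_param: "mix e (mix p q) \<circ> left_param = mix e p"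
proof
  fix n
  show "(mix e (mix p q) \<circ> left_param) n = mix e p n"
  proof (cases "even n")
    case False
    then obtain k where "n = 2 * k + 1" by (rule oddE)
    moreover have "even (2 * k)" "(2 * (2 * k) + 1) div 2 = 2 * k" "2 * (2 * k + 1) - 1 = 2 * (2 * k) + (1::nat)"
      by simp_all
    ultimately show ?thesis by (simp add: mix_def left_param_def)
  qed (simp add: mix_def left_param_def)
qed

lemma mix_right_param: "mix e (mix p q) \<circ> right_param = mix e q"
proof
  fix n
  show "(mix e (mix p q) \<circ> right_param) n = mix e q n"
  proof (cases "even n")
    case False
    then obtain k where "n = 2 * k + 1" by (rule oddE)
    then show ?thesis by (simp add: mix_def right_param_def)
  qed (simp add: mix_def right_param_def)
qed

lemma range_mix: "range (mix p q) \<subseteq> range p \<union> range q"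
  by (auto simp: mix_def)

definition mix_l :: "nat \<Rightarrow> nat" where "mix_l n = 2 * n"
definition mix_r :: "nat \<Rightarrow> nat" where "mix_r n = 2 * n + 1"

lemma mix_l: "mix p q \<circ> mix_l = p" and mix_r: "mix p q \<circ> mix_r = q"
  by (auto simp: mix_def mix_l_def mix_r_def fun_eq_iff)

text \<open>Renames an environment variable pushed by a quantifier to a fresh parameter.\<close>

definition bind_param :: "nat \<Rightarrow> nat" where
  "bind_param n = (if n = 0 then 1 else if even n then n - 2 else n + 2)"

lemma inj_bind_param: "inj bind_param"
proof (rule inj_on_inverseI)
  fix n :: nat
  show "(if bind_param n = 1 then 0 else if even (bind_param n) then bind_param n + 2
    else bind_param n - 2) = n"
  proof (cases "even n")
    case True
    then obtain k where "n = 2 * k" by (rule evenE)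
    then show ?thesis by (cases k) (simp_all add: bind_param_def)
  qed (simp add: bind_param_def)
qed

definition push :: "'b \<Rightarrow> (nat \<Rightarrow> 'b) \<Rightarrow> nat \<Rightarrow> 'b" (infixr "##" 65) where
  "a ## e = case_nat a e"

lemma push_simps [simp]: "(a ## e) 0 = a" "(a ## e) (Suc n) = e n"
  by (simp_all add: push_def)

lemma push_eta [simp]: "(\<lambda>i. (a ## e) (Suc i)) = e"
  by simp

lemma mix_bind_param: "(mix e (b ## p))(1 := a) \<circ> bind_param = mix (a ## e) p"
proof
  fix n
  show "((mix e (b ## p))(1 := a) \<circ> bind_param) n = mix (a ## e) p n"
  proof (cases "even n")
    case True
    then obtain k where "n = 2 * k" by (rule evenE)
    then show ?thesis by (cases k) (simp_all add: mix_def bind_param_def)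
  next
    case False
    then obtain k where "n = 2 * k + 1" by (rule oddE)
    then show ?thesis by (simp add: mix_def bind_param_def)
  qed
qed

section \<open>Definable terms and bounded predicates of a structure\<close>

context l2
begin

lemma eval_rename: "eval e (rename_trm \<pi> t) = eval (e \<circ> \<pi>) t"
  by (induction t) auto

text \<open>Injectivity of \<pi> rules out capture: an update at the renamed bound variable must not
  touch the image of another variable.\<close>

lemma sat_rename: "inj \<pi> \<Longrightarrow> sat e s (rename_fm0 \<pi> \<rho> \<phi>) \<longleftrightarrow> sat (e \<circ> \<pi>) (s \<circ> \<rho>) \<phi>"
proof (induction \<phi> arbitrary: e)
  case (BAll x t \<phi>)
  have "(e(\<pi> x := a)) \<circ> \<pi> = (e \<circ> \<pi>)(x := a)" for a
    using BAll.prems by (auto simp: fun_eq_iff inj_eq)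
  then show ?case by (simp only: rename_fm0.simps sat.simps eval_rename BAll.IH[OF BAll.prems])
qed (auto simp: eval_rename)

definition is_term :: "((nat \<Rightarrow> 'a) \<Rightarrow> 'a) \<Rightarrow> bool" where
  "is_term f \<longleftrightarrow> (\<exists>t p. \<forall>e. f e = eval (mix e p) t)"

text \<open>Elements and sets of the model are hidden in \<open>p\<close> and \<open>s\<close>.
  Constants may thus occur freely in P, and the closure rules apply by \<open>intro\<close> to a HOL
  predicate on environments.\<close>

definition Delta0 :: "((nat \<Rightarrow> 'a) \<Rightarrow> bool) \<Rightarrow> bool" where
  "Delta0 P \<longleftrightarrow> (\<exists>\<phi> p s. range s \<subseteq> Sets M \<and> (\<forall>e. P e \<longleftrightarrow> sat (mix e p) s \<phi>))"

lemma term_var: "is_term (\<lambda>e. e i)"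
  unfolding is_term_def by (intro exI[of _ "Var (2 * i)"]) (simp add: mix_def)

lemma term_const: "is_term (\<lambda>e. a)"
  unfolding is_term_def by (intro exI[of _ "Var 1"] exI[of _ "\<lambda>_. a"]) (simp add: mix_def)

lemma is_term_join:
  assumes "is_term f" "is_term g"
  obtains t u p where "\<And>e. f e = eval (mix e p) t" "\<And>e. g e = eval (mix e p) u"
proof -
  from assms obtain t p u q where "\<And>e. f e = eval (mix e p) t" "\<And>e. g e = eval (mix e q) u"
    unfolding is_term_def by metis
  then show thesis
    by (intro that[of "mix p q" "rename_trm left_param t" "rename_trm right_param u"])
      (simp_all only: eval_rename mix_left_param mix_right_param)
qed

lemma term_add: "is_term f \<Longrightarrow> is_term g \<Longrightarrow> is_term (\<lambda>e. f e \<oplus> g e)"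
proof (erule (1) is_term_join)
  fix t u p
  assume "\<And>e. f e = eval (mix e p) t" "\<And>e. g e = eval (mix e p) u"
  then have "f e \<oplus> g e = eval (mix e p) (Add t u)" for e by simp
  then show ?thesis unfolding is_term_def by blast
qed

lemma term_mul: "is_term f \<Longrightarrow> is_term g \<Longrightarrow> is_term (\<lambda>e. f e \<otimes> g e)"
proof (erule (1) is_term_join)
  fix t u p
  assume "\<And>e. f e = eval (mix e p) t" "\<And>e. g e = eval (mix e p) u"
  then have "f e \<otimes> g e = eval (mix e p) (Mul t u)" for e by simp
  then show ?thesis unfolding is_term_def by blast
qed

text \<open>For use under a quantifier, where the bound variable has become 0 and the outer ones
  have moved up by one.\<close>

lemma term_shift: "is_term f \<Longrightarrow> is_term (\<lambda>e. f (\<lambda>i. e (Suc i)))"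
proof -
  assume "is_term f"
  then obtain t p where f: "\<And>e. f e = eval (mix e p) t" unfolding is_term_def by metis
  define \<pi> :: "nat \<Rightarrow> nat" where "\<pi> n = (if even n then n + 2 else n)" for n
  have "mix e p \<circ> \<pi> = mix (\<lambda>i. e (Suc i)) p" for e
    by (auto simp: mix_def \<pi>_def fun_eq_iff)
  then have "f (\<lambda>i. e (Suc i)) = eval (mix e p) (rename_trm \<pi> t)" for e
    by (simp add: f eval_rename)
  then show ?thesis unfolding is_term_def by blast
qed

lemma Delta0_atomic:
  assumes "Sets M \<noteq> {}" "\<And>e s. P e \<longleftrightarrow> sat (mix e p) s \<phi>"
  shows "Delta0 P"
proof -
  obtain X where "X \<in> Sets M" using assms(1) by blast
  then have "range (\<lambda>_::nat. X) \<subseteq> Sets M" by auto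
  with assms(2) show ?thesis unfolding Delta0_def by blast
qed

lemma Delta0_eq: "is_term f \<Longrightarrow> is_term g \<Longrightarrow> Sets M \<noteq> {} \<Longrightarrow> Delta0 (\<lambda>e. f e = g e)"
proof (erule (1) is_term_join)
  fix t u p
  assume "Sets M \<noteq> {}" "\<And>e. f e = eval (mix e p) t" "\<And>e. g e = eval (mix e p) u"
  then show ?thesis by (intro Delta0_atomic[of _ p "Eq t u"]) simp_all
qed

lemma Delta0_less: "is_term f \<Longrightarrow> is_term g \<Longrightarrow> Sets M \<noteq> {} \<Longrightarrow> Delta0 (\<lambda>e. f e \<prec> g e)"
proof (erule (1) is_term_join)
  fix t u p
  assume "Sets M \<noteq> {}" "\<And>e. f e = eval (mix e p) t" "\<And>e. g e = eval (mix e p) u"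
  then show ?thesis by (intro Delta0_atomic[of _ p "Less t u"]) simp_all
qed

lemma Delta0_mem: "is_term f \<Longrightarrow> X \<in> Sets M \<Longrightarrow> Delta0 (\<lambda>e. f e \<in> X)"
proof -
  assume "is_term f" "X \<in> Sets M"
  then obtain t p where "\<And>e. f e = eval (mix e p) t" unfolding is_term_def by metis
  then have "f e \<in> X \<longleftrightarrow> sat (mix e p) (\<lambda>_. X) (Mem t 0)" for e by simp
  moreover have "range (\<lambda>_::nat. X) \<subseteq> Sets M" using \<open>X \<in> Sets M\<close> by auto
  ultimately show ?thesis unfolding Delta0_def by blast
qed

lemma Delta0_not: "Delta0 P \<Longrightarrow> Delta0 (\<lambda>e. \<not> P e)"
proof -
  assume "Delta0 P"
  then obtain \<phi> p s where "range s \<subseteq> Sets M" "\<And>e. P e \<longleftrightarrow> sat (mix e p) s \<phi>"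
    unfolding Delta0_def by metis
  moreover from this have "\<not> P e \<longleftrightarrow> sat (mix e p) s (Neg \<phi>)" for e by simp
  ultimately show ?thesis unfolding Delta0_def by blast
qed

lemma Delta0_conj: "Delta0 P \<Longrightarrow> Delta0 Q \<Longrightarrow> Delta0 (\<lambda>e. P e \<and> Q e)"
proof -
  assume "Delta0 P" "Delta0 Q"
  then obtain \<phi> p s \<psi> q s' where sets: "range s \<subseteq> Sets M" "range s' \<subseteq> Sets M"
    and *: "\<And>e. P e \<longleftrightarrow> sat (mix e p) s \<phi>" "\<And>e. Q e \<longleftrightarrow> sat (mix e q) s' \<psi>"
    unfolding Delta0_def by (elim exE conjE) blast
  have "P e \<and> Q e \<longleftrightarrow> sat (mix e (mix p q)) (mix s s')
     (Conj (rename_fm0 left_param mix_l \<phi>) (rename_fm0 right_param mix_r \<psi>))" for e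
    by (simp only: sat.simps sat_rename[OF inj_left_param] sat_rename[OF inj_right_param]
        mix_left_param mix_right_param mix_l mix_r *)
  moreover have "range (mix s s') \<subseteq> Sets M" using range_mix[of s s'] sets by blast
  ultimately show ?thesis unfolding Delta0_def by blast
qed

lemma Delta0_disj:
  assumes "Delta0 P" "Delta0 Q"
  shows "Delta0 (\<lambda>e. P e \<or> Q e)"
proof -
  have eq: "(\<lambda>e. P e \<or> Q e) = (\<lambda>e. \<not> (\<not> P e \<and> \<not> Q e))" by blast
  show ?thesis unfolding eq by (intro Delta0_not Delta0_conj assms)
qed

lemma Delta0_imp:
  assumes "Delta0 P" "Delta0 Q"
  shows "Delta0 (\<lambda>e. P e \<longrightarrow> Q e)"
proof -
  have eq: "(\<lambda>e. P e \<longrightarrow> Q e) = (\<lambda>e. \<not> P e \<or> Q e)" by blast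
  show ?thesis unfolding eq by (intro Delta0_not Delta0_disj assms)
qed

lemma Delta0_iff:
  assumes "Delta0 P" "Delta0 Q"
  shows "Delta0 (\<lambda>e. P e \<longleftrightarrow> Q e)"
proof -
  have eq: "(\<lambda>e. P e \<longleftrightarrow> Q e) = (\<lambda>e. (P e \<longrightarrow> Q e) \<and> (Q e \<longrightarrow> P e))" by blast
  show ?thesis unfolding eq by (intro Delta0_conj Delta0_imp assms)
qed

text \<open>As with de Bruijn indices, the bound variable becomes variable 0 and shifts the others.\<close>

lemma Delta0_ball:
  assumes "is_term f" "Delta0 (\<lambda>e. P (e 0) (\<lambda>i. e (Suc i)))"
  shows "Delta0 (\<lambda>e. \<forall>a. a \<prec> f e \<longrightarrow> P a e)"
proof -
  from assms obtain t q \<phi> p s where *: "range s \<subseteq> Sets M"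
    "\<And>e. P (e 0) (\<lambda>i. e (Suc i)) \<longleftrightarrow> sat (mix e p) s \<phi>" "\<And>e. f e = eval (mix e q) t"
    unfolding Delta0_def is_term_def by (elim exE conjE) blast
  \<comment> \<open>Fills the parameter slot that the bound variable takes over; it is overwritten
    before it is read.\<close>
  define b where "b = (undefined :: 'a)"
  have t: "f e = eval (mix e (mix q (b ## p))) (rename_trm left_param t)" for e
    by (simp only: eval_rename mix_left_param *)
  define \<pi> where "\<pi> = right_param \<circ> bind_param"
  have "inj \<pi>" unfolding \<pi>_def by (intro inj_compose inj_right_param inj_bind_param)
  have "(mix e (mix q (b ## p)))(right_param 1 := a) \<circ> \<pi> = mix (a ## e) p" for e a
  proof -
    have "(mix e (mix q (b ## p)))(right_param 1 := a) \<circ> right_param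
       = (mix e (mix q (b ## p)) \<circ> right_param)(1 := a)"
      using inj_right_param by (auto simp: fun_eq_iff inj_eq)
    then show ?thesis unfolding \<pi>_def o_assoc by (simp only: mix_right_param mix_bind_param)
  qed
  then have "sat ((mix e (mix q (b ## p)))(right_param 1 := a)) s (rename_fm0 \<pi> id \<phi>) \<longleftrightarrow> P a e" for a e
    using *(2)[of "a ## e"] by (simp only: sat_rename[OF \<open>inj \<pi>\<close>] push_simps push_eta) simp
  then have "(\<forall>a. a \<prec> f e \<longrightarrow> P a e) \<longleftrightarrow> sat (mix e (mix q (b ## p))) s
      (BAll (right_param 1) (rename_trm left_param t) (rename_fm0 \<pi> id \<phi>))" for e
    by (simp only: sat.simps t)
  with * show ?thesis unfolding Delta0_def by blast
qed

lemma Delta0_bex: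
  assumes "is_term f" "Delta0 (\<lambda>e. P (e 0) (\<lambda>i. e (Suc i)))"
  shows "Delta0 (\<lambda>e. \<exists>a. a \<prec> f e \<and> P a e)"
proof -
  have "(\<lambda>e. \<exists>a. a \<prec> f e \<and> P a e) = (\<lambda>e. \<not> (\<forall>a. a \<prec> f e \<longrightarrow> \<not> P a e))" by blast
  moreover have "Delta0 (\<lambda>e. \<not> (\<forall>a. a \<prec> f e \<longrightarrow> \<not> P a e))"
    by (rule Delta0_not, rule Delta0_ball, rule assms(1), rule Delta0_not, rule assms(2))
  ultimately show ?thesis by simp
qed

lemma Sigma1_ex:
  assumes "Delta0 (\<lambda>e. Q (e 0) (e 1))"
  shows "Sigma1 (\<lambda>n. \<exists>m. Q n m)"
proof -
  from assms obtain p s \<phi> where *: "range s \<subseteq> Sets M"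
    "\<And>e. Q (e 0) (e 1) \<longleftrightarrow> sat (mix e p) s \<phi>" unfolding Delta0_def by metis
  define E where "E n m = mix (n ## m ## undefined) p" for n m
  \<comment> \<open>In \<open>mix\<close> the second environment variable sits at 2, whereas
    \<open>Sigma1\<close> reads the witness at 1; \<pi> exchanges the two and is its own
    inverse.\<close>
  define \<pi> :: "nat \<Rightarrow> nat" where "\<pi> = (\<lambda>i. if i = 1 then 2 else if i = 2 then 1 else i)"
  have "inj \<pi>" unfolding inj_def \<pi>_def by auto
  have "((E undefined undefined \<circ> \<pi>)(0 := n, 1 := m)) \<circ> \<pi> = E n m" for n m
  proof
    fix i
    show "(((E undefined undefined \<circ> \<pi>)(0 := n, 1 := m)) \<circ> \<pi>) i = E n m i"
    proof (cases "even i")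
      case True
      then obtain k where k: "i = 2 * k" by (rule evenE)
      show ?thesis
      proof (cases k)
        case (Suc j)
        with k show ?thesis by (cases j) (simp_all add: E_def mix_def \<pi>_def)
      qed (simp add: k E_def mix_def \<pi>_def)
    next
      case False
      then have "i \<noteq> 0" "i \<noteq> 2" by (intro notI, simp)+
      with False show ?thesis by (simp add: E_def mix_def \<pi>_def)
    qed
  qed
  then have "Q n m \<longleftrightarrow> sat ((E undefined undefined \<circ> \<pi>)(0 := n, 1 := m)) s (rename_fm0 \<pi> id \<phi>)" for n m
    using *(2)[of "n ## m ## undefined"] by (simp add: sat_rename[OF \<open>inj \<pi>\<close>] E_def)
  with *(1) show ?thesis unfolding Sigma1_def by blast
qed

end

section \<open>Arithmetic in models of \<open>RCA\<^sub>0\<close>\<close>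

locale rca0 = l2 +
  assumes RCA0: RCA0
begin

lemma Sets_nonempty: "Sets M \<noteq> {}"
  and basic_axioms: "basic_axioms"
  and Sigma1_induction: "Sigma1_induction"
  and Delta1_comprehension: "Delta1_comprehension"
  using RCA0 unfolding RCA0_def by auto

lemma plus_one_neq_zero: "n \<oplus> \<one> \<noteq> \<zero>"
  and plus_one_inject: "m \<oplus> \<one> = n \<oplus> \<one> \<Longrightarrow> m = n"
  and plus_zero: "m \<oplus> \<zero> = m"
  and plus_plus_one: "m \<oplus> (n \<oplus> \<one>) = (m \<oplus> n) \<oplus> \<one>"
  and times_zero: "m \<otimes> \<zero> = \<zero>"
  and times_plus_one: "m \<otimes> (n \<oplus> \<one>) = (m \<otimes> n) \<oplus> m"
  and not_prec_zero: "\<not> m \<prec> \<zero>"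
  and less_plus_one: "m \<prec> n \<oplus> \<one> \<longleftrightarrow> m \<prec> n \<or> m = n"
  using basic_axioms unfolding basic_axioms_def by blast+

lemmas term_intros = term_var term_const term_add term_mul

lemmas Delta0_connectives = Delta0_not Delta0_conj Delta0_disj Delta0_imp Delta0_iff Delta0_ball Delta0_bex
  Delta0_eq[OF _ _ Sets_nonempty] Delta0_less[OF _ _ Sets_nonempty] Delta0_mem

lemma Delta0_const: "Delta0 (\<lambda>e. b)"
proof (cases b)
  case True
  moreover have "Delta0 (\<lambda>e. \<zero> = \<zero>)" by (intro Delta0_connectives term_intros)
  ultimately show ?thesis by simp
next
  case False
  moreover have "Delta0 (\<lambda>e. \<not> \<zero> = \<zero>)" by (intro Delta0_connectives term_intros)
  ultimately show ?thesis by simp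
qed

lemma Delta0_leq: "is_term f \<Longrightarrow> is_term g \<Longrightarrow> Delta0 (\<lambda>e. f e \<preceq> g e)"
  unfolding leq_def by (intro Delta0_connectives)

lemmas Delta0_basic = Delta0_connectives Delta0_leq

lemma Sigma1_induct:
  assumes "Delta0 (\<lambda>e. Q (e 0) (e 1))"
    and "\<exists>m. Q \<zero> m" "\<And>n m. Q n m \<Longrightarrow> \<exists>m. Q (n \<oplus> \<one>) m"
  shows "\<exists>m. Q n m"
  using Sigma1_induction[unfolded Sigma1_induction_def, rule_format, OF Sigma1_ex[OF assms(1)], of n]
    assms(2,3) by blast

lemma Delta0_induct:
  assumes "Delta0 (\<lambda>e. P (e 0))" "P \<zero>" "\<And>n. P n \<Longrightarrow> P (n \<oplus> \<one>)"
  shows "P n"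
  using Sigma1_induct[of "\<lambda>n m. P n" n] assms by blast

section \<open>The ordered semiring of the numbers of the model\<close>

lemma zero_plus: "\<zero> \<oplus> n = n"
  by (rule Delta0_induct[of "\<lambda>n. \<zero> \<oplus> n = n"])
    (intro Delta0_basic term_intros, simp_all add: plus_zero plus_plus_one)

lemma plus_one_plus: "(m \<oplus> \<one>) \<oplus> n = (m \<oplus> n) \<oplus> \<one>"
  by (rule Delta0_induct[of "\<lambda>n. (m \<oplus> \<one>) \<oplus> n = (m \<oplus> n) \<oplus> \<one>"])
    (intro Delta0_basic term_intros, simp_all add: plus_zero plus_plus_one)

lemma plus_commute: "m \<oplus> n = n \<oplus> m"
  by (rule Delta0_induct[of "\<lambda>n. m \<oplus> n = n \<oplus> m"])
    (intro Delta0_basic term_intros, simp_all add: plus_zero plus_plus_one zero_plus plus_one_plus)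

lemma plus_assoc: "(m \<oplus> n) \<oplus> k = m \<oplus> (n \<oplus> k)"
  by (rule Delta0_induct[of "\<lambda>k. (m \<oplus> n) \<oplus> k = m \<oplus> (n \<oplus> k)"])
    (intro Delta0_basic term_intros, simp_all add: plus_zero plus_plus_one)

lemma plus_left_commute: "m \<oplus> (n \<oplus> k) = n \<oplus> (m \<oplus> k)"
  by (metis plus_assoc plus_commute)

lemma zero_times: "\<zero> \<otimes> n = \<zero>"
  by (rule Delta0_induct[of "\<lambda>n. \<zero> \<otimes> n = \<zero>"])
    (intro Delta0_basic term_intros, simp_all add: times_zero times_plus_one plus_zero)

lemma times_one: "m \<otimes> \<one> = m"
  using times_plus_one[of m \<zero>] by (simp add: zero_plus times_zero)

lemma plus_one_times: "(m \<oplus> \<one>) \<otimes> n = (m \<otimes> n) \<oplus> n"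
  by (rule Delta0_induct[of "\<lambda>n. (m \<oplus> \<one>) \<otimes> n = (m \<otimes> n) \<oplus> n"])
    (intro Delta0_basic term_intros, simp_all add: times_zero times_plus_one plus_zero plus_assoc plus_left_commute plus_commute)

lemma times_commute: "m \<otimes> n = n \<otimes> m"
  by (rule Delta0_induct[of "\<lambda>n. m \<otimes> n = n \<otimes> m"])
    (intro Delta0_basic term_intros, simp_all add: times_zero zero_times times_plus_one plus_one_times)

lemma plus_times: "(m \<oplus> n) \<otimes> k = m \<otimes> k \<oplus> n \<otimes> k"
  by (rule Delta0_induct[of "\<lambda>k. (m \<oplus> n) \<otimes> k = m \<otimes> k \<oplus> n \<otimes> k"])
    (intro Delta0_basic term_intros, simp_all add: times_zero plus_zero times_plus_one plus_assoc plus_left_commute)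

lemma times_plus: "k \<otimes> (m \<oplus> n) = k \<otimes> m \<oplus> k \<otimes> n"
  by (simp add: times_commute[of k] plus_times)

lemma times_assoc: "(m \<otimes> n) \<otimes> k = m \<otimes> (n \<otimes> k)"
  by (rule Delta0_induct[of "\<lambda>k. (m \<otimes> n) \<otimes> k = m \<otimes> (n \<otimes> k)"])
    (intro Delta0_basic term_intros, simp_all add: times_zero times_plus_one times_plus times_one)

lemma plus_right_cancel: "m \<oplus> k = n \<oplus> k \<longleftrightarrow> m = n"
  by (rule Delta0_induct[of "\<lambda>k. m \<oplus> k = n \<oplus> k \<longleftrightarrow> m = n"])
    (intro Delta0_basic term_intros, auto simp: plus_zero plus_plus_one dest: plus_one_inject)

lemma less_iff_plus: "m \<prec> n \<longleftrightarrow> (\<exists>k. n = m \<oplus> (k \<oplus> \<one>))"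
proof
  \<comment> \<open>The implication stands below the quantifier, which makes the induction formula
    \<open>\<Sigma>\<^sup>0\<^sub>1\<close>.\<close>
  have "\<exists>k. m \<prec> n \<longrightarrow> n = m \<oplus> (k \<oplus> \<one>)"
  proof (rule Sigma1_induct[of "\<lambda>n k. m \<prec> n \<longrightarrow> n = m \<oplus> (k \<oplus> \<one>)"])
    show "Delta0 (\<lambda>e. m \<prec> e 0 \<longrightarrow> e 0 = m \<oplus> (e 1 \<oplus> \<one>))" by (intro Delta0_basic term_intros)
    fix n k
    assume IH: "m \<prec> n \<longrightarrow> n = m \<oplus> (k \<oplus> \<one>)"
    show "\<exists>k. m \<prec> n \<oplus> \<one> \<longrightarrow> n \<oplus> \<one> = m \<oplus> (k \<oplus> \<one>)"
    proof (cases "m = n")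
      case True
      then show ?thesis by (intro exI[of _ \<zero>]) (simp add: zero_plus)
    next
      case False
      with IH show ?thesis
        by (intro exI[of _ "k \<oplus> \<one>"]) (auto simp: less_plus_one plus_assoc)
    qed
  qed (simp add: not_prec_zero)
  then show "m \<prec> n \<Longrightarrow> \<exists>k. n = m \<oplus> (k \<oplus> \<one>)" by blast
  assume "\<exists>k. n = m \<oplus> (k \<oplus> \<one>)"
  then obtain k where n: "n = m \<oplus> (k \<oplus> \<one>)" ..
  have "m \<prec> m \<oplus> (k \<oplus> \<one>)"
    by (rule Delta0_induct[of "\<lambda>k. m \<prec> m \<oplus> (k \<oplus> \<one>)"])
      (intro Delta0_basic term_intros, simp_all add: plus_plus_one less_plus_one plus_zero)
  with n show "m \<prec> n" by simp
qed

lemma leq_iff_plus: "m \<preceq> n \<longleftrightarrow> (\<exists>k. n = m \<oplus> k)"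
proof
  show "m \<preceq> n \<Longrightarrow> \<exists>k. n = m \<oplus> k"
    unfolding leq_def less_iff_plus by (metis plus_zero)
  assume "\<exists>k. n = m \<oplus> k"
  then obtain k where k: "n = m \<oplus> k" ..
  \<comment> \<open>The predecessor is claimed with a bound, so that \<open>Delta0\<close> induction
    applies.\<close>
  have "k = \<zero> \<or> (\<exists>j. j \<prec> k \<and> k = j \<oplus> \<one>)"
    by (rule Delta0_induct[of "\<lambda>k. k = \<zero> \<or> (\<exists>j. j \<prec> k \<and> k = j \<oplus> \<one>)"])
      (intro Delta0_basic term_intros, auto simp: less_plus_one)
  with k show "m \<preceq> n" unfolding leq_def less_iff_plus by (metis plus_zero)
qed

lemma zero_or_succ: "k = \<zero> \<or> (\<exists>j. k = j \<oplus> \<one>)"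
  using leq_iff_plus[of \<zero> k] less_iff_plus[of \<zero> k] by (metis leq_def zero_plus)

lemma prec_linear: "m \<prec> n \<or> m = n \<or> n \<prec> m"
proof (rule Delta0_induct[of "\<lambda>n. m \<prec> n \<or> m = n \<or> n \<prec> m"])
  fix n assume "m \<prec> n \<or> m = n \<or> n \<prec> m"
  moreover have "n \<oplus> \<one> \<preceq> m" if "n \<prec> m"
    using that unfolding leq_iff_plus less_iff_plus by (metis plus_assoc plus_commute)
  ultimately show "m \<prec> n \<oplus> \<one> \<or> m = n \<oplus> \<one> \<or> n \<oplus> \<one> \<prec> m"
    by (auto simp: less_plus_one leq_def)
next
  show "m \<prec> \<zero> \<or> m = \<zero> \<or> \<zero> \<prec> m"
    using zero_or_succ[of m] by (auto simp: less_iff_plus zero_plus)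
qed (intro Delta0_basic term_intros)

lemma prec_irrefl: "\<not> m \<prec> m"
proof
  assume "m \<prec> m"
  then obtain k where "m = m \<oplus> (k \<oplus> \<one>)" unfolding less_iff_plus ..
  then have "\<zero> \<oplus> m = (k \<oplus> \<one>) \<oplus> m" using zero_plus plus_commute by metis
  then show False using plus_right_cancel plus_one_neq_zero by metis
qed

lemma prec_trans: "k \<prec> m \<Longrightarrow> m \<prec> n \<Longrightarrow> k \<prec> n"
  unfolding less_iff_plus by (metis plus_assoc)

lemma times_less_mono:
  assumes "a \<prec> b" "\<zero> \<prec> c"
  shows "c \<otimes> a \<prec> c \<otimes> b"
proof -
  from assms obtain k j where "b = a \<oplus> (k \<oplus> \<one>)" "c = j \<oplus> \<one>"
    unfolding less_iff_plus by (auto simp: zero_plus)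
  then have "c \<otimes> b = c \<otimes> a \<oplus> ((c \<otimes> k \<oplus> j) \<oplus> \<one>)"
    by (simp add: times_plus times_one plus_assoc)
  then show ?thesis unfolding less_iff_plus by blast
qed

lemma times_left_commute: "m \<otimes> (n \<otimes> k) = n \<otimes> (m \<otimes> k)"
  by (metis times_assoc times_commute)

lemma one_times: "\<one> \<otimes> m = m"
  by (simp add: times_commute[of \<one>] times_one)

lemmas ring_nf = plus_assoc plus_commute plus_left_commute times_assoc times_commute
  times_left_commute plus_times times_plus times_one one_times plus_zero zero_plus times_zero zero_times

lemma plus_left_cancel: "k \<oplus> m = k \<oplus> n \<longleftrightarrow> m = n"
  using plus_right_cancel plus_commute by metis

lemma leq_refl: "m \<preceq> m"
  by (simp add: leq_def)

lemma not_prec: "\<not> m \<prec> n \<longleftrightarrow> n \<preceq> m"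
  unfolding leq_def using prec_linear prec_irrefl prec_trans by blast

lemma not_leq: "\<not> m \<preceq> n \<longleftrightarrow> n \<prec> m"
  using not_prec by blast

lemma prec_leq: "m \<prec> n \<Longrightarrow> m \<preceq> n"
  by (simp add: leq_def)

lemma leq_trans: "k \<preceq> m \<Longrightarrow> m \<preceq> n \<Longrightarrow> k \<preceq> n"
  unfolding leq_def using prec_trans by blast

lemma leq_prec_trans: "k \<preceq> m \<Longrightarrow> m \<prec> n \<Longrightarrow> k \<prec> n"
  and prec_leq_trans: "k \<prec> m \<Longrightarrow> m \<preceq> n \<Longrightarrow> k \<prec> n"
  unfolding leq_def using prec_trans by blast+

lemma leq_antisym: "m \<preceq> n \<Longrightarrow> n \<preceq> m \<Longrightarrow> m = n"
  unfolding leq_def using prec_irrefl prec_trans by blast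

lemma prec_plus_one_iff: "m \<prec> n \<oplus> \<one> \<longleftrightarrow> m \<preceq> n"
  by (simp add: less_plus_one leq_def)

lemma zero_leq: "\<zero> \<preceq> m"
  using not_prec not_prec_zero by blast

lemma leq_zero_iff: "m \<preceq> \<zero> \<longleftrightarrow> m = \<zero>"
  using not_prec_zero by (auto simp: leq_def)

lemma zero_prec_iff: "\<zero> \<prec> m \<longleftrightarrow> m \<noteq> \<zero>"
  using zero_leq[of m] prec_irrefl by (auto simp: leq_def)

lemma leq_plus: "m \<preceq> m \<oplus> n" "n \<preceq> m \<oplus> n"
  unfolding leq_iff_plus using plus_commute by blast+

lemma prec_self_plus_one: "n \<prec> n \<oplus> \<one>"
  by (simp add: less_plus_one)

lemma plus_one_leq_iff: "m \<oplus> \<one> \<preceq> n \<longleftrightarrow> m \<prec> n"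
  using not_prec[of n "m \<oplus> \<one>"] not_prec[of m n] prec_plus_one_iff[of n m] by blast

lemma plus_prec_cancel: "m \<oplus> k \<prec> n \<oplus> k \<longleftrightarrow> m \<prec> n"
proof -
  have "n \<oplus> k = m \<oplus> k \<oplus> (j \<oplus> \<one>) \<longleftrightarrow> n = m \<oplus> (j \<oplus> \<one>)" for j
    using plus_right_cancel[of n k "m \<oplus> (j \<oplus> \<one>)"] by (simp add: plus_assoc plus_commute plus_left_commute)
  then show ?thesis by (simp add: less_iff_plus)
qed

lemma plus_leq_cancel: "m \<oplus> k \<preceq> n \<oplus> k \<longleftrightarrow> m \<preceq> n"
  by (simp add: leq_def plus_prec_cancel plus_right_cancel)

lemma plus_leq_mono: "a \<preceq> b \<Longrightarrow> c \<preceq> d \<Longrightarrow> a \<oplus> c \<preceq> b \<oplus> d"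
  using plus_leq_cancel leq_trans plus_commute by metis

lemma plus_prec_mono: "a \<prec> b \<Longrightarrow> c \<prec> d \<Longrightarrow> a \<oplus> c \<prec> b \<oplus> d"
  and plus_prec_leq_mono: "a \<prec> b \<Longrightarrow> c \<preceq> d \<Longrightarrow> a \<oplus> c \<prec> b \<oplus> d"
  and plus_leq_prec_mono: "a \<preceq> b \<Longrightarrow> c \<prec> d \<Longrightarrow> a \<oplus> c \<prec> b \<oplus> d"
proof -
  show *: "a \<prec> b \<Longrightarrow> c \<preceq> d \<Longrightarrow> a \<oplus> c \<prec> b \<oplus> d" for a b c d
    using plus_prec_cancel[of a c b] plus_leq_cancel[of c b d] prec_leq_trans plus_commute by metis
  show "a \<prec> b \<Longrightarrow> c \<prec> d \<Longrightarrow> a \<oplus> c \<prec> b \<oplus> d" using * prec_leq by blast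
  show "a \<preceq> b \<Longrightarrow> c \<prec> d \<Longrightarrow> a \<oplus> c \<prec> b \<oplus> d" using *[of c d a b] plus_commute by metis
qed

text \<open>The equation says \<open>y - x = b - a\<close> without subtraction.\<close>

lemma lin_prec: "a \<prec> b \<Longrightarrow> x \<oplus> b = y \<oplus> a \<Longrightarrow> x \<prec> y"
  using plus_leq_prec_mono[of y x a b] not_prec prec_irrefl by metis

lemma lin_leq: "a \<preceq> b \<Longrightarrow> x \<oplus> b = y \<oplus> a \<Longrightarrow> x \<preceq> y"
  using plus_prec_leq_mono[of y x a b] not_leq prec_irrefl by metis

lemma times_prec_cancel: "c \<noteq> \<zero> \<Longrightarrow> c \<otimes> a \<prec> c \<otimes> b \<longleftrightarrow> a \<prec> b"
  using times_less_mono[of a b c] times_less_mono[of b a c] zero_prec_iff prec_linear prec_irrefl prec_trans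
  by metis

lemma times_cancel: "c \<noteq> \<zero> \<Longrightarrow> c \<otimes> a = c \<otimes> b \<longleftrightarrow> a = b"
  using times_prec_cancel prec_linear prec_irrefl by metis

lemma times_leq_cancel: "c \<noteq> \<zero> \<Longrightarrow> c \<otimes> a \<preceq> c \<otimes> b \<longleftrightarrow> a \<preceq> b"
  by (simp add: leq_def times_prec_cancel times_cancel)

lemma times_nonzero: "a \<noteq> \<zero> \<Longrightarrow> b \<noteq> \<zero> \<Longrightarrow> a \<otimes> b \<noteq> \<zero>"
  using times_cancel[of a b \<zero>] by (simp add: times_zero)

lemma leq_times: "d \<noteq> \<zero> \<Longrightarrow> q \<preceq> d \<otimes> q"
  using zero_or_succ[of d] leq_plus(2) by (auto simp: plus_one_times)

lemma one_neq_zero: "\<one> \<noteq> \<zero>"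
  using plus_one_neq_zero[of \<zero>] by (simp add: zero_plus)

text \<open>Nothing is substituted into a formula: a number below f e + 1 is bound and equated with
  f e.\<close>

lemma Delta0_subst1:
  assumes "Delta0 (\<lambda>e. P (e 0))" "is_term f"
  shows "Delta0 (\<lambda>e. P (f e))"
proof -
  have eq: "(\<lambda>e. P (f e)) = (\<lambda>e. \<exists>a. a \<prec> f e \<oplus> \<one> \<and> (a = f e \<and> P a))"
    using prec_self_plus_one by auto
  show ?thesis unfolding eq by (intro Delta0_basic term_intros assms term_shift)
qed

text \<open>The arguments are bound from left to right, so the first one ends up with the highest
  index.\<close>

lemma Delta0_subst2:
  assumes "Delta0 (\<lambda>e. P (e (Suc 0)) (e 0))" "is_term f" "is_term g"
  shows "Delta0 (\<lambda>e. P (f e) (g e))"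
proof -
  have eq: "(\<lambda>e. P (f e) (g e)) = (\<lambda>e. \<exists>a. a \<prec> f e \<oplus> \<one> \<and> (a = f e \<and>
    (\<exists>b. b \<prec> g e \<oplus> \<one> \<and> (b = g e \<and> P a b))))"
    using prec_self_plus_one by auto
  show ?thesis unfolding eq
    by (intro Delta0_basic term_intros assms term_shift[OF assms(2)] term_shift[OF assms(3)]
        term_shift[OF term_shift[OF assms(3)]])
qed

lemma Delta0_subst3:
  assumes "Delta0 (\<lambda>e. P (e (Suc (Suc 0))) (e (Suc 0)) (e 0))" "is_term f" "is_term g" "is_term h"
  shows "Delta0 (\<lambda>e. P (f e) (g e) (h e))"
proof -
  have eq: "(\<lambda>e. P (f e) (g e) (h e)) = (\<lambda>e. \<exists>a. a \<prec> f e \<oplus> \<one> \<and> (a = f e \<and>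
    (\<exists>b. b \<prec> g e \<oplus> \<one> \<and> (b = g e \<and> (\<exists>c. c \<prec> h e \<oplus> \<one> \<and> (c = h e \<and> P a b c))))))"
    using prec_self_plus_one by auto
  show ?thesis unfolding eq
    by (intro Delta0_basic term_intros assms term_shift[OF assms(2)] term_shift[OF assms(3)]
        term_shift[OF term_shift[OF assms(3)]] term_shift[OF assms(4)]
        term_shift[OF term_shift[OF assms(4)]]  term_shift[OF term_shift[OF term_shift[OF assms(4)]]])
qed

section \<open>Least numbers, \<open>\<Pi>\<^sup>0\<^sub>1\<close> induction and
  comprehension\<close>

lemma least_number:
  assumes "Delta0 (\<lambda>e. P (e 0))" "P n"
  shows "\<exists>m. P m \<and> (\<forall>k. k \<prec> m \<longrightarrow> \<not> P k)"
proof (rule ccontr)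
  assume *: "\<not> ?thesis"
  have "\<forall>k. k \<prec> n \<oplus> \<one> \<longrightarrow> \<not> P k"
  proof (rule Delta0_induct[of "\<lambda>n. \<forall>k. k \<prec> n \<longrightarrow> \<not> P k"])
    show "Delta0 (\<lambda>e. \<forall>k. k \<prec> e 0 \<longrightarrow> \<not> P k)" by (intro Delta0_basic term_intros assms(1))
    fix n assume IH: "\<forall>k. k \<prec> n \<longrightarrow> \<not> P k"
    with * have "\<not> P n" by blast
    with IH show "\<forall>k. k \<prec> n \<oplus> \<one> \<longrightarrow> \<not> P k" unfolding less_plus_one by metis
  qed (simp add: not_prec_zero)
  with assms(2) prec_self_plus_one[of n] show False by blast
qed

text \<open>A failure of Q at n is carried downwards: that some m refutes Q at n - i is
  \<open>\<Sigma>\<^sup>0\<^sub>1\<close> in i and passes from i to i + 1 by the contrapositive of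
  the step. At i = n it contradicts the base case.\<close>

lemma Pi1_induct:
  assumes "Delta0 (\<lambda>e. Q (e (Suc 0)) (e 0))"
    and "\<And>m. Q \<zero> m" "\<And>n. n \<prec> N \<Longrightarrow> (\<And>m. Q n m) \<Longrightarrow> (\<And>m. Q (n \<oplus> \<one>) m)"
    and "n \<preceq> N"
  shows "Q n m"
proof (rule ccontr)
  assume *: "\<not> Q n m"
  have "\<exists>m. i \<preceq> n \<longrightarrow> (\<exists>j. j \<prec> n \<oplus> \<one> \<and> (j \<oplus> i = n \<and> \<not> Q j m))" for i
  proof (rule Sigma1_induct[of "\<lambda>i m. i \<preceq> n \<longrightarrow> (\<exists>j. j \<prec> n \<oplus> \<one> \<and> (j \<oplus> i = n \<and> \<not> Q j m))"])
    show "Delta0 (\<lambda>e. e 0 \<preceq> n \<longrightarrow> (\<exists>j. j \<prec> n \<oplus> \<one> \<and> (j \<oplus> e 0 = n \<and> \<not> Q j (e 1))))"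
      by (intro Delta0_basic term_intros Delta0_subst2[of Q, OF assms(1)])
    show "\<exists>m. \<zero> \<preceq> n \<longrightarrow> (\<exists>j. j \<prec> n \<oplus> \<one> \<and> (j \<oplus> \<zero> = n \<and> \<not> Q j m))"
      using * prec_self_plus_one by (auto simp: plus_zero)
    fix i m'
    assume IH: "i \<preceq> n \<longrightarrow> (\<exists>j. j \<prec> n \<oplus> \<one> \<and> (j \<oplus> i = n \<and> \<not> Q j m'))"
    show "\<exists>m. i \<oplus> \<one> \<preceq> n \<longrightarrow> (\<exists>j. j \<prec> n \<oplus> \<one> \<and> (j \<oplus> (i \<oplus> \<one>) = n \<and> \<not> Q j m))"
    proof (cases "i \<prec> n")
      case True
      with IH obtain j where j: "j \<oplus> i = n" "\<not> Q j m'" using prec_leq by blast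
      with True have "j \<noteq> \<zero>" using prec_irrefl by (auto simp: zero_plus)
      then obtain l where l: "j = l \<oplus> \<one>" using zero_or_succ by blast
      then have "l \<prec> n"
        using j prec_self_plus_one[of l] leq_plus(1)[of "l \<oplus> \<one>" i] prec_leq_trans by metis
      then have "l \<prec> N" using assms(4) prec_leq_trans by blast
      then obtain m where "\<not> Q l m" using assms(3)[of l] l j(2) by blast
      moreover have "l \<oplus> (i \<oplus> \<one>) = n" using j l by (simp add: ring_nf)
      ultimately show ?thesis using \<open>l \<prec> n\<close> by (auto simp: less_plus_one)
    qed (simp add: plus_one_leq_iff)
  qed
  from this[of n] obtain m j where "j \<oplus> n = n" "\<not> Q j m" using leq_refl by blast
  moreover from this have "j = \<zero>" using plus_right_cancel[of j n \<zero>] by (simp add: zero_plus)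
  ultimately show False using assms(2) by blast
qed

lemma Sets_D0:
  assumes "Delta0 (\<lambda>e. P (e 0))"
  shows "{n. P n} \<in> Sets M"
proof -
  have "Sigma1 (\<lambda>n. \<exists>m::'a. P n)" "Sigma1 (\<lambda>n. \<exists>m::'a. \<not> P n)"
    by (rule Sigma1_ex, rule assms, rule Sigma1_ex, rule Delta0_not, rule assms)
  then show ?thesis
    using Delta1_comprehension unfolding Delta1_comprehension_def Pi1_def by simp
qed

section \<open>Coded finite sets and sequences\<close>

lemma leq_square: "n \<preceq> n \<otimes> n"
  using leq_times[of n n] by (cases "n = \<zero>") (simp_all add: times_zero leq_refl)

lemma leq_pair: "i \<preceq> pair i j" "j \<preceq> pair i j"
proof -
  show "i \<preceq> pair i j" unfolding pair_def by (rule leq_plus)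
  have "j \<preceq> i \<oplus> j" by (rule leq_plus)
  also have "i \<oplus> j \<preceq> pair i j"
    unfolding pair_def by (rule leq_trans[OF leq_square leq_plus(1)])
  finally (leq_trans) show "j \<preceq> pair i j" .
qed

lemma pair_eq_iff: "pair i j = pair i' j' \<longleftrightarrow> i = i' \<and> j = j'"
proof -
  have less: "pair i j \<prec> pair i' j'" if lt: "i \<oplus> j \<prec> i' \<oplus> j'" for i j i' j'
  proof -
    obtain k where k: "i' \<oplus> j' = (i \<oplus> j) \<oplus> (k \<oplus> \<one>)" using lt[unfolded less_iff_plus] ..
    have "pair i j \<prec> pair i j \<oplus> \<one>" by (rule prec_self_plus_one)
    \<comment> \<open>The witness is the difference of both sides after expanding (i + j + k + 1)^2,
      with 2 (i + j) - i written as (i + j) + j.\<close>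
    also have "pair i j \<oplus> \<one> \<preceq> pair i' j'"
      unfolding pair_def k leq_iff_plus
      by (intro exI[of _ "(i \<oplus> j) \<oplus> j \<oplus> (i \<oplus> j) \<otimes> k \<oplus> (i \<oplus> j) \<otimes> k \<oplus> k \<oplus> k \<oplus> k \<otimes> k \<oplus> i'"])
        (simp add: ring_nf)
    finally (prec_leq_trans) show ?thesis .
  qed
  show ?thesis
  proof
    assume *: "pair i j = pair i' j'"
    then have eq: "i \<oplus> j = i' \<oplus> j'"
      using less[of i j i' j'] less[of i' j' i j] prec_linear prec_irrefl by metis
    with * have "i = i'" unfolding pair_def using plus_left_cancel by simp
    with eq show "i = i' \<and> j = j'" using plus_left_cancel by simp
  qed simp
qed

lemma term_pair: "is_term f \<Longrightarrow> is_term g \<Longrightarrow> is_term (\<lambda>e. pair (f e) (g e))"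
  unfolding pair_def by (intro term_intros)

text \<open>Both components are at most the pair, so the two quantifiers are bounded. In P the first
  component has index 1, the second index 0.\<close>

lemma Delta0_expair:
  assumes "is_term f" "Delta0 (\<lambda>e. P (e (Suc 0)) (e 0) (\<lambda>i. e (Suc (Suc i))))"
  shows "Delta0 (\<lambda>e. \<exists>i j. f e = pair i j \<and> P i j e)"
proof -
  have eq: "(\<lambda>e. \<exists>i j. f e = pair i j \<and> P i j e) = (\<lambda>e. \<exists>i. i \<prec> f e \<oplus> \<one> \<and>
     (\<exists>j. j \<prec> f e \<oplus> \<one> \<and> (f e = pair i j \<and> P i j e)))"
    unfolding prec_plus_one_iff using leq_pair by fastforce
  show ?thesis unfolding eq
    by (intro Delta0_basic term_intros term_pair assms term_shift[OF assms(1)] term_shift[OF term_shift[OF assms(1)]])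
qed

section \<open>Divisibility and common multiples\<close>

lemma Delta0_divides: "is_term f \<Longrightarrow> is_term g \<Longrightarrow> Delta0 (\<lambda>e. divides (f e) (g e))"
proof (rule Delta0_subst2)
  have "divides d n \<longleftrightarrow> (\<exists>q. q \<prec> n \<oplus> \<one> \<and> n = d \<otimes> q)" for d n
  proof (cases "d = \<zero>")
    case True
    then show ?thesis unfolding divides_def using prec_self_plus_one by (auto simp: zero_times)
  next
    case False
    then show ?thesis unfolding divides_def prec_plus_one_iff using leq_times by blast
  qed
  then have eq: "divides = (\<lambda>d n. \<exists>q. q \<prec> n \<oplus> \<one> \<and> n = d \<otimes> q)" by (intro ext)
  show "Delta0 (\<lambda>e. divides (e (Suc 0)) (e 0))" unfolding eq by (intro Delta0_basic term_intros)
qed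

lemma divides_refl: "divides d d"
  unfolding divides_def by (metis times_one)

lemma divides_times: "divides d m \<Longrightarrow> divides d (m \<otimes> n)" "divides d m \<Longrightarrow> divides d (n \<otimes> m)"
  unfolding divides_def by (metis times_assoc, metis times_assoc times_commute)

text \<open>In the absence of subtraction the two quotients are compared; if that of the sum is not
  the larger one, then b is zero.\<close>

lemma divides_plus_cancel:
  assumes "divides d a" "divides d (a \<oplus> b)"
  shows "divides d b"
proof -
  obtain q r where q: "a = d \<otimes> q" and r: "a \<oplus> b = d \<otimes> r" using assms unfolding divides_def by blast
  show ?thesis
  proof (cases "q \<preceq> r")
    case True
    then obtain k where "r = q \<oplus> k" unfolding leq_iff_plus ..
    with q r have "b = d \<otimes> k" using plus_left_cancel by (simp add: times_plus)
    then show ?thesis unfolding divides_def ..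
  next
    case False
    then have "r \<preceq> q" unfolding not_leq by (rule prec_leq)
    then obtain k where "q = r \<oplus> k" unfolding leq_iff_plus ..
    with q r have "d \<otimes> r \<oplus> (d \<otimes> k \<oplus> b) = d \<otimes> r \<oplus> \<zero>" by (simp add: times_plus plus_assoc plus_zero)
    then have "d \<otimes> k \<oplus> b = \<zero>" unfolding plus_left_cancel .
    then have "b = \<zero>" using leq_plus(2)[of b "d \<otimes> k"] leq_zero_iff by simp
    then show ?thesis unfolding divides_def by (metis times_zero)
  qed
qed

lemma divides_one: "divides d \<one> \<Longrightarrow> d = \<one>"
proof -
  assume "divides d \<one>"
  then obtain q where q: "\<one> = d \<otimes> q" unfolding divides_def ..
  then have "d \<noteq> \<zero>" "q \<noteq> \<zero>" using one_neq_zero by (auto simp: times_zero zero_times)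
  moreover from this have "d \<preceq> \<one>" using leq_times[of q d] q times_commute by metis
  ultimately have "d \<preceq> \<one>" "\<zero> \<oplus> \<one> \<preceq> d" by (simp_all add: plus_one_leq_iff zero_prec_iff)
  then show ?thesis using leq_antisym by (simp add: zero_plus)
qed

text \<open>A substitute for the factorial. It supplies the multiplier in the moduli of coded sets,
  and later the denominator N of the grid.\<close>

lemma common_multiple: "\<exists>m. m \<noteq> \<zero> \<and> (\<forall>d. d \<prec> k \<longrightarrow> d \<noteq> \<zero> \<longrightarrow> divides d m)"
proof (rule Sigma1_induct[of "\<lambda>k m. m \<noteq> \<zero> \<and> (\<forall>d. d \<prec> k \<longrightarrow> d \<noteq> \<zero> \<longrightarrow> divides d m)"])
  show "Delta0 (\<lambda>e. e 1 \<noteq> \<zero> \<and> (\<forall>d. d \<prec> e 0 \<longrightarrow> d \<noteq> \<zero> \<longrightarrow> divides d (e 1)))"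
    by (intro Delta0_basic term_intros Delta0_divides)
  show "\<exists>m. m \<noteq> \<zero> \<and> (\<forall>d. d \<prec> \<zero> \<longrightarrow> d \<noteq> \<zero> \<longrightarrow> divides d m)"
    using one_neq_zero not_prec_zero by blast
  fix k m assume IH: "m \<noteq> \<zero> \<and> (\<forall>d. d \<prec> k \<longrightarrow> d \<noteq> \<zero> \<longrightarrow> divides d m)"
  show "\<exists>m. m \<noteq> \<zero> \<and> (\<forall>d. d \<prec> k \<oplus> \<one> \<longrightarrow> d \<noteq> \<zero> \<longrightarrow> divides d m)"
  proof (cases "k = \<zero>")
    \<comment> \<open>Multiplying by zero would destroy m \<noteq> 0, so the witness is one
      here.\<close>
    case True
    then show ?thesis using one_neq_zero by (auto simp: less_plus_one not_prec_zero)
  next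
    case False
    with IH show ?thesis
      by (intro exI[of _ "m \<otimes> k"])
        (auto simp: less_plus_one times_nonzero intro: divides_times divides_refl)
  qed
qed

text \<open>The moduli \<open>m (i + 1) + 1\<close> are pairwise coprime, in the form needed to add one factor at a time.\<close>

lemma divides_modulus_cancel:
  assumes m: "\<And>d. d \<prec> k \<Longrightarrow> d \<noteq> \<zero> \<Longrightarrow> divides d m"
    and "i \<prec> k" "j \<prec> k" "i \<noteq> j"
    and u: "u = m \<otimes> (i \<oplus> \<one>) \<oplus> \<one>" and v: "v = m \<otimes> (j \<oplus> \<one>) \<oplus> \<one>"
    and uv: "divides u (n \<otimes> v)"
  shows "divides u n"
proof -
  \<comment> \<open>u is coprime to m, because u x = (m x) (i + 1) + x.\<close>
  have cop: "divides u x" if "divides u (m \<otimes> x)" for x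
  proof (rule divides_plus_cancel)
    show "divides u ((m \<otimes> x) \<otimes> (i \<oplus> \<one>))" using that by (rule divides_times)
    have "(m \<otimes> x) \<otimes> (i \<oplus> \<one>) \<oplus> x = u \<otimes> x" unfolding u by (simp add: ring_nf)
    then show "divides u ((m \<otimes> x) \<otimes> (i \<oplus> \<one>) \<oplus> x)" unfolding divides_def by blast
  qed
  \<comment> \<open>d is the distance of i and j: modulo u, the product n v equals m n d up to
    sign.\<close>
  obtain d where d: "d \<prec> k" "d \<noteq> \<zero>" and "divides u (m \<otimes> (n \<otimes> d))"
  proof (cases "i \<prec> j")
    case True
    then obtain t where t: "j = i \<oplus> (t \<oplus> \<one>)" unfolding less_iff_plus ..
    have "n \<otimes> v = n \<otimes> u \<oplus> m \<otimes> (n \<otimes> (t \<oplus> \<one>))" unfolding u v t by (simp add: ring_nf)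
    then have "divides u (m \<otimes> (n \<otimes> (t \<oplus> \<one>)))"
      using uv divides_plus_cancel divides_times(2)[OF divides_refl] by metis
    moreover have "t \<oplus> \<one> \<prec> k" using \<open>j \<prec> k\<close> leq_plus(2)[of "t \<oplus> \<one>" i] leq_prec_trans unfolding t by blast
    ultimately show thesis using that plus_one_neq_zero by blast
  next
    case False
    then have "j \<prec> i" using \<open>i \<noteq> j\<close> prec_linear by blast
    then obtain t where t: "i = j \<oplus> (t \<oplus> \<one>)" unfolding less_iff_plus ..
    have "n \<otimes> u = n \<otimes> v \<oplus> m \<otimes> (n \<otimes> (t \<oplus> \<one>))" unfolding u v t by (simp add: ring_nf)
    then have "divides u (m \<otimes> (n \<otimes> (t \<oplus> \<one>)))"
      using uv divides_plus_cancel divides_times(2)[OF divides_refl] by metis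
    moreover have "t \<oplus> \<one> \<prec> k" using \<open>i \<prec> k\<close> leq_plus(2)[of "t \<oplus> \<one>" j] leq_prec_trans unfolding t by blast
    ultimately show thesis using that plus_one_neq_zero by blast
  qed
  \<comment> \<open>Since d divides m, one use of \<open>cop\<close> shows that u divides m n, and
    another that u divides n.\<close>
  from m[OF d] obtain m' where "m = d \<otimes> m'" unfolding divides_def ..
  then have "m \<otimes> n = (n \<otimes> d) \<otimes> m'" by (simp add: ring_nf)
  then have "divides u (m \<otimes> n)" using divides_times(1)[OF cop] \<open>divides u (m \<otimes> (n \<otimes> d))\<close> by metis
  then show ?thesis by (rule cop)
qed

section \<open>Existence of codes and complexity of decoding\<close>

lemma decode_pair: "decode (pair (pair k m) n) = {i. i \<prec> k \<and> divides (m \<otimes> (i \<oplus> \<one>) \<oplus> \<one>) n}"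
  unfolding decode_def pair_eq_iff by blast

text \<open>The number n is the product of the moduli of the members, built by
  \<open>\<Sigma>\<^sup>0\<^sub>1\<close> induction with one factor for each j in P. As m is
  nonzero, no modulus is one, so the empty product codes the empty set.\<close>

lemma exists_decode:
  assumes P: "Delta0 (\<lambda>e. P (e 0))"
  shows "\<exists>m n. decode (pair (pair k m) n) = {i. i \<prec> k \<and> P i}"
proof -
  obtain m where "m \<noteq> \<zero>" and m: "\<And>d. d \<prec> k \<Longrightarrow> d \<noteq> \<zero> \<Longrightarrow> divides d m"
    using common_multiple by metis
  define Q where "Q j n \<longleftrightarrow> (\<forall>i. i \<prec> k \<longrightarrow> (divides (m \<otimes> (i \<oplus> \<one>) \<oplus> \<one>) n \<longleftrightarrow> i \<prec> j \<and> P i))" for j n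
  have "\<exists>n. Q j n" for j
  proof (rule Sigma1_induct[of Q])
    show "Delta0 (\<lambda>e. Q (e 0) (e 1))" unfolding Q_def
      by (intro Delta0_basic term_intros Delta0_divides P)
    show "\<exists>n. Q \<zero> n"
    proof
      have "\<not> divides (m \<otimes> (i \<oplus> \<one>) \<oplus> \<one>) \<one>" for i
      proof
        assume "divides (m \<otimes> (i \<oplus> \<one>) \<oplus> \<one>) \<one>"
        then have "m \<otimes> (i \<oplus> \<one>) \<oplus> \<one> = \<zero> \<oplus> \<one>" unfolding zero_plus by (rule divides_one)
        then have "m \<otimes> (i \<oplus> \<one>) = \<zero>" unfolding plus_right_cancel .
        then show False using \<open>m \<noteq> \<zero>\<close> plus_one_neq_zero times_nonzero by blast
      qed
      then show "Q \<zero> \<one>" unfolding Q_def using not_prec_zero by blast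
    qed
    fix j n assume IH: "Q j n"
    show "\<exists>n. Q (j \<oplus> \<one>) n"
    proof (cases "j \<prec> k \<and> P j")
      case True
      have "divides (m \<otimes> (i \<oplus> \<one>) \<oplus> \<one>) (n \<otimes> (m \<otimes> (j \<oplus> \<one>) \<oplus> \<one>)) \<longleftrightarrow> i \<prec> j \<oplus> \<one> \<and> P i"
        if "i \<prec> k" for i
      proof (cases "i = j")
        case True
        with \<open>j \<prec> k \<and> P j\<close> show ?thesis
          by (auto simp: less_plus_one intro: divides_times divides_refl)
      next
        case False
        have "divides (m \<otimes> (i \<oplus> \<one>) \<oplus> \<one>) (n \<otimes> (m \<otimes> (j \<oplus> \<one>) \<oplus> \<one>)) \<longleftrightarrow>
            divides (m \<otimes> (i \<oplus> \<one>) \<oplus> \<one>) n"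
          using divides_modulus_cancel[OF m that conjunct1[OF True] False refl refl]
            divides_times(1) by blast
        with IH that False show ?thesis unfolding Q_def less_plus_one by simp
      qed
      then show ?thesis unfolding Q_def by blast
    next
      case False
      with IH have "Q (j \<oplus> \<one>) n" unfolding Q_def less_plus_one by blast
      then show ?thesis ..
    qed
  qed
  from this[of k] show ?thesis unfolding Q_def decode_pair by blast
qed

lemma Delta0_decode: "is_term f \<Longrightarrow> is_term g \<Longrightarrow> Delta0 (\<lambda>e. f e \<in> decode (g e))"
proof (rule Delta0_subst2)
  have eq: "z \<in> decode c \<longleftrightarrow> (\<exists>l n. c = pair l n \<and>
      (\<exists>k m. l = pair k m \<and> (z \<prec> k \<and> divides (m \<otimes> (z \<oplus> \<one>) \<oplus> \<one>) n)))" for z c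
    unfolding decode_def by blast
  show "Delta0 (\<lambda>e. e (Suc 0) \<in> decode (e 0))" unfolding eq
    by (intro Delta0_expair Delta0_basic term_intros Delta0_divides)
qed

text \<open>This bounds every quantifier over the elements of a coded set.\<close>

lemma decode_prec: "z \<in> decode c \<Longrightarrow> z \<prec> c"
proof -
  assume "z \<in> decode c"
  then obtain k m n where "c = pair (pair k m) n" "z \<prec> k" unfolding decode_def by blast
  moreover have "k \<preceq> pair (pair k m) n" by (rule leq_trans[OF leq_pair(1) leq_pair(1)])
  ultimately show ?thesis using prec_leq_trans by blast
qed

lemma Delta0_is_triple: "is_term f \<Longrightarrow> Delta0 (\<lambda>e. is_triple (f e))"
proof (rule Delta0_subst1)
  have eq: "is_triple c \<longleftrightarrow> (\<exists>l n. c = pair l n \<and> (\<exists>k m. l = pair k m \<and> True))" for c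
    unfolding is_triple_def by blast
  show "Delta0 (\<lambda>e. is_triple (e 0))" unfolding eq by (intro Delta0_expair term_intros Delta0_const)
qed

lemma Delta0_is_finset_code: "is_term f \<Longrightarrow> Delta0 (\<lambda>e. is_finset_code (f e))"
proof (rule Delta0_subst1)
  have "decode c' = decode c \<longleftrightarrow> (\<forall>z. z \<prec> c \<longrightarrow> (z \<in> decode c' \<longleftrightarrow> z \<in> decode c))"
    if "c' \<prec> c" for c c'
    using decode_prec prec_trans[OF _ that] by blast
  then have eq: "is_finset_code c \<longleftrightarrow> is_triple c \<and> (\<forall>c'. c' \<prec> c \<longrightarrow> (is_triple c' \<longrightarrow>
      \<not> (\<forall>z. z \<prec> c \<longrightarrow> (z \<in> decode c' \<longleftrightarrow> z \<in> decode c))))" for c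
    unfolding is_finset_code_def by metis
  show "Delta0 (\<lambda>e. is_finset_code (e 0))" unfolding eq
    by (intro Delta0_basic term_intros Delta0_is_triple Delta0_decode)
qed

lemma exists_finset_code:
  assumes "Delta0 (\<lambda>e. P (e 0))"
  shows "\<exists>c. is_finset_code c \<and> decode c = {i. i \<prec> k \<and> P i}"
proof -
  obtain m n where mn: "decode (pair (pair k m) n) = {i. i \<prec> k \<and> P i}"
    using exists_decode[OF assms] by blast
  define c0 where "c0 = pair (pair k m) n"
  \<comment> \<open>Equality of the decoded sets, with a bound that covers the elements of both, so
    that \<open>least_number\<close> applies.\<close>
  define Q where "Q c \<longleftrightarrow> is_triple c \<and> (\<forall>z. z \<prec> c \<oplus> c0 \<longrightarrow> (z \<in> decode c \<longleftrightarrow> z \<in> decode c0))" for c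
  have "Delta0 (\<lambda>e. Q (e 0))" unfolding Q_def by (intro Delta0_basic term_intros Delta0_is_triple Delta0_decode)
  moreover have "Q c0" unfolding Q_def is_triple_def c0_def by blast
  ultimately obtain c where c: "Q c" "\<And>c'. c' \<prec> c \<Longrightarrow> \<not> Q c'" using least_number by metis
  have Q: "decode c' = decode c0" if "Q c'" for c'
    using that decode_prec[THEN prec_leq_trans, OF _ leq_plus(1)]
      decode_prec[THEN prec_leq_trans, OF _ leq_plus(2)] unfolding Q_def by blast
  have "is_finset_code c"
    unfolding is_finset_code_def
  proof (intro conjI allI impI notI)
    show "is_triple c" using c(1) unfolding Q_def ..
    fix c' assume "c' \<prec> c" "is_triple c'" "decode c' = decode c"
    then have "Q c'" unfolding Q_def Q[OF c(1)] by blast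
    with c(2) \<open>c' \<prec> c\<close> show False by blast
  qed
  with Q[OF c(1)] mn show ?thesis unfolding c0_def by blast
qed

lemma Delta0_is_seq: "is_term f \<Longrightarrow> is_term g \<Longrightarrow> Delta0 (\<lambda>e. is_seq (f e) (g e))"
proof (rule Delta0_subst2)
  have bound: "j \<prec> c" if "pair i j \<in> decode c" for i j c
    by (rule leq_prec_trans[OF leq_pair(2) decode_prec[OF that]])
  have "(\<exists>!j. pair i j \<in> decode c) \<longleftrightarrow> (\<exists>j. j \<prec> c \<and> (pair i j \<in> decode c \<and>
      (\<forall>j'. j' \<prec> c \<longrightarrow> (pair i j' \<in> decode c \<longrightarrow> j' = j))))" for i c
    using bound by metis
  moreover have "(\<forall>z \<in> decode c. \<exists>i j. i \<prec> l \<and> z = pair i j) \<longleftrightarrow>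
      (\<forall>z. z \<prec> c \<longrightarrow> (z \<in> decode c \<longrightarrow> (\<exists>i j. z = pair i j \<and> i \<prec> l)))" for c l
    using decode_prec by blast
  ultimately have eq: "is_seq c l \<longleftrightarrow> is_finset_code c \<and>
     (\<forall>z. z \<prec> c \<longrightarrow> (z \<in> decode c \<longrightarrow> (\<exists>i j. z = pair i j \<and> i \<prec> l))) \<and>
     (\<forall>i. i \<prec> l \<longrightarrow> (\<exists>j. j \<prec> c \<and> (pair i j \<in> decode c \<and>
      (\<forall>j'. j' \<prec> c \<longrightarrow> (pair i j' \<in> decode c \<longrightarrow> j' = j)))))" for c l
    unfolding is_seq_def by simp
  show "Delta0 (\<lambda>e. is_seq (e (Suc 0)) (e 0))" unfolding eq
    by (intro Delta0_expair Delta0_basic term_intros term_pair Delta0_is_finset_code Delta0_decode)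
qed

lemma seq_entry_iff:
  assumes "is_seq c l" "i \<prec> l"
  shows "pair i j \<in> decode c \<longleftrightarrow> entry c i = j"
proof -
  have "\<exists>!j. pair i j \<in> decode c" using assms unfolding is_seq_def by blast
  then show ?thesis unfolding entry_def by (metis the_equality)
qed

lemma seq_index: "is_seq c l \<Longrightarrow> pair i j \<in> decode c \<Longrightarrow> i \<prec> l"
  unfolding is_seq_def using pair_eq_iff by metis

lemma seq_length_unique: "is_seq c l \<Longrightarrow> is_seq c l' \<Longrightarrow> l = l'"
  using seq_index seq_entry_iff prec_linear prec_irrefl by metis

text \<open>Makes the quantifier over the length of a node bounded, and makes a tree infinite once
  it has nodes of every length.\<close>

lemma seq_length_leq:
  assumes "is_seq c l"
  shows "l \<preceq> c"
proof (cases "l = \<zero>")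
  case False
  then obtain i where i: "l = i \<oplus> \<one>" using zero_or_succ by blast
  then have "pair i (entry c i) \<in> decode c" using seq_entry_iff[OF assms] prec_self_plus_one by blast
  then show ?thesis
    using decode_prec leq_pair(1) leq_prec_trans plus_one_leq_iff unfolding i by blast
qed (simp add: zero_leq)

lemma times_leq_mono: "a \<preceq> b \<Longrightarrow> c \<preceq> d \<Longrightarrow> a \<otimes> c \<preceq> b \<otimes> d"
  unfolding leq_iff_plus by (force simp: plus_times times_plus plus_assoc)

lemma pair_mono: "i \<preceq> i' \<Longrightarrow> j \<preceq> j' \<Longrightarrow> pair i j \<preceq> pair i' j'"
  unfolding pair_def by (intro plus_leq_mono times_leq_mono)

text \<open>The bound b keeps all pairs of the graph below one number, so that the graph has a code
  by \<open>exists_finset_code\<close>.\<close>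

lemma exists_seq:
  assumes G: "Delta0 (\<lambda>e. G (e (Suc 0)) (e 0))"
    and total: "\<And>i. i \<prec> l \<Longrightarrow> \<exists>!j. G i j"
    and bound: "\<And>i j. i \<prec> l \<Longrightarrow> G i j \<Longrightarrow> j \<preceq> b"
  shows "\<exists>c. is_seq c l \<and> (\<forall>i. i \<prec> l \<longrightarrow> G i (entry c i))"
proof -
  have "Delta0 (\<lambda>e. \<exists>i j. e 0 = pair i j \<and> (i \<prec> l \<and> G i j))"
    by (intro Delta0_expair Delta0_basic term_intros Delta0_subst2[of G, OF G])
  from exists_finset_code[OF this]
  obtain c where c: "is_finset_code c"
    "decode c = {z. z \<prec> pair l b \<oplus> \<one> \<and> (\<exists>i j. z = pair i j \<and> (i \<prec> l \<and> G i j))}" by blast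
  have iff: "pair i j \<in> decode c \<longleftrightarrow> i \<prec> l \<and> G i j" for i j
    using pair_mono[of i l j b] bound prec_leq[of i l] unfolding c prec_plus_one_iff
    by (auto simp: pair_eq_iff)
  have seq: "is_seq c l"
    unfolding is_seq_def
  proof (intro conjI ballI allI impI)
    fix z assume "z \<in> decode c"
    then show "\<exists>i j. i \<prec> l \<and> z = pair i j" unfolding c by blast
  next
    fix i assume "i \<prec> l"
    then show "\<exists>!j. pair i j \<in> decode c" unfolding iff using total by simp
  qed (rule c)
  moreover have "G i (entry c i)" if "i \<prec> l" for i
    using seq_entry_iff[OF seq that] iff by blast
  ultimately show ?thesis by blast
qed

section \<open>Binary trees and compactness\<close>

lemma Delta0_is_binseq: "is_term f \<Longrightarrow> is_term g \<Longrightarrow> Delta0 (\<lambda>e. is_binseq (f e) (g e))"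
proof (rule Delta0_subst2)
  have eq: "is_binseq c l \<longleftrightarrow> is_seq c l \<and>
      (\<forall>i. i \<prec> l \<longrightarrow> pair i \<zero> \<in> decode c \<or> pair i \<one> \<in> decode c)" for c l
    unfolding is_binseq_def using seq_entry_iff by blast
  show "Delta0 (\<lambda>e. is_binseq (e (Suc 0)) (e 0))" unfolding eq
    by (intro Delta0_basic term_intros term_pair Delta0_is_seq Delta0_decode)
qed

text \<open>Compactness of Cantor space for the \<open>\<Pi>\<^sup>0\<^sub>1\<close> classes given by clauses with at most two literals.\<close>

lemma compactness:
  assumes "weak_koenig"
    and I: "Delta0 (\<lambda>e. I (e 0))" and N: "Delta0 (\<lambda>e. N (e 0))"
    and C: "Delta0 (\<lambda>e. C (e (Suc (Suc 0))) (e (Suc 0)) (e 0))"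
    and fin: "\<And>n. \<exists>X. Delta0 (\<lambda>e. X (e 0)) \<and> (\<forall>z. z \<prec> n \<longrightarrow> (I z \<longrightarrow> X z) \<and> (N z \<longrightarrow> \<not> X z)) \<and>
      (\<forall>u v z. u \<prec> n \<longrightarrow> v \<prec> n \<longrightarrow> z \<prec> n \<longrightarrow> C u v z \<longrightarrow> X v \<or> \<not> X z)"
  shows "\<exists>X \<in> Sets M. (\<forall>z. I z \<longrightarrow> z \<in> X) \<and> (\<forall>z. N z \<longrightarrow> z \<notin> X) \<and>
      (\<forall>u v z. C u v z \<longrightarrow> v \<in> X \<or> z \<notin> X)"
proof -
  \<comment> \<open>Bit z of \<sigma> is one, expressed through \<open>decode\<close> because
    \<open>entry\<close> is not a term.\<close>
  define B where "B \<sigma> z \<longleftrightarrow> pair z \<one> \<in> decode \<sigma>" for \<sigma> z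
  \<comment> \<open>A node of length l tests only clauses with numbers below l. In
    \<open>C u v z\<close> the number u witnesses the clause; its literals are the bits v and
    z.\<close>
  define K where "K l \<sigma> \<longleftrightarrow>
    (\<forall>z. z \<prec> l \<longrightarrow> (I z \<longrightarrow> B \<sigma> z) \<and> (N z \<longrightarrow> \<not> B \<sigma> z)) \<and>
    (\<forall>u. u \<prec> l \<longrightarrow> (\<forall>v. v \<prec> l \<longrightarrow> (\<forall>z. z \<prec> l \<longrightarrow> (C u v z \<longrightarrow> B \<sigma> v \<or> \<not> B \<sigma> z))))" for l \<sigma>
  \<comment> \<open>The length is at most the code; bounding it makes T definable by
    \<open>Delta0\<close>.\<close>
  define T where "T = {\<sigma>. \<exists>l. l \<prec> \<sigma> \<oplus> \<one> \<and> (is_binseq \<sigma> l \<and> K l \<sigma>)}"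
  have TI: "\<sigma> \<in> T" if "is_binseq \<sigma> l" "K l \<sigma>" for \<sigma> l
    using that seq_length_leq unfolding T_def prec_plus_one_iff is_binseq_def by blast
  have TD: "is_binseq \<sigma> l" "K l \<sigma>" if "\<sigma> \<in> T" "is_seq \<sigma> l" for \<sigma> l
    using that seq_length_unique unfolding T_def is_binseq_def by blast+
  have "is_bintree T"
    unfolding is_bintree_def
  proof (intro conjI ballI allI impI)
    have "Delta0 (\<lambda>e. \<exists>l. l \<prec> e 0 \<oplus> \<one> \<and> (is_binseq (e 0) l \<and> K l (e 0)))"
      unfolding K_def B_def
      by (intro Delta0_basic term_intros term_pair Delta0_is_binseq Delta0_decode Delta0_subst1[of I, OF I] Delta0_subst1[of N, OF N]
          Delta0_subst3[of C, OF C])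
    then show "T \<in> Sets M" unfolding T_def by (rule Sets_D0)
  next
    fix \<sigma> assume "\<sigma> \<in> T"
    then show "\<exists>l. is_binseq \<sigma> l" unfolding T_def by blast
  next
    fix \<sigma> l \<tau> k
    assume \<sigma>: "\<sigma> \<in> T" "is_binseq \<sigma> l" and "k \<preceq> l" and \<tau>: "is_binseq \<tau> k"
      and eq: "\<forall>i. i \<prec> k \<longrightarrow> entry \<tau> i = entry \<sigma> i"
    have seqs: "is_seq \<sigma> l" "is_seq \<tau> k" using \<sigma>(2) \<tau> unfolding is_binseq_def by blast+
    have kl: "i \<prec> l" if "i \<prec> k" for i using that \<open>k \<preceq> l\<close> by (rule prec_leq_trans)
    have B: "B \<tau> i \<longleftrightarrow> B \<sigma> i" if "i \<prec> k" for i
      unfolding B_def seq_entry_iff[OF seqs(1) kl[OF that]] seq_entry_iff[OF seqs(2) that]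
      using eq that by simp
    have "K l \<sigma>" using TD \<sigma>(1) seqs(1) by blast
    then have "K k \<sigma>" unfolding K_def using kl by meson
    then have "K k \<tau>" unfolding K_def using B by simp
    with \<tau> show "\<tau> \<in> T" by (rule TI)
  qed
  moreover have "infinite_set T"
    unfolding infinite_set_def
  proof
    fix n
    obtain X where X: "Delta0 (\<lambda>e. X (e 0))" "\<forall>z. z \<prec> n \<longrightarrow> (I z \<longrightarrow> X z) \<and> (N z \<longrightarrow> \<not> X z)"
      "\<forall>u v z. u \<prec> n \<longrightarrow> v \<prec> n \<longrightarrow> z \<prec> n \<longrightarrow> C u v z \<longrightarrow> X v \<or> \<not> X z"
      using fin[of n] by blast
    \<comment> \<open>The characteristic sequence of the finite approximation X will be a node of
      length n.\<close>
    have "\<exists>\<sigma>. is_seq \<sigma> n \<and> (\<forall>i. i \<prec> n \<longrightarrow> X i \<and> entry \<sigma> i = \<one> \<or> \<not> X i \<and> entry \<sigma> i = \<zero>)"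
    proof (rule exists_seq[of "\<lambda>i j. X i \<and> j = \<one> \<or> \<not> X i \<and> j = \<zero>" n \<one>])
      show "Delta0 (\<lambda>e. X (e (Suc 0)) \<and> e 0 = \<one> \<or> \<not> X (e (Suc 0)) \<and> e 0 = \<zero>)"
        by (intro Delta0_basic term_intros Delta0_subst1[of X, OF X(1)])
    qed (auto simp: leq_refl zero_leq)
    then obtain \<sigma> where \<sigma>: "is_seq \<sigma> n"
      "\<And>i. i \<prec> n \<Longrightarrow> X i \<and> entry \<sigma> i = \<one> \<or> \<not> X i \<and> entry \<sigma> i = \<zero>" by blast
    then have bin: "is_binseq \<sigma> n" unfolding is_binseq_def by blast
    have "B \<sigma> i \<longleftrightarrow> X i" if "i \<prec> n" for i
      unfolding B_def seq_entry_iff[OF \<sigma>(1) that] using \<sigma>(2)[OF that] one_neq_zero by auto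
    with X(2,3) have "K n \<sigma>" unfolding K_def by simp
    with bin have "\<sigma> \<in> T" by (rule TI)
    moreover have "n \<preceq> \<sigma>" using \<sigma>(1) by (rule seq_length_leq)
    ultimately show "\<exists>\<sigma>\<in>T. n \<preceq> \<sigma>" by blast
  qed
  ultimately obtain F where F: "is_path F T" using \<open>weak_koenig\<close> unfolding weak_koenig_def by blast
  define X where "X = {z. pair z \<one> \<in> F}"
  have "F \<in> Sets M" and total: "\<And>i. \<exists>!j. pair i j \<in> F" using F unfolding is_path_def is_fun_def by blast+
  then have "X \<in> Sets M" unfolding X_def by (intro Sets_D0 Delta0_basic term_intros term_pair)
  have path: "\<exists>\<sigma>. K n \<sigma> \<and> (\<forall>z. z \<prec> n \<longrightarrow> (B \<sigma> z \<longleftrightarrow> z \<in> X))" for n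
  proof -
    obtain \<sigma> where \<sigma>: "\<sigma> \<in> T" "is_seq \<sigma> n" "\<forall>i. i \<prec> n \<longrightarrow> pair i (entry \<sigma> i) \<in> F"
      using F unfolding is_path_def by blast
    have "B \<sigma> z \<longleftrightarrow> z \<in> X" if "z \<prec> n" for z
      unfolding B_def seq_entry_iff[OF \<sigma>(2) that] X_def mem_Collect_eq using \<sigma>(3) that total by metis
    with TD(2)[OF \<sigma>(1,2)] show ?thesis by blast
  qed
  show ?thesis
  proof (intro bexI[of _ X] conjI allI impI)
    fix z
    obtain \<sigma> where "K (z \<oplus> \<one>) \<sigma>" "B \<sigma> z \<longleftrightarrow> z \<in> X"
      using path[of "z \<oplus> \<one>"] prec_self_plus_one by blast
    then show "I z \<Longrightarrow> z \<in> X" "N z \<Longrightarrow> z \<notin> X"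
      unfolding K_def using prec_self_plus_one by blast+
  next
    fix u v z assume C: "C u v z"
    \<comment> \<open>A length above all three numbers, so that the clause is tested by the node of
      that length.\<close>
    define n where "n = (u \<oplus> v \<oplus> z) \<oplus> \<one>"
    have "u \<preceq> u \<oplus> v \<oplus> z" "v \<preceq> u \<oplus> v \<oplus> z" "z \<preceq> u \<oplus> v \<oplus> z"
      by (rule leq_trans[OF leq_plus(1) leq_plus(1)] leq_trans[OF leq_plus(2) leq_plus(1)] leq_plus(2))+
    then have less: "u \<prec> n" "v \<prec> n" "z \<prec> n" unfolding n_def prec_plus_one_iff .
    obtain \<sigma> where "K n \<sigma>" "B \<sigma> v \<longleftrightarrow> v \<in> X" "B \<sigma> z \<longleftrightarrow> z \<in> X"
      using path[of n] less by blast
    with C less show "v \<in> X \<or> z \<notin> X" unfolding K_def by blast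
  qed (rule \<open>X \<in> Sets M\<close>)
qed

lemma Delta0_subst4:
  assumes "Delta0 (\<lambda>e. P (e (Suc (Suc (Suc 0)))) (e (Suc (Suc 0))) (e (Suc 0)) (e 0))"
    and "is_term f" "is_term g" "is_term h" "is_term k"
  shows "Delta0 (\<lambda>e. P (f e) (g e) (h e) (k e))"
proof -
  have eq: "(\<lambda>e. P (f e) (g e) (h e) (k e)) = (\<lambda>e. \<exists>a. a \<prec> f e \<oplus> \<one> \<and> (a = f e \<and> P a (g e) (h e) (k e)))"
    using prec_self_plus_one by auto
  have "Delta0 (\<lambda>e. P (e 0) (g (\<lambda>i. e (Suc i))) (h (\<lambda>i. e (Suc i))) (k (\<lambda>i. e (Suc i))))"
  proof -
    have eq: "(\<lambda>e. P (e 0) (g (\<lambda>i. e (Suc i))) (h (\<lambda>i. e (Suc i))) (k (\<lambda>i. e (Suc i)))) =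
      (\<lambda>e. \<exists>b. b \<prec> g (\<lambda>i. e (Suc i)) \<oplus> \<one> \<and> (b = g (\<lambda>i. e (Suc i)) \<and>
       (\<exists>c. c \<prec> h (\<lambda>i. e (Suc i)) \<oplus> \<one> \<and> (c = h (\<lambda>i. e (Suc i)) \<and>
       (\<exists>d. d \<prec> k (\<lambda>i. e (Suc i)) \<oplus> \<one> \<and> (d = k (\<lambda>i. e (Suc i)) \<and> P (e 0) b c d))))))"
      using prec_self_plus_one by auto
    note s = assms(3-5)[THEN term_shift] assms(3-5)[THEN term_shift, THEN term_shift]
      assms(4,5)[THEN term_shift, THEN term_shift, THEN term_shift]
      assms(5)[THEN term_shift, THEN term_shift, THEN term_shift, THEN term_shift]
    show ?thesis unfolding eq by (intro Delta0_basic term_intros s assms(1))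
  qed
  then show ?thesis unfolding eq by (intro Delta0_basic term_intros term_shift assms(2))
qed

text \<open>In P the indices 1, 0 and 2 stand for a, b and d; index 3 is the intermediate pair of a
  and b.\<close>

lemma Delta0_exfrac:
  assumes "is_term f" "Delta0 (\<lambda>e. P (e (Suc 0)) (e 0) (e (Suc (Suc 0))) (\<lambda>i. e (Suc (Suc (Suc (Suc i))))))"
  shows "Delta0 (\<lambda>e. \<exists>a b d. f e = pair (pair a b) d \<and> P a b d e)"
proof -
  have eq: "(\<lambda>e. \<exists>a b d. f e = pair (pair a b) d \<and> P a b d e) =
     (\<lambda>e. \<exists>l d. f e = pair l d \<and> (\<exists>a b. l = pair a b \<and> P a b d e))"
    by metis
  show ?thesis unfolding eq by (intro Delta0_expair term_intros assms)
qed

section \<open>Rationals\<close>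

lemma frac_code_eq_iff: "frac_code t = frac_code t' \<longleftrightarrow> t = t'"
  by (cases t; cases t') (simp add: pair_eq_iff)

lemma frac_eq_refl: "frac_eq t t"
  by (cases t) simp

lemma frac_eq_sym: "frac_eq t u \<Longrightarrow> frac_eq u t"
  by (cases t; cases u) (simp add: ring_nf)

text \<open>Scale the two equations by d'' and d and add them; the common summand and the middle
  denominator d' cancel.\<close>

lemma frac_eq_trans:
  assumes "frac_eq t u" "frac_eq u v" "is_frac u"
  shows "frac_eq t v"
proof -
  obtain a b d a' b' d' a'' b'' d''
    where [simp]: "t = (a, b, d)" "u = (a', b', d')" "v = (a'', b'', d'')"
    by (cases t; cases u; cases v) blast
  have 1: "a \<otimes> d' \<oplus> b' \<otimes> d = a' \<otimes> d \<oplus> b \<otimes> d'" and 2: "a' \<otimes> d'' \<oplus> b'' \<otimes> d' = a'' \<otimes> d' \<oplus> b' \<otimes> d''"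
    and "d' \<noteq> \<zero>"
    using assms by simp_all
  have "d' \<otimes> (a \<otimes> d'' \<oplus> b'' \<otimes> d) \<oplus> (b' \<otimes> d \<otimes> d'' \<oplus> a' \<otimes> d \<otimes> d'') =
     (a \<otimes> d' \<oplus> b' \<otimes> d) \<otimes> d'' \<oplus> (a' \<otimes> d'' \<oplus> b'' \<otimes> d') \<otimes> d"
    by (simp add: ring_nf)
  also have "\<dots> = d' \<otimes> (a'' \<otimes> d \<oplus> b \<otimes> d'') \<oplus> (b' \<otimes> d \<otimes> d'' \<oplus> a' \<otimes> d \<otimes> d'')"
    unfolding 1 2 by (simp add: ring_nf)
  finally show ?thesis
    using \<open>d' \<noteq> \<zero>\<close> by (simp add: plus_right_cancel times_cancel)
qed

lemma frac_less_eq_trans: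
  assumes "frac_less t u" "frac_eq u v" "is_frac u" "is_frac v"
  shows "frac_less t v"
proof -
  obtain a b d a' b' d' a'' b'' d''
    where [simp]: "t = (a, b, d)" "u = (a', b', d')" "v = (a'', b'', d'')"
    by (cases t; cases u; cases v) blast
  have 1: "a \<otimes> d' \<oplus> b' \<otimes> d \<prec> a' \<otimes> d \<oplus> b \<otimes> d'" and 2: "a' \<otimes> d'' \<oplus> b'' \<otimes> d' = a'' \<otimes> d' \<oplus> b' \<otimes> d''"
    and "d' \<noteq> \<zero>" "d'' \<noteq> \<zero>"
    using assms by simp_all
  have "d' \<otimes> (a \<otimes> d'' \<oplus> b'' \<otimes> d) \<oplus> (b' \<otimes> d \<otimes> d'' \<oplus> a' \<otimes> d \<otimes> d'') =
     d'' \<otimes> (a \<otimes> d' \<oplus> b' \<otimes> d) \<oplus> (a' \<otimes> d'' \<oplus> b'' \<otimes> d') \<otimes> d"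
    by (simp add: ring_nf)
  also have "\<dots> \<prec> d'' \<otimes> (a' \<otimes> d \<oplus> b \<otimes> d') \<oplus> (a' \<otimes> d'' \<oplus> b'' \<otimes> d') \<otimes> d"
    unfolding plus_prec_cancel times_prec_cancel[OF \<open>d'' \<noteq> \<zero>\<close>] by (rule 1)
  also have "\<dots> = d' \<otimes> (a'' \<otimes> d \<oplus> b \<otimes> d'') \<oplus> (b' \<otimes> d \<otimes> d'' \<oplus> a' \<otimes> d \<otimes> d'')"
    unfolding 2 by (simp add: ring_nf)
  finally show ?thesis
    using \<open>d' \<noteq> \<zero>\<close> by (simp add: plus_prec_cancel times_prec_cancel)
qed

lemma frac_minus_less: "frac_less (frac_minus u) (frac_minus t) \<longleftrightarrow> frac_less t u"
  by (cases t; cases u) (simp add: ring_nf)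

lemma frac_minus_eq: "frac_eq (frac_minus u) (frac_minus t) \<longleftrightarrow> frac_eq u t"
  by (cases t; cases u) (auto simp add: ring_nf)

lemma is_frac_minus: "is_frac (frac_minus t) \<longleftrightarrow> is_frac t"
  by (cases t) simp

lemma is_frac_add: "is_frac t \<Longrightarrow> is_frac u \<Longrightarrow> is_frac (frac_add t u)"
  by (cases t; cases u) (simp add: times_nonzero)

text \<open>The right side is replaced by \<open>frac_less_eq_trans\<close>, the left side by the
  same lemma after passing to negatives, which reverses the order.\<close>

lemma frac_less_cong:
  assumes "frac_eq t t'" "frac_eq u u'" "is_frac t" "is_frac t'" "is_frac u" "is_frac u'"
  shows "frac_less t u \<longleftrightarrow> frac_less t' u'"
proof -
  have *: "frac_less t' u'" if "frac_less t u" "frac_eq t t'" "frac_eq u u'"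
    "is_frac t" "is_frac t'" "is_frac u" "is_frac u'" for t t' u u'
  proof -
    have "frac_less t u'" using frac_less_eq_trans that by blast
    then have "frac_less (frac_minus u') (frac_minus t)" unfolding frac_minus_less .
    then have "frac_less (frac_minus u') (frac_minus t')"
      by (rule frac_less_eq_trans) (simp_all add: frac_minus_eq is_frac_minus that)
    then show ?thesis unfolding frac_minus_less .
  qed
  show ?thesis using *[of t u t' u'] *[of t' u' t u] assms frac_eq_sym by blast
qed

lemma frac_add_cong:
  assumes "frac_eq t t'" "frac_eq u u'"
  shows "frac_eq (frac_add t u) (frac_add t' u')"
proof -
  obtain a b d a' b' d' where [simp]: "t = (a, b, d)" "t' = (a', b', d')"
    by (cases t; cases t') blast
  obtain x y z x' y' z' where [simp]: "u = (x, y, z)" "u' = (x', y', z')"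
    by (cases u; cases u') blast
  have 1: "a \<otimes> d' \<oplus> b' \<otimes> d = a' \<otimes> d \<oplus> b \<otimes> d'" and 2: "x \<otimes> z' \<oplus> y' \<otimes> z = x' \<otimes> z \<oplus> y \<otimes> z'"
    using assms by simp_all
  have "(a \<otimes> z \<oplus> x \<otimes> d) \<otimes> (d' \<otimes> z') \<oplus> (b' \<otimes> z' \<oplus> y' \<otimes> d') \<otimes> (d \<otimes> z) =
      z \<otimes> z' \<otimes> (a \<otimes> d' \<oplus> b' \<otimes> d) \<oplus> d \<otimes> d' \<otimes> (x \<otimes> z' \<oplus> y' \<otimes> z)"
    by (simp add: ring_nf)
  also have "\<dots> = (a' \<otimes> z' \<oplus> x' \<otimes> d') \<otimes> (d \<otimes> z) \<oplus> (b \<otimes> z \<oplus> y \<otimes> d) \<otimes> (d' \<otimes> z')"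
    unfolding 1 2 by (simp add: ring_nf)
  finally show ?thesis by simp
qed

lemma frac_of_frac_code: "is_frac t \<Longrightarrow> frac_of (frac_code t) = t"
  unfolding frac_of_def by (rule the_equality) (auto simp: frac_code_eq_iff)

lemma is_rat_frac_of:
  assumes "is_rat c"
  shows "is_frac (frac_of c)" "frac_code (frac_of c) = c"
    "\<And>t. is_frac t \<Longrightarrow> frac_eq t (frac_of c) \<Longrightarrow> c \<preceq> frac_code t"
proof -
  obtain u where u: "is_frac u" "c = frac_code u"
    and least: "\<And>t. is_frac t \<Longrightarrow> frac_eq t u \<Longrightarrow> c \<preceq> frac_code t"
    using assms unfolding is_rat_def not_prec by blast
  have c: "frac_of c = u" unfolding u(2) using u(1) by (rule frac_of_frac_code)
  show "is_frac (frac_of c)" "frac_code (frac_of c) = c" unfolding c using u by blast+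
  show "c \<preceq> frac_code t" if "is_frac t" "frac_eq t (frac_of c)" for t
    using least that unfolding c by blast
qed

lemma is_rat_unique:
  assumes "is_rat c" "is_rat c'" "frac_eq (frac_of c) (frac_of c')"
  shows "c = c'"
  using is_rat_frac_of(3)[OF assms(1) is_rat_frac_of(1)[OF assms(2)]]
    is_rat_frac_of(3)[OF assms(2) is_rat_frac_of(1)[OF assms(1)]]
    frac_eq_sym assms is_rat_frac_of(2) leq_antisym by simp

lemma exists_rat:
  assumes "is_frac t"
  shows "\<exists>c. is_rat c \<and> frac_eq (frac_of c) t"
proof -
  obtain a b d where t: "t = (a, b, d)" by (cases t)
  \<comment> \<open>Coding a fraction equivalent to t is a \<open>Delta0\<close> property, so there
    is a least such code.\<close>
  define Q where "Q c \<longleftrightarrow> (\<exists>a' b' d'. c = pair (pair a' b') d' \<and> (d' \<noteq> \<zero> \<and>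
     a' \<otimes> d \<oplus> b \<otimes> d' = a \<otimes> d' \<oplus> b' \<otimes> d))" for c
  have Q: "Q c \<longleftrightarrow> (\<exists>t'. is_frac t' \<and> c = frac_code t' \<and> frac_eq t' t)" for c
    unfolding Q_def t by auto
  have "Delta0 (\<lambda>e. Q (e 0))" unfolding Q_def by (intro Delta0_exfrac Delta0_basic term_intros)
  moreover have "Q (frac_code t)" unfolding Q using assms frac_eq_refl by blast
  ultimately obtain c where c: "Q c" "\<And>c'. c' \<prec> c \<Longrightarrow> \<not> Q c'" using least_number by metis
  then obtain u where u: "is_frac u" "c = frac_code u" "frac_eq u t" unfolding Q by blast
  have "\<not> frac_code t' \<prec> c" if "is_frac t'" "frac_eq t' u" for t'
    using c(2) frac_eq_trans[OF that(2) u(3) u(1)] that(1) unfolding Q by blast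
  with u have "is_rat c" unfolding is_rat_def by blast
  moreover have "frac_of c = u" unfolding u(2) by (rule frac_of_frac_code[OF u(1)])
  ultimately show ?thesis using u(3) by (intro exI[of _ c]) simp
qed

lemma rat_of:
  assumes "is_frac t"
  shows "is_rat (rat_of t)" "frac_eq (frac_of (rat_of t)) t" "is_frac (frac_of (rat_of t))"
proof -
  have "\<exists>!c. is_rat c \<and> frac_eq (frac_of c) t"
    using exists_rat[OF assms] is_rat_unique frac_eq_trans[OF _ frac_eq_sym assms] by metis
  from theI'[OF this] show "is_rat (rat_of t)" "frac_eq (frac_of (rat_of t)) t"
    unfolding rat_of_def by blast+
  then show "is_frac (frac_of (rat_of t))" using is_rat_frac_of(1) by blast
qed

lemma rat_of_frac_of: "is_rat c \<Longrightarrow> rat_of (frac_of c) = c"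
  by (rule is_rat_unique) (auto intro: rat_of is_rat_frac_of(1))

lemma rat_of_eq_iff:
  assumes "is_frac t" "is_frac t'"
  shows "rat_of t = rat_of t' \<longleftrightarrow> frac_eq t t'"
proof
  assume "rat_of t = rat_of t'"
  then show "frac_eq t t'"
    using frac_eq_trans[OF frac_eq_sym[OF rat_of(2)[OF assms(1)]], of t'] rat_of[OF assms(1)] rat_of[OF assms(2)]
    by simp
next
  assume *: "frac_eq t t'"
  have "frac_eq (frac_of (rat_of t)) t'"
    by (rule frac_eq_trans[OF rat_of(2)[OF assms(1)] * assms(1)])
  then have "frac_eq (frac_of (rat_of t)) (frac_of (rat_of t'))"
    by (rule frac_eq_trans[OF _ frac_eq_sym[OF rat_of(2)[OF assms(2)]] assms(2)])
  then show "rat_of t = rat_of t'" by (rule is_rat_unique[OF rat_of(1)[OF assms(1)] rat_of(1)[OF assms(2)]])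
qed

lemma rat_less_rat_of: "is_frac t \<Longrightarrow> is_frac t' \<Longrightarrow> rat_of t <\<^sub>q rat_of t' \<longleftrightarrow> frac_less t t'"
  unfolding rat_less_def by (intro frac_less_cong rat_of)

lemma rat_add_rat_of: "is_frac t \<Longrightarrow> is_frac t' \<Longrightarrow> rat_add (rat_of t) (rat_of t') = rat_of (frac_add t t')"
  unfolding rat_add_def 
  by (rule rat_of_eq_iff[THEN iffD2]) (simp_all add: is_frac_add frac_add_cong rat_of)

lemma rat_minus_rat_of: "is_frac t \<Longrightarrow> rat_minus (rat_of t) = rat_of (frac_minus t)"
  unfolding rat_minus_def 
  by (rule rat_of_eq_iff[THEN iffD2]) (simp_all add: is_frac_minus frac_minus_eq rat_of)

text \<open>The workhorse for rational arithmetic: over one denominator D, order, sum and negation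
  become linear conditions on numerators, to be settled by \<open>lin_prec\<close> and
  \<open>lin_leq\<close>.\<close>

definition rat :: "'a \<Rightarrow> 'a \<Rightarrow> 'a \<Rightarrow> 'a" where
  "rat D a b = rat_of (a, b, D)"

lemma rat_Rats: "D \<noteq> \<zero> \<Longrightarrow> rat D a b \<in> Rats"
  unfolding rat_def Rats_def by (simp add: rat_of)

lemma rat_eq_iff: "D \<noteq> \<zero> \<Longrightarrow> rat D a b = rat D a' b' \<longleftrightarrow> a \<oplus> b' = a' \<oplus> b"
  using times_cancel[of D "a \<oplus> b'" "a' \<oplus> b"]
  by (simp add: rat_def rat_of_eq_iff times_commute[of _ D] flip: times_plus)

lemma rat_less_iff: "D \<noteq> \<zero> \<Longrightarrow> rat D a b <\<^sub>q rat D a' b' \<longleftrightarrow> a \<oplus> b' \<prec> a' \<oplus> b"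
  using times_prec_cancel[of D "a \<oplus> b'" "a' \<oplus> b"]
  by (simp add: rat_def rat_less_rat_of times_commute[of _ D] flip: times_plus)

lemma rat_le_iff: "D \<noteq> \<zero> \<Longrightarrow> rat D a b \<le>\<^sub>q rat D a' b' \<longleftrightarrow> a \<oplus> b' \<preceq> a' \<oplus> b"
  by (simp add: rat_le_def rat_less_iff rat_eq_iff leq_def)

lemma rat_scale: "D \<noteq> \<zero> \<Longrightarrow> c \<noteq> \<zero> \<Longrightarrow> rat (D \<otimes> c) (a \<otimes> c) (b \<otimes> c) = rat D a b"
  by (simp add: rat_def rat_of_eq_iff times_nonzero ring_nf)

lemma rat_add: "D \<noteq> \<zero> \<Longrightarrow> rat_add (rat D a b) (rat D a' b') = rat D (a \<oplus> a') (b \<oplus> b')"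
  by (simp add: rat_def rat_add_rat_of rat_of_eq_iff times_nonzero ring_nf)

lemma rat_minus: "D \<noteq> \<zero> \<Longrightarrow> rat_minus (rat D a b) = rat D b a"
  by (simp add: rat_def rat_minus_rat_of)

lemma rat_nat: "D \<noteq> \<zero> \<Longrightarrow> rat_nat k = rat D (k \<otimes> D) \<zero>"
  by (simp add: rat_def rat_nat_def rat_of_eq_iff one_neq_zero ring_nf)

lemma exists_rat_denominator: "p \<in> Rats \<Longrightarrow> \<exists>D a b. D \<noteq> \<zero> \<and> p = rat D a b"
proof -
  assume "p \<in> Rats"
  then have p: "is_rat p" by (simp add: Rats_def)
  obtain a b d where f: "frac_of p = (a, b, d)" by (cases "frac_of p")
  then have "p = rat d a b" "d \<noteq> \<zero>"
    using rat_of_frac_of[OF p] is_rat_frac_of(1)[OF p] by (simp_all add: rat_def)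
  then show ?thesis by blast
qed

text \<open>S is finite in the sense of HOL, not of the model, so ordinary induction applies: one
  denominator is multiplied in at a time.\<close>

lemma common_denominator:
  assumes "finite S" "S \<subseteq> Rats"
  shows "\<exists>D. D \<noteq> \<zero> \<and> (\<forall>p \<in> S. \<exists>a b. p = rat D a b)"
  using assms
proof induction
  case empty
  then show ?case using one_neq_zero by blast
next
  case (insert p S)
  then obtain D where D: "D \<noteq> \<zero>" "\<forall>p \<in> S. \<exists>a b. p = rat D a b" by auto
  obtain E a b where E: "E \<noteq> \<zero>" "p = rat E a b" using insert.prems exists_rat_denominator by blast
  have "p = rat (D \<otimes> E) (a \<otimes> D) (b \<otimes> D)"
    using rat_scale[OF E(1) D(1)] E by (simp add: times_commute[of D])
  moreover have "\<exists>a b. q = rat (D \<otimes> E) a b" if "q \<in> S" for q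
    using D that rat_scale[OF D(1) E(1)] by metis
  ultimately show ?case using times_nonzero[OF D(1) E(1)] by blast
qed

text \<open>A rational is the least code among its fractions. This bounds quantifiers over values of
  \<open>rat\<close>, which is not a term.\<close>

lemma rat_leq_code:
  assumes "D \<noteq> \<zero>"
  shows "rat D a b \<preceq> pair (pair a b) D"
proof -
  have "is_frac (a, b, D)" using assms by simp
  from is_rat_frac_of(3)[OF rat_of(1)[OF this] this frac_eq_sym[OF rat_of(2)[OF this]]]
  show ?thesis by (simp add: rat_def)
qed

lemma Delta0_is_rat: "is_term f \<Longrightarrow> Delta0 (\<lambda>e. f e \<in> Rats)"
proof (rule Delta0_subst1)
  have "is_rat c \<longleftrightarrow> (\<exists>a b d. c = pair (pair a b) d \<and> (d \<noteq> \<zero> \<and> (\<forall>c'. c' \<prec> c \<longrightarrow>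
     \<not> (\<exists>a' b' d'. c' = pair (pair a' b') d' \<and> (d' \<noteq> \<zero> \<and> a' \<otimes> d \<oplus> b \<otimes> d' = a \<otimes> d' \<oplus> b' \<otimes> d)))))" for c
    unfolding is_rat_def by fastforce
  then have eq: "c \<in> Rats \<longleftrightarrow> (\<exists>a b d. c = pair (pair a b) d \<and> (d \<noteq> \<zero> \<and> (\<forall>c'. c' \<prec> c \<longrightarrow>
     \<not> (\<exists>a' b' d'. c' = pair (pair a' b') d' \<and> (d' \<noteq> \<zero> \<and> a' \<otimes> d \<oplus> b \<otimes> d' = a \<otimes> d' \<oplus> b' \<otimes> d)))))" for c
    unfolding Rats_def by simp
  show "Delta0 (\<lambda>e. e 0 \<in> Rats)" unfolding eq by (intro Delta0_exfrac Delta0_basic term_intros)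
qed

lemma Rats_frac_of: "p \<in> Rats \<Longrightarrow> frac_of p = (a, b, d) \<longleftrightarrow> p = pair (pair a b) d"
  using is_rat_frac_of[of p] frac_code_eq_iff[of "frac_of p" "(a, b, d)"] by (simp add: Rats_def)

lemma Delta0_rat:
  assumes "D \<noteq> \<zero>" "is_term f" "is_term g" "is_term h"
  shows "Delta0 (\<lambda>e. f e = rat D (g e) (h e))"
proof (rule Delta0_subst3[of "\<lambda>p a b. p = rat D a b", OF _ assms(2-4)])
  \<comment> \<open>The fraction coded by p is unique, so it can be read off and compared with (a,
    b, D) by cross-multiplication.\<close>
  have eq: "p = rat D a b \<longleftrightarrow> p \<in> Rats \<and> (\<exists>a' b' d'. p = pair (pair a' b') d' \<and>
      a' \<otimes> D \<oplus> b \<otimes> d' = a \<otimes> d' \<oplus> b' \<otimes> D)" for p a b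
  proof (cases "p \<in> Rats")
    case True
    obtain a' b' d' where f: "frac_of p = (a', b', d')" by (cases "frac_of p")
    with True have "is_frac (a', b', d')" "rat_of (a', b', d') = p"
      using is_rat_frac_of(1)[of p] rat_of_frac_of[of p] by (simp_all add: Rats_def)
    then have "p = rat D a b \<longleftrightarrow> a' \<otimes> D \<oplus> b \<otimes> d' = a \<otimes> d' \<oplus> b' \<otimes> D"
      using rat_of_eq_iff[of "(a', b', d')" "(a, b, D)"] assms(1) by (simp add: rat_def)
    with True f show ?thesis by (simp add: Rats_frac_of pair_eq_iff)
  qed (use rat_Rats[OF assms(1)] in auto)
  show "Delta0 (\<lambda>e. e (Suc (Suc 0)) = rat D (e (Suc 0)) (e 0))" unfolding eq
    by (intro Delta0_exfrac Delta0_basic term_intros Delta0_is_rat)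
qed

text \<open>All order relations that enter the formulas reduce to this one, \<open>rless\<close>
  among them. The arguments are confined to \<open>Rats\<close> because \<open>frac_of\<close> may
  be undetermined elsewhere.\<close>

definition sum_less :: "'a \<Rightarrow> 'a \<Rightarrow> 'a \<Rightarrow> 'a \<Rightarrow> bool" where
  "sum_less p q r s \<longleftrightarrow> p \<in> Rats \<and> q \<in> Rats \<and> r \<in> Rats \<and> s \<in> Rats \<and> rat_add p q <\<^sub>q rat_add r s"

lemma Delta0_sum_less:
  assumes "is_term f" "is_term g" "is_term h" "is_term k"
  shows "Delta0 (\<lambda>e. sum_less (f e) (g e) (h e) (k e))"
proof (rule Delta0_subst4[of sum_less, OF _ assms])
  have eq: "sum_less p q r s \<longleftrightarrow> p \<in> Rats \<and> q \<in> Rats \<and> r \<in> Rats \<and> s \<in> Rats \<and>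
      (\<exists>a b d. p = pair (pair a b) d \<and> (\<exists>a' b' d'. q = pair (pair a' b') d' \<and>
      (\<exists>x y z. r = pair (pair x y) z \<and> (\<exists>x' y' z'. s = pair (pair x' y') z' \<and>
       (a \<otimes> d' \<oplus> a' \<otimes> d) \<otimes> (z \<otimes> z') \<oplus> (y \<otimes> z' \<oplus> y' \<otimes> z) \<otimes> (d \<otimes> d') \<prec>
       (x \<otimes> z' \<oplus> x' \<otimes> z) \<otimes> (d \<otimes> d') \<oplus> (b \<otimes> d' \<oplus> b' \<otimes> d) \<otimes> (z \<otimes> z')))))" for p q r s
  proof (cases "p \<in> Rats \<and> q \<in> Rats \<and> r \<in> Rats \<and> s \<in> Rats")
    case True
    obtain a b d where p: "frac_of p = (a, b, d)" by (cases "frac_of p")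
    obtain a' b' d' where q: "frac_of q = (a', b', d')" by (cases "frac_of q")
    obtain x y z where r: "frac_of r = (x, y, z)" by (cases "frac_of r")
    obtain x' y' z' where s: "frac_of s = (x', y', z')" by (cases "frac_of s")
    have "is_frac (frac_add (frac_of p) (frac_of q))" "is_frac (frac_add (frac_of r) (frac_of s))"
      using True is_rat_frac_of(1) by (simp_all add: is_frac_add Rats_def)
    then have "rat_add p q <\<^sub>q rat_add r s \<longleftrightarrow>
      frac_less (frac_add (frac_of p) (frac_of q)) (frac_add (frac_of r) (frac_of s))"
      unfolding rat_add_def by (rule rat_less_rat_of)
    moreover have "p = pair (pair a b) d" "q = pair (pair a' b') d'" "r = pair (pair x y) z" "s = pair (pair x' y') z'"
      using True p q r s Rats_frac_of by auto
    ultimately show ?thesis using True unfolding sum_less_def p q r s by (simp add: pair_eq_iff)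
  qed (auto simp: sum_less_def)
  show "Delta0 (\<lambda>e. sum_less (e (Suc (Suc (Suc 0)))) (e (Suc (Suc 0))) (e (Suc 0)) (e 0))"
    unfolding eq by (intro Delta0_exfrac Delta0_basic term_intros Delta0_is_rat)
qed

section \<open>Order, density and linear estimates for rationals\<close>

lemma rat_add_Rats: "p \<in> Rats \<Longrightarrow> q \<in> Rats \<Longrightarrow> rat_add p q \<in> Rats"
  using is_rat_frac_of(1) by (simp add: rat_add_def Rats_def rat_of is_frac_add)

lemma rat_minus_Rats: "p \<in> Rats \<Longrightarrow> rat_minus p \<in> Rats"
  using is_rat_frac_of(1) by (simp add: rat_minus_def Rats_def rat_of is_frac_minus)

lemma rat_nat_Rats: "rat_nat k \<in> Rats"
  by (simp add: rat_nat_def Rats_def rat_of one_neq_zero)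

lemma rats2:
  assumes "p \<in> Rats" "q \<in> Rats"
  obtains D a b a' b' where "D \<noteq> \<zero>" "p = rat D a b" "q = rat D a' b'"
  using common_denominator[of "{p, q}"] assms by auto

lemma rats3:
  assumes "p \<in> Rats" "q \<in> Rats" "r \<in> Rats"
  obtains D a b a' b' c d where "D \<noteq> \<zero>" "p = rat D a b" "q = rat D a' b'" "r = rat D c d"
  using common_denominator[of "{p, q, r}"] assms by auto

lemma rats5:
  assumes "p \<in> Rats" "q \<in> Rats" "r \<in> Rats" "s \<in> Rats" "t \<in> Rats"
  obtains D a b a' b' c d c' d' x y where "D \<noteq> \<zero>" "p = rat D a b" "q = rat D a' b'"
    "r = rat D c d" "s = rat D c' d'" "t = rat D x y"
  using common_denominator[of "{p, q, r, s, t}"] assms by auto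

lemma rats6:
  assumes "p \<in> Rats" "q \<in> Rats" "r \<in> Rats" "s \<in> Rats" "t \<in> Rats" "u \<in> Rats"
  obtains D a b a' b' c d c' d' x y x' y' where "D \<noteq> \<zero>" "p = rat D a b" "q = rat D a' b'"
    "r = rat D c d" "s = rat D c' d'" "t = rat D x y" "u = rat D x' y'"
  using common_denominator[of "{p, q, r, s, t, u}"] assms by auto

lemma rat_zero: "D \<noteq> \<zero> \<Longrightarrow> rat_nat \<zero> = rat D \<zero> \<zero>"
  by (simp add: rat_nat zero_times)

lemma rat_less_irrefl: "p \<in> Rats \<Longrightarrow> \<not> p <\<^sub>q p"
  by (rule rats2[of p p]) (simp_all add: rat_less_iff prec_irrefl)

lemma rat_less_trans:
  assumes "p \<in> Rats" "q \<in> Rats" "r \<in> Rats" "p <\<^sub>q q" "q <\<^sub>q r"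
  shows "p <\<^sub>q r"
  using assms(1-3)
proof (rule rats3)
  fix D a b a' b' c d
  assume [simp]: "D \<noteq> \<zero>" "p = rat D a b" "q = rat D a' b'" "r = rat D c d"
  have "a \<oplus> b' \<prec> a' \<oplus> b" "a' \<oplus> d \<prec> c \<oplus> b'" using assms(4,5) by (simp_all add: rat_less_iff)
  from lin_prec[OF plus_prec_mono[OF this], of "a \<oplus> d" "c \<oplus> b"] show ?thesis
    by (simp add: rat_less_iff ring_nf)
qed

lemma rat_linear: "p \<in> Rats \<Longrightarrow> q \<in> Rats \<Longrightarrow> p <\<^sub>q q \<or> p = q \<or> q <\<^sub>q p"
proof (erule (1) rats2)
  fix D a b a' b'
  assume "D \<noteq> \<zero>" "p = rat D a b" "q = rat D a' b'"
  then show ?thesis using prec_linear[of "a \<oplus> b'" "a' \<oplus> b"] by (simp add: rat_less_iff rat_eq_iff)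
qed

lemma not_rat_less:
  assumes "p \<in> Rats" "q \<in> Rats"
  shows "\<not> p <\<^sub>q q \<longleftrightarrow> q \<le>\<^sub>q p"
  using rat_linear[OF assms] rat_less_irrefl[OF assms(1)] rat_less_trans[OF assms assms(1)]
  unfolding rat_le_def by blast

lemma rat_dense:
  assumes "p \<in> Rats" "q \<in> Rats" "p <\<^sub>q q"
  shows "\<exists>r \<in> Rats. p <\<^sub>q r \<and> r <\<^sub>q q"
  using assms(1,2)
proof (rule rats2)
  fix D a b a' b'
  assume D: "D \<noteq> \<zero>" and [simp]: "p = rat D a b" "q = rat D a' b'"
  let ?D = "D \<otimes> (\<one> \<oplus> \<one>)"
  have E: "?D \<noteq> \<zero>" "\<one> \<oplus> \<one> \<noteq> \<zero>" using D plus_one_neq_zero times_nonzero by blast+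
  have less: "a \<oplus> b' \<prec> a' \<oplus> b" using assms(3) D by (simp add: rat_less_iff)
  have p: "p = rat ?D (a \<oplus> a) (b \<oplus> b)" and q: "q = rat ?D (a' \<oplus> a') (b' \<oplus> b')"
    using rat_scale[OF D E(2), of a b] rat_scale[OF D E(2), of a' b'] by (simp_all add: times_plus times_one)
  show ?thesis
  proof (intro bexI conjI)
    show "p <\<^sub>q rat ?D (a \<oplus> a') (b \<oplus> b')" unfolding p rat_less_iff[OF E(1)]
      by (rule lin_prec[OF less]) (simp add: ring_nf)
    show "rat ?D (a \<oplus> a') (b \<oplus> b') <\<^sub>q q" unfolding q rat_less_iff[OF E(1)]
      by (rule lin_prec[OF less]) (simp add: ring_nf)
  qed (rule rat_Rats[OF E(1)])
qed

lemma rat_minus_less_swap: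
  assumes "p \<in> Rats" "q \<in> Rats" "rat_minus p <\<^sub>q q"
  shows "rat_minus q <\<^sub>q p"
  using assms(1,2)
proof (rule rats2)
  fix D a b a' b'
  assume "D \<noteq> \<zero>" "p = rat D a b" "q = rat D a' b'"
  with assms(3) show ?thesis by (simp add: rat_less_iff rat_minus plus_commute)
qed

lemma rat_less_add_pos:
  assumes "p \<in> Rats" "q \<in> Rats" "rat_nat \<zero> <\<^sub>q q"
  shows "p <\<^sub>q rat_add p q"
  using assms(1,2)
proof (rule rats2)
  fix D a b a' b'
  assume [simp]: "D \<noteq> \<zero>" "p = rat D a b" "q = rat D a' b'"
  have "b' \<prec> a'" using assms(3) by (simp add: rat_zero[of D] rat_less_iff ring_nf)
  from lin_prec[OF this, of "a \<oplus> (b \<oplus> b')" "a \<oplus> a' \<oplus> b"] show ?thesis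
    by (simp add: rat_less_iff rat_add ring_nf)
qed

definition rless :: "'a \<Rightarrow> 'a \<Rightarrow> bool" where
  "rless p q \<longleftrightarrow> sum_less p (rat_nat \<zero>) q (rat_nat \<zero>)"

lemma rat_add_zero: "p \<in> Rats \<Longrightarrow> rat_add p (rat_nat \<zero>) = p"
proof (rule rats2[of p p])
  fix D a b a' b' assume "D \<noteq> \<zero>" "p = rat D a b"
  then show ?thesis by (simp add: rat_zero[of D] rat_add plus_zero)
qed

lemma rless_iff: "rless p q \<longleftrightarrow> p \<in> Rats \<and> q \<in> Rats \<and> p <\<^sub>q q"
  unfolding rless_def sum_less_def using rat_nat_Rats rat_add_zero by auto

lemma Delta0_rless: "is_term f \<Longrightarrow> is_term g \<Longrightarrow> Delta0 (\<lambda>e. rless (f e) (g e))"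
  unfolding rless_def by (intro Delta0_sum_less term_intros)

lemma unit_rats_iff: "p \<in> unit_rats \<longleftrightarrow> p \<in> Rats \<and> \<not> rless p (rat_nat \<zero>) \<and> \<not> rless (rat_nat \<one>) p"
  by (auto simp: unit_rats_def rless_iff rat_nat_Rats not_rat_less)

lemma Delta0_unit_rats: "is_term f \<Longrightarrow> Delta0 (\<lambda>e. f e \<in> unit_rats)"
  unfolding unit_rats_iff by (intro Delta0_basic Delta0_is_rat Delta0_rless term_intros)

text \<open>Sum of a \<le> q, q < r and -s < v. In use, q and r are upper bounds of f y, s is one of
  -f x, while v \<le> f x and a \<le> f y.\<close>

lemma increment_bound:
  assumes "a \<in> Rats" "q \<in> Rats" "r \<in> Rats" "s \<in> Rats" "v \<in> Rats"
    and "\<not> q <\<^sub>q a" "q <\<^sub>q r" "rat_minus s <\<^sub>q v"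
  shows "rat_add a (rat_nat \<zero>) <\<^sub>q rat_add v (rat_add r s)"
  using assms(1-5)
proof (rule rats5)
  fix D a1 a2 q1 q2 r1 r2 s1 s2 v1 v2
  assume [simp]: "D \<noteq> \<zero>" "a = rat D a1 a2" "q = rat D q1 q2" "r = rat D r1 r2" "s = rat D s1 s2" "v = rat D v1 v2"
  have "a1 \<oplus> q2 \<preceq> q1 \<oplus> a2" "q1 \<oplus> r2 \<prec> r1 \<oplus> q2" "s2 \<oplus> v2 \<prec> v1 \<oplus> s1"
    using assms(6-8) by (simp_all add: rat_less_iff rat_minus not_prec)
  from plus_leq_prec_mono[OF this(1) plus_prec_mono[OF this(2,3)]] show ?thesis
    by (simp add: rat_zero[of D] rat_less_iff rat_add) (erule lin_prec, simp add: ring_nf)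
qed

text \<open>From -s < r + c \<le> 0 it follows that s > r + c, so c' = s - r exceeds c and hence -u.
  The purpose is to show that no element \<le> 0 lies in the cuts of both a difference and its
  negative.\<close>

lemma real_diff_upward:
  assumes "r \<in> Rats" "c \<in> Rats" "s \<in> Rats" "u \<in> Rats"
    and "rat_minus u <\<^sub>q c" "\<not> rat_nat \<zero> <\<^sub>q rat_add r c" "rat_minus s <\<^sub>q rat_add r c"
  shows "\<exists>c' \<in> Rats. s = rat_add r c' \<and> rat_minus u <\<^sub>q c'"
  using assms(1-4,1)
proof (rule rats5)
  fix D r1 r2 c1 c2 s1 s2 u1 u2 x y
  assume [simp]: "D \<noteq> \<zero>" "r = rat D r1 r2" "c = rat D c1 c2" "s = rat D s1 s2" "u = rat D u1 u2"
  have 1: "u2 \<oplus> c2 \<prec> c1 \<oplus> u1" "r1 \<oplus> c1 \<preceq> r2 \<oplus> c2" "s2 \<oplus> (r2 \<oplus> c2) \<prec> (r1 \<oplus> c1) \<oplus> s1"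
    using assms(5-7) by (simp_all add: rat_zero[of D] rat_less_iff rat_minus rat_add not_prec ring_nf)
  \<comment> \<open>s - r + u equals (s + r + c) + (c + u) - 2 (r + c), hence the second inequality
    is used twice.\<close>
  note 2 = plus_leq_prec_mono[OF 1(2) plus_leq_prec_mono[OF 1(2) plus_prec_mono[OF 1(1,3)]]]
  show ?thesis
  proof (intro bexI conjI)
    show "s = rat_add r (rat D (s1 \<oplus> r2) (s2 \<oplus> r1))" by (simp add: rat_add rat_eq_iff ring_nf)
    show "rat_minus u <\<^sub>q rat D (s1 \<oplus> r2) (s2 \<oplus> r1)"
      by (simp add: rat_minus rat_less_iff) (rule lin_prec[OF 2], simp add: ring_nf)
  qed (simp add: rat_Rats)
qed

lemma slope_refl:
  assumes "a \<in> Rats" "d \<in> Rats" "w \<in> Rats" "\<not> d <\<^sub>q a"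
  shows "\<not> rat_add w d <\<^sub>q rat_add a w"
  using assms(1-3)
proof (rule rats3)
  fix D a1 a2 d1 d2 w1 w2
  assume [simp]: "D \<noteq> \<zero>" "a = rat D a1 a2" "d = rat D d1 d2" "w = rat D w1 w2"
  have "a1 \<oplus> d2 \<preceq> d1 \<oplus> a2" using assms(4) by (simp add: rat_less_iff not_prec)
  then show ?thesis by (simp add: rat_less_iff rat_add not_prec) (erule lin_leq, simp add: ring_nf)
qed

text \<open>The induction step along the grid: w is the partial sum and c the next increment; v and
  a are lower bounds of f at the old and the new point; u and d are the partial sum and an upper
  bound of f at the starting point.\<close>

lemma slope_step:
  assumes "a \<in> Rats" "v \<in> Rats" "c \<in> Rats" "w \<in> Rats" "d \<in> Rats" "u \<in> Rats"
    and "rat_add a (rat_nat \<zero>) <\<^sub>q rat_add v c" "\<not> rat_add w d <\<^sub>q rat_add v u"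
  shows "\<not> rat_add (rat_add w c) d <\<^sub>q rat_add a u"
  using assms(1-6)
proof (rule rats6)
  fix D a1 a2 v1 v2 c1 c2 w1 w2 d1 d2 u1 u2
  assume [simp]: "D \<noteq> \<zero>" "a = rat D a1 a2" "v = rat D v1 v2" "c = rat D c1 c2" "w = rat D w1 w2"
    "d = rat D d1 d2" "u = rat D u1 u2"
  have "a1 \<oplus> (v2 \<oplus> c2) \<preceq> v1 \<oplus> c1 \<oplus> a2" "v1 \<oplus> u1 \<oplus> (w2 \<oplus> d2) \<preceq> w1 \<oplus> d1 \<oplus> (v2 \<oplus> u2)"
    using assms(7,8) by (simp_all add: rat_zero[of D] rat_less_iff rat_add not_prec plus_zero prec_leq)
  from plus_leq_mono[OF this] show ?thesis
    by (simp add: rat_less_iff rat_add not_prec) (erule lin_leq, simp add: ring_nf)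
qed

text \<open>Passes from the exact grid values v of g x and w of g y to rationals b \<le> v and c > w
  around them.\<close>

lemma slope_clause:
  assumes "a \<in> Rats" "b \<in> Rats" "c \<in> Rats" "d \<in> Rats" "v \<in> Rats" "w \<in> Rats"
    and "\<not> rat_add w d <\<^sub>q rat_add a v" "\<not> v <\<^sub>q b" "w <\<^sub>q c"
  shows "\<not> rat_add c d <\<^sub>q rat_add a b"
  using assms(1-6)
proof (rule rats6)
  fix D a1 a2 b1 b2 c1 c2 d1 d2 v1 v2 w1 w2
  assume [simp]: "D \<noteq> \<zero>" "a = rat D a1 a2" "b = rat D b1 b2" "c = rat D c1 c2" "d = rat D d1 d2"
    "v = rat D v1 v2" "w = rat D w1 w2"
  have "a1 \<oplus> v1 \<oplus> (w2 \<oplus> d2) \<preceq> w1 \<oplus> d1 \<oplus> (a2 \<oplus> v2)" "b1 \<oplus> v2 \<preceq> v1 \<oplus> b2" "w1 \<oplus> c2 \<preceq> c1 \<oplus> w2"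
    using assms(7-9) by (simp_all add: rat_less_iff rat_add not_prec prec_leq)
  from plus_leq_mono[OF this(1) plus_leq_mono[OF this(2,3)]] show ?thesis
    by (simp add: rat_less_iff rat_add not_prec) (erule lin_leq, simp add: ring_nf)
qed

lemma exists_third_of_gap:
  assumes "q \<in> Rats" "r \<in> Rats" "s \<in> Rats" "b \<in> Rats"
    and "q <\<^sub>q r" "rat_minus s <\<^sub>q b"
  shows "\<exists>\<epsilon> \<in> Rats. rat_nat \<zero> <\<^sub>q \<epsilon> \<and>
    rat_add q (rat_add \<epsilon> (rat_add \<epsilon> \<epsilon>)) <\<^sub>q rat_add (rat_add r s) b"
  using assms(1-4,1)
proof (rule rats5)
  fix D q1 q2 r1 r2 s1 s2 b1 b2 x y
  assume D: "D \<noteq> \<zero>" and [simp]: "q = rat D q1 q2" "r = rat D r1 r2" "s = rat D s1 s2" "b = rat D b1 b2"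
  \<comment> \<open>Distinct numerators over D differ by at least one, so r + s + b exceeds q by at
    least 1/D. With \<epsilon> = 1/(4D), three \<epsilon> stay strictly below this gap.\<close>
  let ?four = "\<one> \<oplus> \<one> \<oplus> \<one> \<oplus> \<one>"
  have E: "?four \<noteq> \<zero>" "D \<otimes> ?four \<noteq> \<zero>" using D plus_one_neq_zero times_nonzero by blast+
  have "q1 \<oplus> r2 \<prec> r1 \<oplus> q2" "s2 \<oplus> b2 \<prec> b1 \<oplus> s1"
    using assms(5,6) D by (simp_all add: rat_less_iff rat_minus)
  then have "(q1 \<oplus> r2) \<oplus> \<one> \<preceq> r1 \<oplus> q2" "s2 \<oplus> b2 \<preceq> b1 \<oplus> s1"
    by (simp_all only: plus_one_leq_iff prec_leq)
  then have "(q1 \<oplus> r2) \<oplus> \<one> \<oplus> (s2 \<oplus> b2) \<preceq> r1 \<oplus> q2 \<oplus> (b1 \<oplus> s1)" by (rule plus_leq_mono)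
  then have gap: "?four \<otimes> ((q1 \<oplus> r2) \<oplus> \<one> \<oplus> (s2 \<oplus> b2)) \<preceq> ?four \<otimes> (r1 \<oplus> q2 \<oplus> (b1 \<oplus> s1))"
    unfolding times_leq_cancel[OF E(1)] .
  have eqs: "q = rat (D \<otimes> ?four) (q1 \<otimes> ?four) (q2 \<otimes> ?four)" "r = rat (D \<otimes> ?four) (r1 \<otimes> ?four) (r2 \<otimes> ?four)"
    "s = rat (D \<otimes> ?four) (s1 \<otimes> ?four) (s2 \<otimes> ?four)" "b = rat (D \<otimes> ?four) (b1 \<otimes> ?four) (b2 \<otimes> ?four)"
    using rat_scale[OF D E(1)] by simp_all
  show ?thesis
  proof (intro bexI[of _ "rat (D \<otimes> ?four) \<one> \<zero>"] conjI)
    show "rat_nat \<zero> <\<^sub>q rat (D \<otimes> ?four) \<one> \<zero>"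
      using one_neq_zero by (simp add: rat_zero[OF E(2)] rat_less_iff[OF E(2)] zero_prec_iff plus_zero)
    show "rat_add q (rat_add (rat (D \<otimes> ?four) \<one> \<zero>) (rat_add (rat (D \<otimes> ?four) \<one> \<zero>) (rat (D \<otimes> ?four) \<one> \<zero>)))
      <\<^sub>q rat_add (rat_add r s) b"
      unfolding eqs rat_add[OF E(2)] rat_less_iff[OF E(2)]
      by (rule lin_prec[OF leq_prec_trans[OF gap prec_self_plus_one]]) (simp add: ring_nf)
  qed (rule rat_Rats[OF E(2)])
qed

lemma split_above_slope:
  assumes "q \<in> Rats" "r \<in> Rats" "s \<in> Rats" "b \<in> Rats" "\<epsilon> \<in> Rats" "x \<in> Rats"
    and "rat_nat \<zero> <\<^sub>q \<epsilon>" "rat_add q (rat_add \<epsilon> (rat_add \<epsilon> \<epsilon>)) <\<^sub>q rat_add (rat_add r s) b"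
  shows "\<exists>a \<in> Rats. \<exists>r' \<in> Rats. \<exists>s' \<in> Rats. rat_add r' s' = rat_add r s \<and> a <\<^sub>q r' \<and>
    rat_minus x <\<^sub>q s' \<and> rat_add q (rat_add x \<epsilon>) <\<^sub>q rat_add a b"
  using assms(1-6)
proof (rule rats6)
  fix D q1 q2 r1 r2 s1 s2 b1 b2 e1 e2 x1 x2
  assume [simp]: "D \<noteq> \<zero>" "q = rat D q1 q2" "r = rat D r1 r2" "s = rat D s1 s2" "b = rat D b1 b2"
    "\<epsilon> = rat D e1 e2" "x = rat D x1 x2"
  have pos: "e2 \<prec> e1"
    using assms(7) by (simp add: rat_zero[of D] rat_less_iff plus_zero zero_plus)
  have gap: "q1 \<oplus> (e1 \<oplus> (e1 \<oplus> e1)) \<oplus> (r2 \<oplus> s2 \<oplus> b2) \<prec> r1 \<oplus> s1 \<oplus> b1 \<oplus> (q2 \<oplus> (e2 \<oplus> (e2 \<oplus> e2)))"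
    using assms(8) by (simp add: rat_less_iff rat_add)
  \<comment> \<open>a = r + s + x - 2\<epsilon>, r' = r + s + x - \<epsilon> and s' = \<epsilon> -
    x. The last inequality to be shown is then the gap of three \<epsilon>.\<close>
  let ?a = "rat D (r1 \<oplus> s1 \<oplus> x1 \<oplus> e2 \<oplus> e2) (r2 \<oplus> s2 \<oplus> x2 \<oplus> e1 \<oplus> e1)"
  let ?r = "rat D (r1 \<oplus> s1 \<oplus> x1 \<oplus> e2) (r2 \<oplus> s2 \<oplus> x2 \<oplus> e1)"
  let ?s = "rat D (e1 \<oplus> x2) (e2 \<oplus> x1)"
  have "rat_add ?r ?s = rat_add r s" by (simp add: rat_add rat_eq_iff ring_nf)
  moreover have "?a <\<^sub>q ?r"
    by (simp add: rat_less_iff) (rule lin_prec[OF pos], simp add: ring_nf)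
  moreover have "rat_minus x <\<^sub>q ?s"
    by (simp add: rat_less_iff rat_minus) (rule lin_prec[OF pos], simp add: ring_nf)
  moreover have "rat_add q (rat_add x \<epsilon>) <\<^sub>q rat_add ?a b"
    by (simp add: rat_less_iff rat_add) (rule lin_prec[OF gap], simp add: ring_nf)
  moreover have "?a \<in> Rats" "?r \<in> Rats" "?s \<in> Rats" by (simp_all add: rat_Rats)
  ultimately show ?thesis by blast
qed

text \<open>Walk upwards from a rational outside Z in steps of \<epsilon>. Some step must enter Z,
  since otherwise \<open>Delta0\<close> induction keeps the walk outside even beyond a member of
  Z.\<close>

lemma presentation_approx:
  assumes Z: "rational_presentation Z" and p: "p \<in> unit_rats" and \<epsilon>: "\<epsilon> \<in> Rats" "rat_nat \<zero> <\<^sub>q \<epsilon>"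
  shows "\<exists>x \<in> Rats. pair p x \<notin> Z \<and> pair p (rat_add x \<epsilon>) \<in> Z"
proof -
  obtain q q' where q: "q \<in> Rats" "q' \<in> Rats" "pair p q \<in> Z" "pair p q' \<notin> Z"
    using Z p unfolding rational_presentation_def by blast
  show ?thesis using q(1,2) \<epsilon>(1)
  proof (rule rats3)
    fix D q1 q2 a b e1 e2
    assume D: "D \<noteq> \<zero>" and [simp]: "q = rat D q1 q2" "q' = rat D a b" "\<epsilon> = rat D e1 e2"
    have "e2 \<prec> e1" using \<epsilon>(2) D by (simp add: rat_zero[of D] rat_less_iff plus_zero zero_plus)
    then obtain e where "e1 = e2 \<oplus> (e \<oplus> \<one>)" unfolding less_iff_plus ..
    then have step: "rat_add (rat D (a \<oplus> j \<otimes> (e \<oplus> \<one>)) b) \<epsilon> = rat D (a \<oplus> (j \<oplus> \<one>) \<otimes> (e \<oplus> \<one>)) b" for j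
      using D by (simp add: rat_add rat_eq_iff ring_nf)
    show ?thesis
    proof (rule ccontr)
      assume "\<not> ?thesis"
      then have *: "pair p (rat D (a \<oplus> (j \<oplus> \<one>) \<otimes> (e \<oplus> \<one>)) b) \<notin> Z"
        if "pair p (rat D (a \<oplus> j \<otimes> (e \<oplus> \<one>)) b) \<notin> Z" for j
        using that rat_Rats[OF D] step by metis
      define P where "P j \<longleftrightarrow> (\<exists>r. r \<prec> pair (pair (a \<oplus> j \<otimes> (e \<oplus> \<one>)) b) D \<oplus> \<one> \<and>
         (r = rat D (a \<oplus> j \<otimes> (e \<oplus> \<one>)) b \<and> \<not> pair p r \<in> Z))" for j
      have P: "P j \<longleftrightarrow> pair p (rat D (a \<oplus> j \<otimes> (e \<oplus> \<one>)) b) \<notin> Z" for j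
        unfolding P_def prec_plus_one_iff using rat_leq_code[OF D] by blast
      have "Z \<in> Sets M" using Z unfolding rational_presentation_def by blast
      \<comment> \<open>Each step adds e + 1 \<ge> 1 to the numerator over D, so q1 + b + 1 steps
        lead past q.\<close>
      have "P (q1 \<oplus> b \<oplus> \<one>)"
      proof (rule Delta0_induct[of P])
        show "Delta0 (\<lambda>e. P (e 0))" unfolding P_def
          by (intro Delta0_basic term_intros term_pair Delta0_rat \<open>Z \<in> Sets M\<close> D)
        show "P \<zero>" unfolding P using q(4) by (simp add: zero_times plus_zero)
        show "P (n \<oplus> \<one>)" if "P n" for n using that unfolding P by (rule *)
      qed
      moreover have "q <\<^sub>q rat D (a \<oplus> (q1 \<oplus> b \<oplus> \<one>) \<otimes> (e \<oplus> \<one>)) b"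
      proof -
        have "(q1 \<oplus> b) \<oplus> \<one> \<preceq> (e \<oplus> \<one>) \<otimes> (q1 \<oplus> b \<oplus> \<one>)"
          by (rule leq_times) (rule plus_one_neq_zero)
        then have "q1 \<oplus> b \<prec> (q1 \<oplus> b \<oplus> \<one>) \<otimes> (e \<oplus> \<one>)"
          unfolding plus_one_leq_iff by (simp only: times_commute)
        also have "\<dots> \<preceq> (q1 \<oplus> b \<oplus> \<one>) \<otimes> (e \<oplus> \<one>) \<oplus> (a \<oplus> q2)" by (rule leq_plus)
        finally (prec_leq_trans) show ?thesis
          using D by (simp add: rat_less_iff plus_assoc plus_left_commute plus_commute)
      qed
      ultimately show False
        using q(1,3) p Z rat_Rats[OF D] unfolding P rational_presentation_def by blast
    qed
  qed
qed

section \<open>The majorant\<close>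

lemma unit_rats_Rats: "p \<in> unit_rats \<Longrightarrow> p \<in> Rats"
  by (simp add: unit_rats_def)

lemma not_less_less_trans:
  assumes "p \<in> Rats" "q \<in> Rats" "r \<in> Rats" "\<not> q <\<^sub>q p" "q <\<^sub>q r"
  shows "p <\<^sub>q r"
  using rat_linear[OF assms(1,2)] assms rat_less_trans[OF assms(1-3)] by blast

lemma rat_unit: "N \<noteq> \<zero> \<Longrightarrow> i \<preceq> N \<Longrightarrow> rat N i \<zero> \<in> unit_rats"
  by (simp add: unit_rats_iff rat_Rats rless_iff rat_nat[of N] rat_less_iff ring_nf not_prec zero_leq)

section \<open>Uniform grids\<close>

lemma exists_uniform_partition:
  assumes "N \<noteq> \<zero>"
  shows "\<exists>t. is_partition t N \<and> (\<forall>i. i \<preceq> N \<longrightarrow> entry t i = rat N i \<zero>)"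
proof -
  have "\<exists>t. is_seq t (N \<oplus> \<one>) \<and> (\<forall>i. i \<prec> N \<oplus> \<one> \<longrightarrow> entry t i = rat N i \<zero>)"
  proof (rule exists_seq[of "\<lambda>i r. r = rat N i \<zero>" "N \<oplus> \<one>" "pair (pair N \<zero>) N"])
    show "Delta0 (\<lambda>e. e 0 = rat N (e (Suc 0)) \<zero>)" by (intro Delta0_rat term_intros assms)
    show "j \<preceq> pair (pair N \<zero>) N" if "i \<prec> N \<oplus> \<one>" "j = rat N i \<zero>" for i j
      using leq_trans[OF rat_leq_code[OF assms] pair_mono[OF pair_mono[OF _ leq_refl] leq_refl]] that
      by (simp add: prec_plus_one_iff)
  qed simp
  then obtain t where t: "is_seq t (N \<oplus> \<one>)" "\<And>i. i \<preceq> N \<Longrightarrow> entry t i = rat N i \<zero>"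
    unfolding prec_plus_one_iff by blast
  have "is_partition t N"
    unfolding is_partition_def
  proof (intro conjI allI impI)
    show "entry t \<zero> = rat_nat \<zero>" using t(2)[OF zero_leq] assms by (simp add: rat_zero)
    show "entry t N = rat_nat \<one>" using t(2)[OF leq_refl] assms by (simp add: rat_nat[of N] one_times)
    fix i
    show "i \<preceq> N \<Longrightarrow> entry t i \<in> unit_rats" using t(2) rat_unit assms by simp
    show "entry t i <\<^sub>q entry t (i \<oplus> \<one>)" if "i \<prec> N"
      using t(2)[of i] t(2)[of "i \<oplus> \<one>"] prec_leq[OF that] that assms
      by (simp add: plus_one_leq_iff rat_less_iff plus_zero prec_self_plus_one)
  qed (rule t)
  with t(2) show ?thesis by blast
qed

text \<open>The denominator is at most the code p of the fraction, hence below n and a divisor of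
  N.\<close>

lemma unit_rat_on_grid:
  assumes "N \<noteq> \<zero>" and N: "\<And>d. d \<prec> n \<Longrightarrow> d \<noteq> \<zero> \<Longrightarrow> divides d N"
    and p: "p \<in> unit_rats" "p \<prec> n"
  shows "\<exists>i. i \<preceq> N \<and> p = rat N i \<zero>"
proof -
  obtain a b d where f: "frac_of p = (a, b, d)" by (cases "frac_of p")
  have rat_p: "is_rat p" "p \<in> Rats" using unit_rats_Rats[OF p(1)] by (simp_all add: Rats_def)
  have d: "d \<noteq> \<zero>" and eq: "p = rat d a b"
    using is_rat_frac_of(1)[OF rat_p(1)] rat_of_frac_of[OF rat_p(1)] by (simp_all add: f rat_def)
  have "p = pair (pair a b) d" using f Rats_frac_of[OF rat_p(2)] by blast
  then have "d \<prec> n" using leq_prec_trans[OF leq_pair(2)] p(2) by blast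
  then obtain m where m: "N = d \<otimes> m" using N d unfolding divides_def by blast
  then have "m \<noteq> \<zero>" using assms(1) by (auto simp: times_zero)
  then have eq: "p = rat N (a \<otimes> m) (b \<otimes> m)" using rat_scale[OF d] eq m by simp
  have le: "b \<otimes> m \<preceq> a \<otimes> m" "a \<otimes> m \<preceq> N \<oplus> b \<otimes> m"
    using p(1) assms(1) unfolding unit_rats_def eq
    by (simp_all add: rat_nat[of N] rat_le_iff zero_times one_times plus_zero zero_plus)
  then obtain i where i: "a \<otimes> m = b \<otimes> m \<oplus> i" unfolding leq_iff_plus by blast
  with le(2) have "i \<preceq> N" using plus_leq_cancel[of i "b \<otimes> m" N] by (simp add: plus_commute)
  moreover have "p = rat N i \<zero>" unfolding eq rat_eq_iff[OF assms(1)] i plus_zero by (rule plus_commute)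
  ultimately show ?thesis by blast
qed

text \<open>\<open>entry\<close> is a definite description and cannot occur in a formula. The left
  side is its bounded replacement; it holds vacuously past the end of the sequence.\<close>

lemma all_entry_iff:
  assumes "is_seq c l"
  shows "(\<forall>v. v \<prec> c \<longrightarrow> (pair j v \<in> decode c \<longrightarrow> Q v)) \<longleftrightarrow> (j \<prec> l \<longrightarrow> Q (entry c j))"
proof -
  have "v \<prec> c" if "pair j v \<in> decode c" for v
    using leq_prec_trans[OF leq_pair(2) decode_prec[OF that]] .
  then show ?thesis using seq_index[OF assms] seq_entry_iff[OF assms] by metis
qed

section \<open>Presentations as cuts, and increments of the presented function\<close>

lemma presentation_upward:
  "rational_presentation Z \<Longrightarrow> p \<in> unit_rats \<Longrightarrow> q \<in> Rats \<Longrightarrow> q' \<in> Rats \<Longrightarrow> q <\<^sub>q q' \<Longrightarrow>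
    pair p q \<in> Z \<Longrightarrow> pair p q' \<in> Z"
  unfolding rational_presentation_def by blast

lemma presentation_less:
  "rational_presentation Z \<Longrightarrow> p \<in> unit_rats \<Longrightarrow> q \<in> Rats \<Longrightarrow> q' \<in> Rats \<Longrightarrow>
    pair p q \<in> Z \<Longrightarrow> pair p q' \<notin> Z \<Longrightarrow> \<not> q <\<^sub>q q'"
  using presentation_upward by blast

lemma real_minus_presented_witness:
  assumes Z: "rational_presentation Z" and x: "x \<in> unit_rats" and s: "s \<in> real_minus (presented_fun Z x)"
  shows "\<exists>v \<in> Rats. rat_minus s <\<^sub>q v \<and> pair x v \<notin> Z"
proof -
  obtain u where u: "s \<in> Rats" "u \<in> Rats" "u \<notin> presented_fun Z x" "rat_minus u <\<^sub>q s"
    using s unfolding real_minus_def by blast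
  \<comment> \<open>u is at most the infimum but may itself belong to Z at x; a rational strictly
    below u is certainly outside.\<close>
  obtain v where v: "v \<in> Rats" "rat_minus s <\<^sub>q v" "v <\<^sub>q u"
    using rat_dense[OF rat_minus_Rats[OF u(1)] u(2) rat_minus_less_swap[OF u(2,1,4)]] by blast
  then have "pair x v \<notin> Z" using u unfolding presented_fun_def by blast
  with v show ?thesis by blast
qed

text \<open>The third conclusion expresses f y \<le> f x + c without naming either value: one lower
  bound v of f x serves all lower bounds a of f y.\<close>

lemma increment_properties:
  assumes Z: "rational_presentation Z" and x: "x \<in> unit_rats" and y: "y \<in> unit_rats"
    and c: "c \<in> real_abs (real_diff (presented_fun Z y) (presented_fun Z x))"
  shows "c \<in> Rats" "rat_nat \<zero> <\<^sub>q c"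
    "\<exists>v \<in> Rats. pair x v \<notin> Z \<and> (\<forall>a \<in> Rats. pair y a \<notin> Z \<longrightarrow> rat_add a (rat_nat \<zero>) <\<^sub>q rat_add v c)"
proof -
  let ?D = "real_diff (presented_fun Z y) (presented_fun Z x)"
  obtain r s where rs: "c = rat_add r s" "r \<in> presented_fun Z y" "s \<in> real_minus (presented_fun Z x)"
    using c unfolding real_abs_def real_diff_def real_add_def by blast
  obtain q where q: "r \<in> Rats" "q \<in> Rats" "pair y q \<in> Z" "q <\<^sub>q r"
    using rs(2) unfolding presented_fun_def by blast
  obtain u where u: "s \<in> Rats" "u \<in> Rats" "u \<notin> presented_fun Z x" "rat_minus u <\<^sub>q s"
    using rs(3) unfolding real_minus_def by blast
  show "c \<in> Rats" unfolding rs(1) using q(1) u(1) by (rule rat_add_Rats)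
  show "rat_nat \<zero> <\<^sub>q c"
  proof (rule ccontr)
    assume nonpos: "\<not> rat_nat \<zero> <\<^sub>q c"
    \<comment> \<open>c also lies in the cut of the negated difference, which gives z outside the
      cut of the difference; c \<le> 0 would put z inside.\<close>
    obtain z where z: "z \<in> Rats" "z \<notin> ?D" "rat_minus z <\<^sub>q c"
      using c unfolding real_abs_def real_minus_def[of ?D] by blast
    obtain s' where "s' \<in> Rats" "z = rat_add r s'" "rat_minus u <\<^sub>q s'"
      using real_diff_upward[OF q(1) u(1) z(1) u(2,4)] nonpos z(3) unfolding rs(1) by blast
    with rs(2) u z(2) show False unfolding real_diff_def real_add_def real_minus_def by blast
  qed
  obtain v where v: "v \<in> Rats" "rat_minus s <\<^sub>q v" "pair x v \<notin> Z"
    using real_minus_presented_witness[OF Z x rs(3)] by blast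
  have "rat_add a (rat_nat \<zero>) <\<^sub>q rat_add v c" if "a \<in> Rats" "pair y a \<notin> Z" for a
    unfolding rs(1)
    by (rule increment_bound[OF that(1) q(2,1) u(1) v(1) presentation_less[OF Z y q(2) that(1) q(3) that(2)] q(4) v(2)])
  with v show "\<exists>v \<in> Rats. pair x v \<notin> Z \<and> (\<forall>a \<in> Rats. pair y a \<notin> Z \<longrightarrow> rat_add a (rat_nat \<zero>) <\<^sub>q rat_add v c)"
    by blast
qed

lemma exists_finite_majorant:
  assumes Z: "rational_presentation Z"
    and var: "\<And>t n. is_partition t n \<Longrightarrow> variation (presented_fun Z) t n \<le>\<^sub>r real_nat k"
    and N: "N \<noteq> \<zero>"
  shows "\<exists>w. is_seq w (N \<oplus> \<one>) \<and> (\<forall>i. i \<preceq> N \<longrightarrow> entry w i \<in> Rats \<and> \<not> entry w i <\<^sub>q rat_nat \<zero> \<and>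
      entry w i <\<^sub>q rat_nat (k \<oplus> \<one>)) \<and>
    (\<forall>i j. i \<preceq> j \<longrightarrow> j \<preceq> N \<longrightarrow> \<not> entry w j <\<^sub>q entry w i \<and>
      (\<forall>a \<in> Rats. \<forall>d \<in> Rats. pair (rat N j \<zero>) a \<notin> Z \<longrightarrow> pair (rat N i \<zero>) d \<in> Z \<longrightarrow>
         \<not> rat_add (entry w j) d <\<^sub>q rat_add a (entry w i)))"
proof -
  obtain t where part: "is_partition t N" and t: "\<And>i. i \<preceq> N \<Longrightarrow> entry t i = rat N i \<zero>"
    using exists_uniform_partition[OF N] by blast
  \<comment> \<open>The hypothesis only gives variation \<le> k, so just the rationals strictly
    above k are known to lie in its upper cut; k + 1 is one of them.\<close>
  have "rat_nat (k \<oplus> \<one>) \<in> real_nat k"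
    unfolding real_nat_def using rat_nat_Rats one_neq_zero prec_self_plus_one
    by (simp add: rat_nat[of \<one>] rat_less_iff times_one plus_zero)
  then have "rat_nat (k \<oplus> \<one>) \<in> variation (presented_fun Z) t N"
    using var[OF part] unfolding real_le_def by blast
  then obtain c s where c: "is_seq c N" and incr: "\<And>i. i \<prec> N \<Longrightarrow> entry c i \<in>
      real_abs (real_diff (presented_fun Z (entry t (i \<oplus> \<one>))) (presented_fun Z (entry t i)))"
    and s: "rat_sum c N s" "s <\<^sub>q rat_nat (k \<oplus> \<one>)"
    unfolding variation_def real_sum_def by blast
  obtain w where w: "is_seq w (N \<oplus> \<one>)" and w0: "entry w \<zero> = rat_nat \<zero>"
    and wSuc: "\<And>i. i \<prec> N \<Longrightarrow> entry w (i \<oplus> \<one>) = rat_add (entry w i) (entry c i)" and wN: "entry w N = s"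
    using s(1) unfolding rat_sum_def by blast
  have c_props: "entry c i \<in> Rats" "rat_nat \<zero> <\<^sub>q entry c i"
    "\<exists>v \<in> Rats. pair (rat N i \<zero>) v \<notin> Z \<and> (\<forall>a \<in> Rats. pair (rat N (i \<oplus> \<one>) \<zero>) a \<notin> Z \<longrightarrow>
       rat_add a (rat_nat \<zero>) <\<^sub>q rat_add v (entry c i))" if "i \<prec> N" for i
  proof -
    have "i \<preceq> N" "i \<oplus> \<one> \<preceq> N" using that prec_leq plus_one_leq_iff by blast+
    then show "entry c i \<in> Rats" "rat_nat \<zero> <\<^sub>q entry c i"
      "\<exists>v \<in> Rats. pair (rat N i \<zero>) v \<notin> Z \<and> (\<forall>a \<in> Rats. pair (rat N (i \<oplus> \<one>) \<zero>) a \<notin> Z \<longrightarrow>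
       rat_add a (rat_nat \<zero>) <\<^sub>q rat_add v (entry c i))"
      using increment_properties[OF Z rat_unit[OF N] rat_unit[OF N], of i "i \<oplus> \<one>" "entry c i"]
        incr[OF that] t by simp_all
  qed
  \<comment> \<open>\<open>rat_sum\<close> does not say that the partial sums are rationals; this
    follows along w from the increments.\<close>
  have wRats: "entry w j \<in> Rats" if "j \<preceq> N" for j
  proof -
    define P where "P j \<longleftrightarrow> (\<forall>v. v \<prec> w \<longrightarrow> (pair j v \<in> decode w \<longrightarrow> v \<in> Rats))" for j
    have P: "P j \<longleftrightarrow> (j \<preceq> N \<longrightarrow> entry w j \<in> Rats)" for j
      unfolding P_def all_entry_iff[OF w] prec_plus_one_iff ..
    have "P j"
    proof (rule Delta0_induct[of P])
      show "Delta0 (\<lambda>e. P (e 0))" unfolding P_def by (intro Delta0_basic term_intros term_pair Delta0_decode Delta0_is_rat)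
      show "P \<zero>" unfolding P w0 using rat_nat_Rats by blast
      show "P (n \<oplus> \<one>)" if "P n" for n
        using that wSuc[of n] c_props(1)[of n] rat_add_Rats prec_leq[of n N] unfolding P plus_one_leq_iff by simp
    qed
    with that show ?thesis unfolding P by blast
  qed
  have wstep: "entry w j <\<^sub>q entry w (j \<oplus> \<one>)" if "j \<prec> N" for j
    using rat_less_add_pos[OF wRats c_props(1,2)] prec_leq that wSuc by simp
  have mono: "\<not> entry w j <\<^sub>q entry w i" if "i \<preceq> j" "j \<preceq> N" for i j
  proof -
    have i: "entry w i \<in> Rats" using wRats leq_trans that by blast
    define P where "P j \<longleftrightarrow> (\<forall>v. v \<prec> w \<longrightarrow> (pair j v \<in> decode w \<longrightarrow> (i \<preceq> j \<longrightarrow> \<not> rless v (entry w i))))" for j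
    have P: "P j \<longleftrightarrow> (j \<preceq> N \<longrightarrow> i \<preceq> j \<longrightarrow> \<not> entry w j <\<^sub>q entry w i)" for j
      unfolding P_def all_entry_iff[OF w] prec_plus_one_iff rless_iff using wRats i by blast
    have "P j"
    proof (rule Delta0_induct[of P])
      show "Delta0 (\<lambda>e. P (e 0))" unfolding P_def by (intro Delta0_basic term_intros term_pair Delta0_decode Delta0_rless)
      show "P \<zero>" unfolding P leq_zero_iff using rat_less_irrefl[OF i] by blast
      show "P (n \<oplus> \<one>)" if IH: "P n" for n
        unfolding P plus_one_leq_iff
      proof (intro impI notI)
        assume n: "n \<prec> N" and "i \<preceq> n \<oplus> \<one>" and less: "entry w (n \<oplus> \<one>) <\<^sub>q entry w i"
        have Rats: "entry w n \<in> Rats" "entry w (n \<oplus> \<one>) \<in> Rats"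
          using wRats n prec_leq plus_one_leq_iff by blast+
        from \<open>i \<preceq> n \<oplus> \<one>\<close> consider "i \<preceq> n" | "i = n \<oplus> \<one>" unfolding leq_def[of i "n \<oplus> \<one>"] prec_plus_one_iff by blast
        then show False
        proof cases
          case 1
          then have "\<not> entry w n <\<^sub>q entry w i" using IH n prec_leq unfolding P by blast
          then show False using rat_less_trans[OF Rats i wstep[OF n] less] by blast
        next
          case 2
          with less rat_less_irrefl[OF i] show False by blast
        qed
      qed
    qed
    with that show ?thesis unfolding P by blast
  qed
  have slope: "\<not> rat_add (entry w j) d <\<^sub>q rat_add a (entry w i)"
    if ij: "i \<preceq> j" "j \<preceq> N" and "a \<in> Rats" "d \<in> Rats" "pair (rat N j \<zero>) a \<notin> Z" "pair (rat N i \<zero>) d \<in> Z" for i j a d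
  proof -
    have iN: "i \<preceq> N" using ij leq_trans by blast
    then have i: "entry w i \<in> Rats" using wRats by blast
    have base: "\<not> rat_add (entry w i) d <\<^sub>q rat_add a (entry w i)"
      if "a \<in> Rats" "d \<in> Rats" "pair (rat N i \<zero>) a \<notin> Z" "pair (rat N i \<zero>) d \<in> Z" for a d
      by (rule slope_refl[OF that(1,2) i presentation_less[OF Z rat_unit[OF N iN] that(2,1,4,3)]])
    \<comment> \<open>m codes a counterexample (a, d) to the slope inequality from i/N to the point
      p with value v.\<close>
    define B where "B p v m \<longleftrightarrow> (\<exists>a d. m = pair a d \<and> (\<not> pair p a \<in> Z \<and>
      pair (rat N i \<zero>) d \<in> Z \<and> sum_less v d a (entry w i)))" for p v m
    \<comment> \<open>p and v are the entries of t and w at j. As bounded quantifiers they leave m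
      as the only variable to be quantified without a bound.\<close>
    define Q where "Q j m \<longleftrightarrow> (\<forall>p. p \<prec> t \<longrightarrow> (pair j p \<in> decode t \<longrightarrow>
      (\<forall>v. v \<prec> w \<longrightarrow> (pair j v \<in> decode w \<longrightarrow> (i \<preceq> j \<longrightarrow> \<not> B p v m)))))" for j m
    have tseq: "is_seq t (N \<oplus> \<one>)" using part unfolding is_partition_def by blast
    have Q: "Q j m \<longleftrightarrow> (i \<preceq> j \<longrightarrow> \<not> B (rat N j \<zero>) (entry w j) m)" if "j \<preceq> N" for j m
      unfolding Q_def all_entry_iff[OF w] all_entry_iff[OF tseq] prec_plus_one_iff using that t by simp
    have BD: "\<not> B p v m" if "\<And>a d. a \<in> Rats \<Longrightarrow> d \<in> Rats \<Longrightarrow> pair p a \<notin> Z \<Longrightarrow> pair (rat N i \<zero>) d \<in> Z \<Longrightarrow>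
        \<not> rat_add v d <\<^sub>q rat_add a (entry w i)" for p v m
      unfolding B_def sum_less_def using that by blast
    have "Q j (pair a d)"
    proof (rule Pi1_induct[of Q N])
      have "Z \<in> Sets M" using Z unfolding rational_presentation_def by blast
      then show "Delta0 (\<lambda>e. Q (e (Suc 0)) (e 0))" unfolding Q_def B_def
        by (intro Delta0_basic Delta0_expair term_intros term_pair Delta0_decode Delta0_sum_less)
      show "Q \<zero> m" for m
        unfolding Q[OF zero_leq] leq_zero_iff using BD[OF base] by blast
      fix n m
      assume n: "n \<prec> N" and IH: "\<And>m. Q n m"
      have n': "n \<preceq> N" "n \<oplus> \<one> \<preceq> N" using n prec_leq plus_one_leq_iff by blast+
      show "Q (n \<oplus> \<one>) m" unfolding Q[OF n'(2)]
      proof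
        assume "i \<preceq> n \<oplus> \<one>"
        then consider "i \<preceq> n" | "i = n \<oplus> \<one>" unfolding leq_def[of i "n \<oplus> \<one>"] prec_plus_one_iff by blast
        then show "\<not> B (rat N (n \<oplus> \<one>) \<zero>) (entry w (n \<oplus> \<one>)) m"
        proof cases
          case 1
          show ?thesis
          proof (rule BD)
            fix a d assume a: "a \<in> Rats" "pair (rat N (n \<oplus> \<one>) \<zero>) a \<notin> Z"
              and d: "d \<in> Rats" "pair (rat N i \<zero>) d \<in> Z"
            \<comment> \<open>The lower bound a at the new point is traded for v at the previous
              one, so the induction hypothesis is needed for all pairs and not only for (a,
              d).\<close>
            obtain v where v: "v \<in> Rats" "pair (rat N n \<zero>) v \<notin> Z"
              "rat_add a (rat_nat \<zero>) <\<^sub>q rat_add v (entry c n)"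
              using c_props(3)[OF n] a by blast
            have "\<not> B (rat N n \<zero>) (entry w n) (pair v d)" using IH Q[OF n'(1)] 1 by blast
            then have "\<not> rat_add (entry w n) d <\<^sub>q rat_add v (entry w i)"
              unfolding B_def sum_less_def using v(1,2) d wRats[OF n'(1)] i by blast
            then show "\<not> rat_add (entry w (n \<oplus> \<one>)) d <\<^sub>q rat_add a (entry w i)"
              unfolding wSuc[OF n]
              by (rule slope_step[OF a(1) v(1) c_props(1)[OF n] wRats[OF n'(1)] d(1) i v(3)])
          qed
        next
          case 2
          then show ?thesis using BD[OF base] by simp
        qed
      qed
    qed (rule ij(2))
    then have "\<not> B (rat N j \<zero>) (entry w j) (pair a d)" using Q[OF ij(2)] ij(1) by blast
    then show ?thesis
      unfolding B_def sum_less_def using that wRats i by blast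
  qed
  have "\<not> entry w i <\<^sub>q rat_nat \<zero>" "entry w i <\<^sub>q rat_nat (k \<oplus> \<one>)" if "i \<preceq> N" for i
  proof -
    show "\<not> entry w i <\<^sub>q rat_nat \<zero>" using mono[OF zero_leq that] unfolding w0 .
    show "entry w i <\<^sub>q rat_nat (k \<oplus> \<one>)"
      by (rule not_less_less_trans[OF wRats[OF that] wRats[OF leq_refl] rat_nat_Rats mono[OF that leq_refl]])
        (simp add: wN s(2))
  qed
  with w wRats mono slope show ?thesis by (intro exI[of _ w]) blast
qed

text \<open>Forces g \<le> k + 1 and, together with \<open>must_out\<close>, puts rationals on both
  sides of the cut at every point.\<close>

definition must_in :: "'a \<Rightarrow> 'a \<Rightarrow> bool" where
  "must_in k z \<longleftrightarrow> (\<exists>p q. z = pair p q \<and> (p \<in> unit_rats \<and> q \<in> Rats \<and> \<not> rless q (rat_nat (k \<oplus> \<one>))))"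

text \<open>Forces g \<ge> 0, and at the same time excludes all numbers that are not a point of the
  unit interval paired with a rational.\<close>

definition must_out :: "'a \<Rightarrow> bool" where
  "must_out z \<longleftrightarrow> \<not> (\<exists>p q. z = pair p q \<and> (p \<in> unit_rats \<and> q \<in> Rats \<and> \<not> rless q (rat_nat \<zero>)))"

text \<open>
  Points \<open>(x, b)\<close> outside and \<open>(y, c)\<close> inside a presentation of \<open>g\<close> mean \<open>b \<le> g x\<close> and \<open>g y \<le> c\<close>.  For
  \<open>x \<le> y\<close> this contradicts monotonicity if \<open>c < b\<close>, and it contradicts \<open>f y - f x \<le> g y - g x\<close> if
  \<open>c + d < a + b\<close> for some \<open>a \<le> f y\<close> and \<open>d \<ge> f x\<close>.
\<close>

definition conflict :: "'a set \<Rightarrow> 'a \<Rightarrow> 'a \<Rightarrow> 'a \<Rightarrow> bool" where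
  "conflict Z u v z \<longleftrightarrow> (\<exists>x b. v = pair x b \<and> (\<exists>y c. z = pair y c \<and>
     (x \<in> unit_rats \<and> y \<in> unit_rats \<and> b \<in> Rats \<and> c \<in> Rats \<and> \<not> rless y x \<and>
       (rless c b \<or> (\<exists>a d. u = pair a d \<and> (\<not> pair y a \<in> Z \<and> pair x d \<in> Z \<and> sum_less c d a b))))))"

lemma finite_satisfiability:
  assumes Z: "rational_presentation Z"
    and var: "\<And>t n. is_partition t n \<Longrightarrow> variation (presented_fun Z) t n \<le>\<^sub>r real_nat k"
  shows "\<exists>X. Delta0 (\<lambda>e. X (e 0)) \<and>
    (\<forall>z. z \<prec> n \<longrightarrow> (must_in k z \<longrightarrow> X z) \<and> (must_out z \<longrightarrow> \<not> X z)) \<and>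
    (\<forall>u v z. u \<prec> n \<longrightarrow> v \<prec> n \<longrightarrow> z \<prec> n \<longrightarrow> conflict Z u v z \<longrightarrow> X v \<or> \<not> X z)"
proof -
  obtain N where N: "N \<noteq> \<zero>" and div: "\<And>d. d \<prec> n \<Longrightarrow> d \<noteq> \<zero> \<Longrightarrow> divides d N"
    using common_multiple by metis
  obtain w where w: "is_seq w (N \<oplus> \<one>)"
    and val: "\<And>i. i \<preceq> N \<Longrightarrow> entry w i \<in> Rats \<and> \<not> entry w i <\<^sub>q rat_nat \<zero> \<and> entry w i <\<^sub>q rat_nat (k \<oplus> \<one>)"
    and mono: "\<And>i j. i \<preceq> j \<Longrightarrow> j \<preceq> N \<Longrightarrow> \<not> entry w j <\<^sub>q entry w i"
    and slope: "\<And>i j a d. i \<preceq> j \<Longrightarrow> j \<preceq> N \<Longrightarrow> a \<in> Rats \<Longrightarrow> d \<in> Rats \<Longrightarrow> pair (rat N j \<zero>) a \<notin> Z \<Longrightarrow>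
      pair (rat N i \<zero>) d \<in> Z \<Longrightarrow> \<not> rat_add (entry w j) d <\<^sub>q rat_add a (entry w i)"
    using exists_finite_majorant[OF Z var N] by metis
  \<comment> \<open>At a grid point X is the strict upper cut of the partial sum; elsewhere it is
    empty. It is given by a bounded formula with parameter w.\<close>
  define X where "X z \<longleftrightarrow> (\<exists>p q. z = pair p q \<and> (\<exists>i. i \<prec> N \<oplus> \<one> \<and> (p = rat N i \<zero> \<and>
     (\<exists>v. v \<prec> w \<and> (pair i v \<in> decode w \<and> rless v q)))))" for z
  have X: "X (pair (rat N i \<zero>) q) \<longleftrightarrow> entry w i <\<^sub>q q" if i: "i \<preceq> N" and q: "q \<in> Rats" for i q
  proof -
    have "rat N i \<zero> = rat N i' \<zero> \<longleftrightarrow> i = i'" for i'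
      by (simp add: rat_eq_iff N plus_zero)
    moreover have "pair i v \<in> decode w \<longleftrightarrow> entry w i = v" for v
      by (rule seq_entry_iff[OF w]) (simp add: prec_plus_one_iff i)
    moreover have "v \<prec> w" if "pair i v \<in> decode w" for v
      by (rule leq_prec_trans[OF leq_pair(2) decode_prec[OF that]])
    ultimately show ?thesis
      unfolding X_def pair_eq_iff prec_plus_one_iff rless_iff using i q val[OF i] by metis
  qed
  have X_form: "\<exists>i q. i \<preceq> N \<and> q \<in> Rats \<and> z = pair (rat N i \<zero>) q" if "X z" for z
    using that unfolding X_def prec_plus_one_iff rless_iff by blast
  have grid: "\<exists>i. i \<preceq> N \<and> p = rat N i \<zero>" if "p \<in> unit_rats" "pair p q \<prec> n" for p q
    by (rule unit_rat_on_grid[OF N div that(1) leq_prec_trans[OF leq_pair(1) that(2)]])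
  show ?thesis
  proof (intro exI[of _ X] conjI allI impI)
    show "Delta0 (\<lambda>e. X (e 0))" unfolding X_def
      by (intro Delta0_expair Delta0_basic Delta0_rat N term_intros term_pair Delta0_decode Delta0_rless)
  next
    fix z assume "z \<prec> n" "must_in k z"
    then obtain p q where z: "z = pair p q" "p \<in> unit_rats" "q \<in> Rats" "\<not> q <\<^sub>q rat_nat (k \<oplus> \<one>)"
      unfolding must_in_def rless_iff using rat_nat_Rats by blast
    then obtain i where i: "i \<preceq> N" "p = rat N i \<zero>" using grid \<open>z \<prec> n\<close> by blast
    have "entry w i <\<^sub>q q"
      using val[OF i(1)] z(3,4) rat_linear[OF z(3) rat_nat_Rats, of "k \<oplus> \<one>"] rat_less_trans[OF _ rat_nat_Rats z(3)]
      by blast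
    then show "X z" unfolding z(1) i(2) X[OF i(1) z(3)] .
  next
    fix z assume "must_out z"
    show "\<not> X z"
    proof
      assume "X z"
      then obtain i q where z: "i \<preceq> N" "q \<in> Rats" "z = pair (rat N i \<zero>) q" using X_form by blast
      with \<open>X z\<close> have less: "entry w i <\<^sub>q q" using X by blast
      have "\<not> q <\<^sub>q rat_nat \<zero>"
        using rat_less_trans[OF _ z(2) rat_nat_Rats less] val[OF z(1)] by blast
      with \<open>must_out z\<close> z rat_unit[OF N z(1)] show False unfolding must_out_def rless_iff by blast
    qed
  next
    fix u v z assume "u \<prec> n" and vz: "v \<prec> n" "z \<prec> n" and "conflict Z u v z"
    then obtain x b y c where v: "v = pair x b" and z: "z = pair y c" and xy: "x \<in> unit_rats" "y \<in> unit_rats"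
      and bc: "b \<in> Rats" "c \<in> Rats" and le: "\<not> y <\<^sub>q x" and
      cases: "c <\<^sub>q b \<or> (\<exists>a \<in> Rats. \<exists>d \<in> Rats. pair y a \<notin> Z \<and> pair x d \<in> Z \<and> rat_add c d <\<^sub>q rat_add a b)"
      unfolding conflict_def rless_iff sum_less_def using unit_rats_Rats by blast
    obtain i where i: "i \<preceq> N" "x = rat N i \<zero>" using grid xy(1) vz(1) unfolding v by blast
    obtain j where j: "j \<preceq> N" "y = rat N j \<zero>" using grid xy(2) vz(2) unfolding z by blast
    have ij: "i \<preceq> j" using le unfolding i(2) j(2) rat_less_iff[OF N] plus_zero not_prec .
    have i': "entry w i \<in> Rats" and j': "entry w j \<in> Rats" using val i(1) j(1) by blast+
    show "X v \<or> \<not> X z"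
      unfolding v z i(2) j(2) X[OF i(1) bc(1)] X[OF j(1) bc(2)]
    proof (rule ccontr)
      assume "\<not> (entry w i <\<^sub>q b \<or> \<not> entry w j <\<^sub>q c)"
      then have less: "\<not> entry w i <\<^sub>q b" "entry w j <\<^sub>q c" by blast+
      from cases show False
      proof (elim disjE bexE conjE)
        assume "c <\<^sub>q b"
        then have "entry w j <\<^sub>q b" using rat_less_trans[OF j' bc(2,1) less(2)] by blast
        then have "entry w i <\<^sub>q b" by (rule not_less_less_trans[OF i' j' bc(1) mono[OF ij j(1)]])
        with less(1) show False ..
      next
        fix a d assume "a \<in> Rats" "d \<in> Rats" "pair y a \<notin> Z" "pair x d \<in> Z" "rat_add c d <\<^sub>q rat_add a b"
        with slope_clause[OF \<open>a \<in> Rats\<close> bc \<open>d \<in> Rats\<close> i' j' _ less] slope[OF ij j(1)] i(2) j(2)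
        show False by blast
      qed
    qed
  qed
qed

lemma exists_majorant:
  assumes "weak_koenig" and Z: "rational_presentation Z"
    and var: "\<And>t n. is_partition t n \<Longrightarrow> variation (presented_fun Z) t n \<le>\<^sub>r real_nat k"
  shows "\<exists>X. rational_presentation X \<and> nondecreasing (presented_fun X) \<and>
    slope_le (presented_fun Z) (presented_fun X)"
proof -
  have "Z \<in> Sets M" using Z unfolding rational_presentation_def by blast
  have "Delta0 (\<lambda>e. must_in k (e 0))" unfolding must_in_def
    by (intro Delta0_expair Delta0_basic Delta0_unit_rats Delta0_is_rat Delta0_rless term_intros)
  moreover have "Delta0 (\<lambda>e. must_out (e 0))" unfolding must_out_def
    by (intro Delta0_expair Delta0_basic Delta0_unit_rats Delta0_is_rat Delta0_rless term_intros)
  moreover have "Delta0 (\<lambda>e. conflict Z (e (Suc (Suc 0))) (e (Suc 0)) (e 0))" unfolding conflict_def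
    by (intro Delta0_expair Delta0_basic Delta0_unit_rats Delta0_is_rat Delta0_rless Delta0_sum_less term_intros term_pair \<open>Z \<in> Sets M\<close>)
  ultimately obtain X where X: "X \<in> Sets M" and must_in: "\<And>z. must_in k z \<Longrightarrow> z \<in> X"
    and must_out: "\<And>z. must_out z \<Longrightarrow> z \<notin> X" and conflict: "\<And>u v z. conflict Z u v z \<Longrightarrow> v \<in> X \<or> z \<notin> X"
    using compactness[OF \<open>weak_koenig\<close> _ _ _ finite_satisfiability[OF Z var]] by blast
  have up: "pair x b \<in> X" if xy: "x \<in> unit_rats" "y \<in> unit_rats" "\<not> y <\<^sub>q x" and bc: "b \<in> Rats" "c \<in> Rats" "c <\<^sub>q b"
      and "pair y c \<in> X" for x y b c
  proof -
    \<comment> \<open>The monotonicity disjunct puts no condition on the witness u, so zero will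
      do.\<close>
    have "conflict Z \<zero> (pair x b) (pair y c)"
      unfolding conflict_def rless_iff using xy bc by blast
    with conflict \<open>pair y c \<in> X\<close> show ?thesis by blast
  qed
  have slope: "\<not> rat_add c d <\<^sub>q rat_add a b" if xy: "x \<in> unit_rats" "y \<in> unit_rats" "\<not> y <\<^sub>q x"
      and Rats: "a \<in> Rats" "b \<in> Rats" "c \<in> Rats" "d \<in> Rats"
      and "pair x b \<notin> X" "pair y c \<in> X" "pair y a \<notin> Z" "pair x d \<in> Z" for x y a b c d
  proof
    assume "rat_add c d <\<^sub>q rat_add a b"
    then have "conflict Z (pair a d) (pair x b) (pair y c)"
      unfolding conflict_def rless_iff sum_less_def using that by blast
    with conflict \<open>pair x b \<notin> X\<close> \<open>pair y c \<in> X\<close> show False by blast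
  qed
  have pres: "rational_presentation X"
    unfolding rational_presentation_def
  proof (intro conjI ballI impI)
    fix z assume "z \<in> X"
    then show "\<exists>p\<in>unit_rats. \<exists>q\<in>Rats. z = pair p q" using must_out unfolding must_out_def by blast
  next
    fix p assume p: "p \<in> unit_rats"
    have "pair p (rat_nat (k \<oplus> \<one>)) \<in> X"
      using p rat_nat_Rats rat_less_irrefl by (intro must_in) (auto simp: must_in_def rless_iff)
    \<comment> \<open>The rational \<open>rat \<one> \<zero> \<one>\<close> is -1.\<close>
    moreover have "rat \<one> \<zero> \<one> <\<^sub>q rat_nat \<zero>"
      using one_neq_zero by (simp add: rat_zero[of \<one>] rat_less_iff zero_plus zero_prec_iff)
    then have "pair p (rat \<one> \<zero> \<one>) \<notin> X"
      using rat_Rats[OF one_neq_zero] rat_nat_Rats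
      by (intro must_out) (auto simp: must_out_def rless_iff pair_eq_iff)
    ultimately show "\<exists>q\<in>Rats. \<exists>q'\<in>Rats. pair p q \<in> X \<and> pair p q' \<notin> X"
      using rat_Rats[OF one_neq_zero] rat_nat_Rats by blast
  next
    fix p q q' assume "p \<in> unit_rats" "q \<in> Rats" "q' \<in> Rats" "q <\<^sub>q q'" "pair p q \<in> X"
    \<comment> \<open>The monotonicity clause with x = y.\<close>
    then show "pair p q' \<in> X" using up[of p p q' q] rat_less_irrefl unit_rats_Rats by blast
  qed (rule X)
  moreover have "nondecreasing (presented_fun X)"
    unfolding nondecreasing_def real_le_def
  proof (intro ballI impI subsetI)
    fix x y r assume xy: "x \<in> unit_rats" "y \<in> unit_rats" "x <\<^sub>q y" and "r \<in> presented_fun X y"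
    then obtain q where q: "r \<in> Rats" "q \<in> Rats" "pair y q \<in> X" "q <\<^sub>q r" unfolding presented_fun_def by blast
    \<comment> \<open>The clause gives membership only strictly above q, and r must in turn lie
      strictly above a member; b is placed between the two.\<close>
    obtain b where b: "b \<in> Rats" "q <\<^sub>q b" "b <\<^sub>q r" using rat_dense[OF q(2,1,4)] by blast
    have "\<not> y <\<^sub>q x"
      using rat_less_trans[of x y x] rat_less_irrefl[of x] unit_rats_Rats xy by blast
    then have "pair x b \<in> X" using up[OF xy(1,2) _ b(1) q(2) b(2) q(3)] by blast
    with b q(1) show "r \<in> presented_fun X x" unfolding presented_fun_def by blast
  qed
  moreover have "slope_le (presented_fun Z) (presented_fun X)"
    unfolding slope_le_def real_le_def
  proof (intro ballI impI subsetI)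
    fix x y v assume xy: "x \<in> unit_rats" "y \<in> unit_rats" "x <\<^sub>q y"
      and "v \<in> real_diff (presented_fun X y) (presented_fun X x)"
    then obtain r s where v: "v = rat_add r s" and r: "r \<in> presented_fun X y"
      and s: "s \<in> real_minus (presented_fun X x)"
      unfolding real_diff_def real_add_def by blast
    obtain q where q: "r \<in> Rats" "q \<in> Rats" "pair y q \<in> X" "q <\<^sub>q r" using r unfolding presented_fun_def by blast
    have "s \<in> Rats" using s unfolding real_minus_def by blast
    obtain b where b: "b \<in> Rats" "rat_minus s <\<^sub>q b" "pair x b \<notin> X"
      using real_minus_presented_witness[OF pres xy(1) s] by blast
    \<comment> \<open>q < r and -s < b leave room between q and r + s + b. One \<epsilon> is spent
      on locating f x, the other two on the strict inequalities a < r' and -d < s'.\<close>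
    obtain \<epsilon> where \<epsilon>: "\<epsilon> \<in> Rats" "rat_nat \<zero> <\<^sub>q \<epsilon>"
      "rat_add q (rat_add \<epsilon> (rat_add \<epsilon> \<epsilon>)) <\<^sub>q rat_add (rat_add r s) b"
      using exists_third_of_gap[OF q(2,1) \<open>s \<in> Rats\<close> b(1) q(4) b(2)] by blast
    obtain d where d: "d \<in> Rats" "pair x d \<notin> Z" "pair x (rat_add d \<epsilon>) \<in> Z"
      using presentation_approx[OF Z xy(1) \<epsilon>(1,2)] by blast
    obtain a r' s' where a: "a \<in> Rats" "r' \<in> Rats" "s' \<in> Rats" "rat_add r' s' = rat_add r s"
      "a <\<^sub>q r'" "rat_minus d <\<^sub>q s'" "rat_add q (rat_add d \<epsilon>) <\<^sub>q rat_add a b"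
      using split_above_slope[OF q(2,1) \<open>s \<in> Rats\<close> b(1) \<epsilon>(1) d(1) \<epsilon>(2,3)] by blast
    have "\<not> y <\<^sub>q x"
      using rat_less_trans[of x y x] rat_less_irrefl[of x] unit_rats_Rats xy by blast
    \<comment> \<open>Otherwise (x, b) outside and (y, q) inside X would violate the slope clause
      witnessed by a and d + \<epsilon>.\<close>
    then have "pair y a \<in> Z"
      using slope[OF xy(1,2) _ a(1) b(1) q(2) rat_add_Rats[OF d(1) \<epsilon>(1)] b(3) q(3) _ d(3)] a(7) by blast
    with a have "r' \<in> presented_fun Z y" unfolding presented_fun_def by blast
    moreover have "d \<notin> presented_fun Z x"
      using presentation_upward[OF Z xy(1) _ d(1)] d(2) unfolding presented_fun_def by blast
    then have "s' \<in> real_minus (presented_fun Z x)" unfolding real_minus_def using a d(1) by blast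
    ultimately show "v \<in> real_diff (presented_fun Z y) (presented_fun Z x)"
      unfolding v a(4)[symmetric] real_diff_def real_add_def by blast
  qed
  ultimately show ?thesis by blast
qed

end

theorem theorem4p8:
  fixes M :: "'a l2_structure" and f :: "'a \<Rightarrow> 'a set"
  assumes "l2.WKL0 M"
    and "l2.rationally_presented M f"
    and "l2.bounded_variation M f"
  shows "\<exists>g. l2.rationally_presented M g \<and> l2.nondecreasing M g \<and> l2.slope_le M f g"
proof -
  interpret rca0 M
    using assms(1) by unfold_locales (simp add: l2.WKL0_def)
  obtain Z where Z: "rational_presentation Z" and f: "f = presented_fun Z"
    using assms(2) unfolding rationally_presented_def by blast
  obtain k where "\<And>t n. is_partition t n \<Longrightarrow> variation (presented_fun Z) t n \<le>\<^sub>r real_nat k"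
    using assms(3) unfolding bounded_variation_def f by blast
  moreover have "weak_koenig" using assms(1) unfolding WKL0_def by blast
  ultimately show ?thesis
    using exists_majorant[OF _ Z] unfolding rationally_presented_def f by blast
qed

end
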